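(* Let $\varphi\in\mathrm{LFM}(B_N)$ be hyperbolic and not an automorphism of $B_N$. If $\varphi$ has only one boundary fixed point (point of $\partial B_N$ fixed by $\varphi$), with boundary dilation coefficient $\alpha$, then the spectrum and the essential spectrum of $C_\varphi$ on $H^2(B_N)$ are both equal to the closed disk $\{\lambda\in\mathbb{C}:|\lambda|\le\alpha^{-N/2}\}$. Moreover, every point in the disk $|\lambda|<\alpha^{-N/2}$ is an eigenvalue of $C_\varphi$ of infinite multiplicity.
   Context: $B_N$ is the open Euclidean unit ball of $\mathbb{C}^N$; $H^2(B_N)$ is the classical Hardy space; $C_\varphi f=f\circ\varphi$ is the composition operator. $\mathrm{LFM}(B_N)$ is the set of linear fractional maps $\varphi(z)=\frac{Az+B}{\langle z,C\rangle+d}$ ($A\in\mathbb{C}^{N\times N}$, $B,C\in\mathbb{C}^N$, $d\in\mathbb{C}$) that map $B_N$ into itself; such maps extend holomorphically to a neighbourhood of $\overline{B_N}$, and $C_\varphi$ is bounded on $H^2(B_N)$. If $\varphi\in\mathrm{LFM}(B_N)$ has no fixed point in $B_N$, there is a unique $\tau\in\partial B_N$ (the Denjoy–Wolff point) with $\varphi(\tau)=\tau$ and $\langle d\varphi_\tau(\tau),\tau\rangle=\alpha$ with $0<\alpha\le1$; $\alpha$ is called the boundary dilation coefficient. $\varphi$ is hyperbolic if it has no fixed point in $B_N$ and $\alpha\in(0,1)$.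
   Formalization: The point λ = 0 is claimed to be an eigenvalue of infinite multiplicity only when φ is not injective on the ball; for injective φ (e.g. N = 1, φ(z) = sz + 1 − s, 0 < s < 1) the operator is injective and 0 is not an eigenvalue. *)

theory Defs
  imports "HOL-Analysis.Analysis" "HOL-Library.Function_Algebras"
begin

section \<open>Linear fractional maps of the unit ball of complex N-space\<close>

text \<open>Complex N-space is \<open>complex ^ 'n\<close> with N = \<open>CARD('n)\<close>; its \<open>norm\<close> is the Euclidean one, so
  \<open>ball 0 1\<close> is the Euclidean unit ball. The library's inner product on this type is the real one.\<close>

definition cinner :: "complex ^ 'n \<Rightarrow> complex ^ 'n \<Rightarrow> complex" where
  "cinner z w = (\<Sum>i\<in>UNIV. z $ i * cnj (w $ i))"

definition lin_frac ::
  "complex ^ 'n ^ 'n \<Rightarrow> complex ^ 'n \<Rightarrow> complex ^ 'n \<Rightarrow> complex \<Rightarrow> complex ^ 'n \<Rightarrow> complex ^ 'n" where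
  "lin_frac A B C d z = inverse (cinner z C + d) *s (A *v z + B)"

text \<open>The formula itself is used as the extension of the map beyond the ball. If its denominator
  vanishes somewhere on the unit sphere, then the map is constant on the ball (by boundedness), hence
  has a fixed point in the ball; so for maps without a fixed point in the ball the formula is the
  holomorphic extension to a neighbourhood of the closed ball.\<close>

definition LFM :: "(complex ^ 'n \<Rightarrow> complex ^ 'n) set" where
  "LFM = {\<phi>. \<exists>A B C d. \<phi> = lin_frac A B C d \<and>
                (\<forall>z\<in>ball 0 1. cinner z C + d \<noteq> 0) \<and> \<phi> ` ball 0 1 \<subseteq> ball 0 1}"

definition no_interior_fixpoint :: "(complex ^ 'n \<Rightarrow> complex ^ 'n) \<Rightarrow> bool" where
  "no_interior_fixpoint \<phi> \<longleftrightarrow> (\<forall>z\<in>ball 0 1. \<phi> z \<noteq> z)"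

definition denjoy_wolff :: "(complex ^ 'n \<Rightarrow> complex ^ 'n) \<Rightarrow> complex ^ 'n \<Rightarrow> real \<Rightarrow> bool" where
  "denjoy_wolff \<phi> \<tau> \<alpha> \<longleftrightarrow> \<tau> \<in> sphere 0 1 \<and> \<phi> \<tau> = \<tau> \<and> 0 < \<alpha> \<and> \<alpha> \<le> 1 \<and>
     (\<exists>D. (\<phi> has_derivative D) (at \<tau>) \<and> cinner (D \<tau>) \<tau> = of_real \<alpha>)"

definition hyperbolic :: "(complex ^ 'n \<Rightarrow> complex ^ 'n) \<Rightarrow> bool" where
  "hyperbolic \<phi> \<longleftrightarrow> no_interior_fixpoint \<phi> \<and> (\<exists>\<tau> \<alpha>. denjoy_wolff \<phi> \<tau> \<alpha> \<and> \<alpha> < 1)"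

text \<open>Holomorphy in several variables: Frechet differentiable with complex linear derivative.\<close>

definition holomorphic_fun_on :: "(complex ^ 'n \<Rightarrow> complex) \<Rightarrow> (complex ^ 'n) set \<Rightarrow> bool" where
  "holomorphic_fun_on f S \<longleftrightarrow>
     (\<forall>z\<in>S. \<exists>D. (f has_derivative D) (at z within S) \<and> (\<forall>c v. D (c *s v) = c * D v))"

definition holomorphic_map_on ::
  "(complex ^ 'n \<Rightarrow> complex ^ 'n) \<Rightarrow> (complex ^ 'n) set \<Rightarrow> bool" where
  "holomorphic_map_on F S \<longleftrightarrow> (\<forall>i. holomorphic_fun_on (\<lambda>z. F z $ i) S)"

definition ball_automorphism :: "(complex ^ 'n \<Rightarrow> complex ^ 'n) \<Rightarrow> bool" where
  "ball_automorphism \<phi> \<longleftrightarrow> holomorphic_map_on \<phi> (ball 0 1) \<and> bij_betw \<phi> (ball 0 1) (ball 0 1) \<and>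
     holomorphic_map_on (inv_into (ball 0 1) \<phi>) (ball 0 1)"


section \<open>The Hardy space and composition operators\<close>

text \<open>The normalized rotation-invariant measure on the unit sphere, as the image of the normalized
  volume of the ball under the radial projection \<open>z \<mapsto> z / \<parallel>z\<parallel>\<close> (which is \<open>sgn\<close>).\<close>

definition sphere_measure :: "(complex ^ 'n) measure" where
  "sphere_measure = distr (uniform_measure lborel (ball 0 1)) borel sgn"

definition square_mean :: "(complex ^ 'n \<Rightarrow> complex) \<Rightarrow> real \<Rightarrow> real" where
  "square_mean f r = (\<integral>\<zeta>. (cmod (f (r *\<^sub>R \<zeta>)))\<^sup>2 \<partial>sphere_measure)"

text \<open>Functions on the ball are represented by functions on the whole space that vanish off the ball,
  so that equality in \<open>hardy2\<close> is equality of functions.\<close>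

definition hardy2 :: "(complex ^ 'n \<Rightarrow> complex) set" where
  "hardy2 = {f. holomorphic_fun_on f (ball 0 1) \<and> (\<forall>z. z \<notin> ball 0 1 \<longrightarrow> f z = 0) \<and>
                bdd_above (square_mean f ` {0<..<1})}"

definition hardy2_norm :: "(complex ^ 'n \<Rightarrow> complex) \<Rightarrow> real" where
  "hardy2_norm f = sqrt (SUP r\<in>{0<..<1}. square_mean f r)"

definition comp_op ::
  "(complex ^ 'n \<Rightarrow> complex ^ 'n) \<Rightarrow> (complex ^ 'n \<Rightarrow> complex) \<Rightarrow> complex ^ 'n \<Rightarrow> complex" where
  "comp_op \<phi> f = (\<lambda>z. if z \<in> ball 0 1 then f (\<phi> z) else 0)"


section \<open>Operators on a normed space of complex-valued functions\<close>

text \<open>Throughout, \<open>V\<close> is a complex linear space of functions and \<open>nrm\<close> is a norm on it; operators are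
  functions whose values outside \<open>V\<close> are irrelevant.\<close>

definition cscale :: "complex \<Rightarrow> ('a \<Rightarrow> complex) \<Rightarrow> 'a \<Rightarrow> complex" where
  "cscale c f = (\<lambda>x. c * f x)"

interpretation cfun: vector_space cscale
  by unfold_locales (auto simp: cscale_def fun_eq_iff algebra_simps)

definition bounded_op ::
  "('a \<Rightarrow> complex) set \<Rightarrow> (('a \<Rightarrow> complex) \<Rightarrow> real) \<Rightarrow> (('a \<Rightarrow> complex) \<Rightarrow> 'a \<Rightarrow> complex) \<Rightarrow> bool" where
  "bounded_op V nrm T \<longleftrightarrow>
     (\<forall>f\<in>V. T f \<in> V) \<and>
     (\<forall>f\<in>V. \<forall>g\<in>V. T (f + g) = T f + T g) \<and>
     (\<forall>c. \<forall>f\<in>V. T (cscale c f) = cscale c (T f)) \<and>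
     (\<exists>K. \<forall>f\<in>V. nrm (T f) \<le> K * nrm f)"

definition compact_op ::
  "('a \<Rightarrow> complex) set \<Rightarrow> (('a \<Rightarrow> complex) \<Rightarrow> real) \<Rightarrow> (('a \<Rightarrow> complex) \<Rightarrow> 'a \<Rightarrow> complex) \<Rightarrow> bool" where
  "compact_op V nrm T \<longleftrightarrow> bounded_op V nrm T \<and>
     (\<forall>f. (\<forall>k::nat. f k \<in> V \<and> nrm (f k) \<le> 1) \<longrightarrow>
        (\<exists>s::nat \<Rightarrow> nat. \<exists>g\<in>V. strict_mono s \<and> (\<lambda>k. nrm (T (f (s k)) - g)) \<longlonglongrightarrow> 0))"

definition invertible_op ::
  "('a \<Rightarrow> complex) set \<Rightarrow> (('a \<Rightarrow> complex) \<Rightarrow> real) \<Rightarrow> (('a \<Rightarrow> complex) \<Rightarrow> 'a \<Rightarrow> complex) \<Rightarrow> bool" where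
  "invertible_op V nrm T \<longleftrightarrow> bounded_op V nrm T \<and>
     (\<exists>S. bounded_op V nrm S \<and> (\<forall>f\<in>V. S (T f) = f \<and> T (S f) = f))"

text \<open>Invertibility of the coset of \<open>T\<close> in the Calkin algebra.\<close>

definition essentially_invertible_op ::
  "('a \<Rightarrow> complex) set \<Rightarrow> (('a \<Rightarrow> complex) \<Rightarrow> real) \<Rightarrow> (('a \<Rightarrow> complex) \<Rightarrow> 'a \<Rightarrow> complex) \<Rightarrow> bool" where
  "essentially_invertible_op V nrm T \<longleftrightarrow> bounded_op V nrm T \<and>
     (\<exists>S. bounded_op V nrm S \<and>
        compact_op V nrm (\<lambda>f. S (T f) - f) \<and> compact_op V nrm (\<lambda>f. T (S f) - f))"

definition op_spectrum ::
  "('a \<Rightarrow> complex) set \<Rightarrow> (('a \<Rightarrow> complex) \<Rightarrow> real) \<Rightarrow> (('a \<Rightarrow> complex) \<Rightarrow> 'a \<Rightarrow> complex) \<Rightarrow> complex set"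
  where
  "op_spectrum V nrm T = {\<mu>. \<not> invertible_op V nrm (\<lambda>f. T f - cscale \<mu> f)}"

definition op_essential_spectrum ::
  "('a \<Rightarrow> complex) set \<Rightarrow> (('a \<Rightarrow> complex) \<Rightarrow> real) \<Rightarrow> (('a \<Rightarrow> complex) \<Rightarrow> 'a \<Rightarrow> complex) \<Rightarrow> complex set"
  where
  "op_essential_spectrum V nrm T = {\<mu>. \<not> essentially_invertible_op V nrm (\<lambda>f. T f - cscale \<mu> f)}"

definition eigenspace ::
  "('a \<Rightarrow> complex) set \<Rightarrow> (('a \<Rightarrow> complex) \<Rightarrow> 'a \<Rightarrow> complex) \<Rightarrow> complex \<Rightarrow> ('a \<Rightarrow> complex) set" where
  "eigenspace V T \<mu> = {f\<in>V. T f = cscale \<mu> f}"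

definition op_eigenvalue ::
  "('a \<Rightarrow> complex) set \<Rightarrow> (('a \<Rightarrow> complex) \<Rightarrow> 'a \<Rightarrow> complex) \<Rightarrow> complex \<Rightarrow> bool" where
  "op_eigenvalue V T \<mu> \<longleftrightarrow> (\<exists>f\<in>eigenspace V T \<mu>. f \<noteq> 0)"

definition infinite_dimensional :: "('a \<Rightarrow> complex) set \<Rightarrow> bool" where
  "infinite_dimensional W \<longleftrightarrow> \<not> (\<exists>B. finite B \<and> B \<subseteq> W \<and> W \<subseteq> cfun.span B)"

end

(* A linear fractional map acts linearly on C^N x C. Its derivative at the Denjoy-Wolff point tau shows
   that (tau, 1) is also an eigenvector for the adjoint with respect to the form |t|^2 - |x|^2, and shifting
   along this null vector makes the map, suitably scaled, expand that form. Hence with the denominator q,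
   suitably normalised, 1/(1 - <z,w>) - 1/(q(z) q(w)^- (1 - <phi(z),phi(w)>)) is a positive kernel times
   Cauchy kernels; taking N-th powers, f |-> q^{-N} (f o phi) is a contraction of H^2. The eigenvalue
   alpha^{-1/2} of the linear map has a dual eigenvector, an affine function whose zero set would contain
   a second fixed point by Brouwer's theorem if it met the closed ball. This function 1 - <z,v> therefore has
   no zeros, and it turns the contraction into a bound alpha^{-N/2} for C_phi in an equivalent norm. Finally
   W = (1 - <z,v>) / (1 - <z,tau>) satisfies W o phi = W / alpha, and its complex powers are eigenfunctions. *)

theory Submission
  imports Defs "HOL-Probability.Probability_Measure" "HOL-Complex_Analysis.Complex_Analysis"
    "HOL-Real_Asymp.Real_Asymp"
begin

section \<open>Complex N-space, the measure on its unit sphere, and holomorphy\<close>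

section \<open>The Hermitian inner product\<close>

text \<open>The difficulty is the exact rate. That the linear map sends the cone |x| \<le> |t| into
  itself gives no constant; the invariance of the defect form under shifts by the null vector does,
  because every vector off a hyperplane can be shifted onto the light cone, where the cone inclusion
  is the whole claim. The constant is \<open>\<mu>\<close>, that is |q(tau)|^2 \<alpha> for the
  unnormalised q, so after normalisation |q(tau)| = \<alpha>^(-1/2), and the N factors of the kernel
  give \<alpha>^(-N/2). The weight (1 - <z,v>)^(-N) changes the Hardy norm only up to a constant,
  because v lies in the open ball.

  Boundary values are avoided: moments of the sphere measure and a kernel formula for dilates
  replace them. Complex powers of W give nonzero eigenvalues only; multiplying an eigenfunction by
  powers of a bounded invariant function gives infinite multiplicity. The eigenvalue 0 is decided by
  whether the linear map is singular. The essential spectrum is found from orthonormal eigenvectors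
  for nearby eigenvalues, which covers 0 and the boundary circle.\<close>

lemma cinner_add_left: "cinner (x + y) z = cinner x z + cinner y z"
  by (simp add: cinner_def algebra_simps sum.distrib)

lemma cinner_add_right: "cinner x (y + z) = cinner x y + cinner x z"
  by (simp add: cinner_def algebra_simps sum.distrib)

lemma cinner_diff_left: "cinner (x - y) z = cinner x z - cinner y z"
  by (simp add: cinner_def algebra_simps sum_subtractf)

lemma cinner_diff_right: "cinner x (y - z) = cinner x y - cinner x z"
  by (simp add: cinner_def algebra_simps sum_subtractf)

lemma cinner_smult_left: "cinner (c *s x) y = c * cinner x y"
  by (simp add: cinner_def sum_distrib_left mult_ac)

lemma cinner_smult_right: "cinner x (c *s y) = cnj c * cinner x y"
  by (simp add: cinner_def sum_distrib_left mult_ac)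

lemma scaleR_eq_smult: "r *\<^sub>R (x :: complex ^ 'n) = of_real r *s x"
  unfolding vec_eq_iff vector_scaleR_component vector_smult_component
  by (simp add: scaleR_conv_of_real)

lemma cinner_scaleR_left: "cinner (r *\<^sub>R x) y = of_real r * cinner x y"
  by (simp add: scaleR_eq_smult cinner_smult_left)

lemma cinner_scaleR_right: "cinner x (r *\<^sub>R y) = of_real r * cinner x y"
  by (simp add: scaleR_eq_smult cinner_smult_right)

lemma cinner_zero_left [simp]: "cinner 0 x = 0"
  by (simp add: cinner_def)

lemma cinner_zero_right [simp]: "cinner x 0 = 0"
  by (simp add: cinner_def)

lemma cinner_commute: "cinner y x = cnj (cinner x y)"
  by (simp add: cinner_def mult_ac)

lemma inner_eq_Re_cinner: "x \<bullet> y = Re (cinner x y)"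
  by (simp add: inner_vec_def cinner_def inner_complex_def)

lemma cinner_self: "cinner x x = of_real ((norm x)\<^sup>2)"
proof -
  have "Im (cinner x x) = 0" by (simp add: cinner_def mult_ac)
  moreover have "Re (cinner x x) = (norm x)\<^sup>2"
    by (simp add: power2_norm_eq_inner inner_eq_Re_cinner)
  ultimately show ?thesis by (simp add: complex_eq_iff)
qed

lemmas cinner_simps = cinner_add_left cinner_add_right cinner_diff_left cinner_diff_right
  cinner_smult_left cinner_smult_right cinner_scaleR_left cinner_scaleR_right

lemma norm_smult: "norm (c *s (x :: complex ^ 'n)) = cmod c * norm x"
proof -
  have "(norm (c *s x))\<^sup>2 = (cmod c * norm x)\<^sup>2"
  proof -
    have "complex_of_real ((norm (c *s x))\<^sup>2) = cinner (c *s x) (c *s x)" by (simp only: cinner_self)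
    also have "\<dots> = c * cnj c * cinner x x" by (simp add: cinner_simps)
    also have "\<dots> = of_real ((cmod c * norm x)\<^sup>2)"
      by (simp add: cinner_self complex_norm_square[symmetric] power_mult_distrib)
    finally show ?thesis by (simp only: of_real_eq_iff)
  qed
  thus ?thesis by (simp add: power2_eq_iff_nonneg)
qed

text \<open>Multiplying \<open>x\<close> by a unimodular \<open>c\<close> (or by 0, if the product
  is 0) makes the product real and nonnegative. It is then the real inner product, for which
  Cauchy-Schwarz is known.\<close>

lemma cmod_cinner_le: "cmod (cinner x y) \<le> norm x * norm y"
proof -
  define c where "c = cnj (sgn (cinner x y))"
  have "cmod (cinner x y) = Re (c * cinner x y)"
  proof (cases "cinner x y = 0")
    case False
    have "c * cinner x y = cinner x y * cnj (cinner x y) / cmod (cinner x y)"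
      by (simp add: c_def sgn_eq)
    also have "\<dots> = of_real (cmod (cinner x y))"
      using False by (simp add: complex_norm_square[symmetric] power2_eq_square)
    finally show ?thesis by simp
  qed simp
  also have "\<dots> = (c *s x) \<bullet> y" by (simp add: inner_eq_Re_cinner cinner_simps)
  also have "\<dots> \<le> norm (c *s x) * norm y" by (rule norm_cauchy_schwarz)
  also have "\<dots> \<le> norm x * norm y"
    by (intro mult_right_mono) (auto simp: norm_smult c_def norm_sgn)
  finally show ?thesis .
qed

lemma continuous_on_cinner [continuous_intros]:
  "continuous_on S f \<Longrightarrow> continuous_on S g \<Longrightarrow> continuous_on S (\<lambda>x. cinner (f x) (g x))"
  unfolding cinner_def by (intro continuous_intros)

lemma bounded_linear_cinner_left: "bounded_linear (\<lambda>x. cinner x y)"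
  by (rule bounded_linear_intro[of _ "norm y"])
     (simp_all only: cinner_simps scaleR_conv_of_real[where 'a = complex] cmod_cinner_le)

lemma bounded_linear_smult_left: "bounded_linear (\<lambda>c. c *s (x :: complex ^ 'n))"
  by (rule bounded_linear_intro[of _ "norm x"])
     (auto simp: vec_eq_iff algebra_simps norm_smult)

lemma continuous_on_smult [continuous_intros]:
  fixes g :: "_ \<Rightarrow> complex ^ 'n"
  shows "continuous_on S f \<Longrightarrow> continuous_on S g \<Longrightarrow> continuous_on S (\<lambda>x. f x *s g x)"
  unfolding vector_scalar_mult_def by (intro continuous_intros)

lemma measurable_cinner [measurable (raw)]:
  fixes f g :: "_ \<Rightarrow> complex ^ 'n"
  assumes "f \<in> borel_measurable M" "g \<in> borel_measurable M"
  shows "(\<lambda>x. cinner (f x) (g x)) \<in> borel_measurable M"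
proof -
  have "continuous_on UNIV (\<lambda>p :: (complex ^ 'n) \<times> (complex ^ 'n). cinner (fst p) (snd p))"
    by (intro continuous_intros)
  from borel_measurable_continuous_Pair[OF assms, of cinner] show ?thesis
    using \<open>continuous_on UNIV _\<close> by simp
qed

lemma measurable_smult [measurable (raw)]:
  fixes g :: "_ \<Rightarrow> complex ^ 'n"
  assumes "f \<in> borel_measurable M" "g \<in> borel_measurable M"
  shows "(\<lambda>x. f x *s g x) \<in> borel_measurable M"
proof -
  have "continuous_on UNIV (\<lambda>p :: complex \<times> (complex ^ 'n). fst p *s snd p)"
    by (intro continuous_intros)
  from borel_measurable_continuous_Pair[OF assms, of "(*s)"] show ?thesis
    using \<open>continuous_on UNIV _\<close> by simp
qed


section \<open>Rotation invariance of the sphere measure\<close>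

text \<open>Boxes determine the measure, and their volume is preserved by orthogonal maps of
  \<open>real ^ 'm\<close>. The sort of the index type is that of
  \<open>measure_orthogonal_image\<close>; the next lemma carries the result over to complex
  coordinates.\<close>

lemma distr_lborel_orthogonal_real_vec:
  fixes T :: "real ^ 'm::{finite,wellorder} \<Rightarrow> real ^ 'm::_"
  assumes T: "orthogonal_transformation T"
  shows "distr lborel borel T = lborel"
proof (rule sym, rule lborel_eqI)
  have lin: "linear T" using T by (simp add: orthogonal_transformation_linear)
  have mT: "T \<in> borel_measurable borel"
    using lin by (intro borel_measurable_continuous_onI linear_continuous_on linear_linear[THEN iffD2])
  fix l u :: "real ^ 'm::_" assume lu: "\<And>b. b \<in> Basis \<Longrightarrow> l \<bullet> b \<le> u \<bullet> b"
  have bij: "bij T" using T orthogonal_transformation_bij by blast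
  have "emeasure (distr lborel borel T) (box l u) = emeasure lborel (T -` box l u)"
    using mT by (subst emeasure_distr) auto
  also have "T -` box l u = inv T ` box l u" using bij by (simp add: bij_vimage_eq_inv_image)
  also have "emeasure lborel (inv T ` box l u) = emeasure lebesgue (inv T ` box l u)"
    using bij measurable_sets_borel[OF mT, of "box l u"]
    by (simp add: bij_vimage_eq_inv_image)
  also have "\<dots> = ennreal (measure lebesgue (inv T ` box l u))"
    using measurable_orthogonal_image[OF orthogonal_transformation_inv[OF T], of "box l u"]
    by (simp add: emeasure_eq_measure2 fmeasurableD2)
  also have "measure lebesgue (inv T ` box l u) = measure lebesgue (box l u)"
    by (intro measure_orthogonal_image orthogonal_transformation_inv[OF T]) simp
  also have "\<dots> = (\<Prod>b\<in>Basis. (u - l) \<bullet> b)" using lu by (simp add: content_cbox[symmetric] measure_lborel_box_eq)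
  finally show "emeasure (distr lborel borel T) (box l u) = (\<Prod>b\<in>Basis. (u - l) \<bullet> b)" .
qed simp

text \<open>\<open>'n bit0\<close> has 2N elements and is well-ordered, so
  \<open>real ^ 'n bit0\<close> is a model of complex N-space to which the previous lemma applies.
  Orthonormal coordinates \<open>J\<close> identify the two spaces and preserve volume;
  \<open>T\<close> is conjugated with them.\<close>

lemma distr_lborel_orthogonal:
  fixes T :: "complex ^ 'n \<Rightarrow> complex ^ 'n"
  assumes T: "orthogonal_transformation T"
  shows "distr lborel borel T = lborel"
proof -
  have "card (UNIV :: 'n bit0 set) = card (Basis :: (complex ^ 'n) set)"
    by (simp add: DIM_cart card_bit0)
  then obtain \<beta> where \<beta>: "bij_betw \<beta> (UNIV :: 'n bit0 set) (Basis :: (complex ^ 'n) set)"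
    using finite_same_card_bij[of "UNIV :: 'n bit0 set" "Basis :: (complex ^ 'n) set"] by auto
  define J :: "complex ^ 'n \<Rightarrow> real ^ 'n bit0" where "J x = (\<chi> k. x \<bullet> \<beta> k)" for x
  define J' :: "real ^ 'n bit0 \<Rightarrow> complex ^ 'n" where "J' y = (\<Sum>k\<in>UNIV. (y $ k) *\<^sub>R \<beta> k)" for y
  have \<beta>B: "\<beta> k \<in> Basis" for k using \<beta> by (auto simp: bij_betw_def)
  have \<beta>i: "\<beta> k = \<beta> l \<longleftrightarrow> k = l" for k l using \<beta> by (auto simp: bij_betw_def inj_on_def)
  have J'J: "J' (J x) = x" for x
  proof -
    have "J' (J x) = (\<Sum>b\<in>Basis. (x \<bullet> b) *\<^sub>R b)"
      unfolding J'_def J_def by (simp add: sum.reindex_bij_betw[OF \<beta>, of "\<lambda>b. (x \<bullet> b) *\<^sub>R b"])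
    thus ?thesis by (simp add: euclidean_representation)
  qed
  have innB: "\<beta> k \<bullet> \<beta> l = (if k = l then 1 else 0)" for k l
    by (simp add: inner_Basis \<beta>B \<beta>i)
  have J'b: "J' y \<bullet> \<beta> k = y $ k" for y k
    by (simp add: J'_def inner_sum_left innB if_distrib cong: if_cong)
  have JJ': "J (J' y) = y" for y by (simp add: J_def J'b vec_eq_iff)
  have linJ: "linear J" by (rule linearI) (auto simp: J_def vec_eq_iff inner_add_left)
  have linJ': "linear J'" by (rule linearI) (auto simp: J'_def sum.distrib scaleR_add_left scaleR_sum_right)
  have Jinner: "J x \<bullet> J y = x \<bullet> y" for x y
  proof -
    have "J x \<bullet> J y = (\<Sum>k\<in>UNIV. (x \<bullet> \<beta> k) * (y \<bullet> \<beta> k))" by (simp add: J_def inner_vec_def)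
    also have "\<dots> = (\<Sum>b\<in>Basis. (x \<bullet> b) * (y \<bullet> b))"
      by (rule sum.reindex_bij_betw[OF \<beta>])
    also have "\<dots> = x \<bullet> y" by (rule euclidean_inner[symmetric])
    finally show ?thesis .
  qed
  have mJ [measurable]: "J \<in> borel_measurable borel"
    using linJ by (intro borel_measurable_continuous_onI linear_continuous_on linear_linear[THEN iffD2])
  have mJ' [measurable]: "J' \<in> borel_measurable borel"
    using linJ' by (intro borel_measurable_continuous_onI linear_continuous_on linear_linear[THEN iffD2])
  have linT: "linear T" using T by (simp add: orthogonal_transformation_linear)
  have mT [measurable]: "T \<in> borel_measurable borel"
    using linT by (intro borel_measurable_continuous_onI linear_continuous_on linear_linear[THEN iffD2])
  \<comment> \<open>Boxes correspond to boxes because \<open>J\<close> reads off the coordinates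
    with respect to \<open>Basis\<close>.\<close>
  have dJ: "distr lborel borel J = lborel"
  proof (rule sym, rule lborel_eqI)
    fix l u :: "real ^ 'n bit0" assume lu: "\<And>b. b \<in> Basis \<Longrightarrow> l \<bullet> b \<le> u \<bullet> b"
    have lu': "l $ k \<le> u $ k" for k using lu[of "axis k 1"] by (simp add: inner_axis)
    have pre: "J -` box l u = box (J' l) (J' u)"
    proof -
      have "x \<in> box (J' l) (J' u) \<longleftrightarrow> (\<forall>k. J' l \<bullet> \<beta> k < x \<bullet> \<beta> k \<and> x \<bullet> \<beta> k < J' u \<bullet> \<beta> k)" for x
        unfolding mem_box using \<beta> \<beta>B by (metis bij_betw_imp_surj_on rangeE)
      moreover have "y \<in> box l u \<longleftrightarrow> (\<forall>k. l $ k < y $ k \<and> y $ k < u $ k)" for y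
        by (auto simp: mem_box_cart)
      ultimately show ?thesis by (auto simp: J'b J_def)
    qed
    have "emeasure (distr lborel borel J) (box l u) = emeasure lborel (box (J' l) (J' u))"
      by (subst emeasure_distr) (auto simp: pre)
    also have "\<dots> = (\<Prod>b\<in>Basis. (J' u - J' l) \<bullet> b)"
    proof (rule emeasure_lborel_box)
      fix b :: "complex ^ 'n" assume "b \<in> Basis"
      then obtain k where "b = \<beta> k" using \<beta> by (auto simp: bij_betw_def)
      thus "J' l \<bullet> b \<le> J' u \<bullet> b" by (simp add: J'b lu')
    qed
    also have "(\<Prod>b\<in>Basis. (J' u - J' l) \<bullet> b) = (\<Prod>k\<in>UNIV. (J' u - J' l) \<bullet> \<beta> k)"
      by (rule prod.reindex_bij_betw[OF \<beta>, symmetric])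
    also have "\<dots> = (\<Prod>k\<in>UNIV. (u - l) \<bullet> axis k 1)"
      by (simp add: inner_diff_left J'b inner_axis)
    also have "\<dots> = (\<Prod>b\<in>Basis. (u - l) \<bullet> b)"
    proof -
      have "bij_betw (\<lambda>k. axis k 1 :: real ^ 'n bit0) UNIV Basis"
        by (auto simp: bij_betw_def inj_on_def axis_eq_axis Basis_vec_def)
      from prod.reindex_bij_betw[OF this] show ?thesis .
    qed
    finally show "emeasure (distr lborel borel J) (box l u) = (\<Prod>b\<in>Basis. (u - l) \<bullet> b)" .
  qed simp
  define T' where "T' = J \<circ> T \<circ> J'"
  have J'inner: "J' x \<bullet> J' y = x \<bullet> y" for x y by (metis JJ' Jinner)
  have "orthogonal_transformation T'"
    unfolding orthogonal_transformation_def T'_def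
    using linJ linJ' linT T
    by (auto intro!: linear_compose simp: Jinner J'inner orthogonal_transformation_def)
  hence dT': "distr lborel borel T' = lborel" by (rule distr_lborel_orthogonal_real_vec)
  have mT' [measurable]: "T' \<in> borel_measurable borel" unfolding T'_def comp_def by measurable
  have dJ': "distr lborel borel J' = lborel"
  proof -
    have "distr lborel borel J' = distr (distr lborel borel J) borel J'" by (simp add: dJ)
    also have "\<dots> = distr lborel borel (J' \<circ> J)" by (rule distr_distr) simp_all
    also have "J' \<circ> J = id" by (auto simp: J'J)
    finally show ?thesis by (simp add: distr_id2)
  qed
  have "distr lborel borel T = distr (distr lborel borel J') borel T" by (simp add: dJ')
  also have "\<dots> = distr lborel borel (T \<circ> J')" by (rule distr_distr) simp_all
  also have "T \<circ> J' = J' \<circ> T'" by (auto simp: T'_def J'J)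
  also have "distr lborel borel (J' \<circ> T') = distr (distr lborel borel T') borel J'"
    by (rule distr_distr[symmetric]) simp_all
  also have "\<dots> = lborel" by (simp add: dT' dJ')
  finally show ?thesis .
qed

lemma measurable_sgn_vec [measurable]: "(sgn :: complex ^ 'n \<Rightarrow> complex ^ 'n) \<in> borel_measurable borel"
  unfolding sgn_div_norm by measurable

lemma emeasure_unit_ball: "emeasure lborel (ball 0 1 :: (complex ^ 'n) set) \<noteq> 0"
    "emeasure lborel (ball 0 1 :: (complex ^ 'n) set) \<noteq> \<infinity>"
proof -
  have "0 < measure lborel (ball 0 1 :: (complex ^ 'n) set)"
    using content_ball_pos[of 1 "0 :: complex ^ 'n"] by (simp add: measure_completion)
  thus "emeasure lborel (ball 0 1 :: (complex ^ 'n) set) \<noteq> 0"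
    by (auto simp: measure_def)
  show "emeasure lborel (ball 0 1 :: (complex ^ 'n) set) \<noteq> \<infinity>"
    using emeasure_bounded_finite[of "ball 0 1 :: (complex ^ 'n) set"] by auto
qed

lemma sets_sphere_measure [measurable_cong, simp]: "sets sphere_measure = sets borel"
  by (simp add: sphere_measure_def)

lemma space_sphere_measure [simp]: "space sphere_measure = UNIV"
  by (simp add: sphere_measure_def)

interpretation sphere: prob_space "sphere_measure :: (complex ^ 'n) measure"
proof -
  interpret u: prob_space "uniform_measure lborel (ball 0 1 :: (complex ^ 'n) set)"
    by (rule prob_space_uniform_measure) (use emeasure_unit_ball in auto)
  show "prob_space (sphere_measure :: (complex ^ 'n) measure)"
    unfolding sphere_measure_def by (rule u.prob_space_distr) simp
qed

text \<open>\<open>sgn\<close> fails to be a unit vector only at the origin, a null set.\<close>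

lemma AE_sphere_norm: "AE \<zeta> in sphere_measure. norm (\<zeta> :: complex ^ 'n) = 1"
proof -
  have "AE z in uniform_measure lborel (ball 0 1 :: (complex ^ 'n) set). norm (sgn z) = 1"
    using AE_lborel_singleton[of "0 :: complex ^ 'n"]
    by (intro AE_uniform_measureI) (auto simp: norm_sgn)
  thus ?thesis unfolding sphere_measure_def
    by (subst AE_distr_iff) (auto intro: borel_measurable_const measurable_compose)
qed

text \<open>\<open>T\<close> preserves the ball and its volume, and it commutes with the radial
  projection \<open>sgn\<close>.\<close>

lemma distr_sphere_orthogonal:
  fixes T :: "complex ^ 'n \<Rightarrow> complex ^ 'n"
  assumes T: "orthogonal_transformation T"
  shows "distr sphere_measure borel T = sphere_measure"
proof -
  let ?B = "ball 0 1 :: (complex ^ 'n) set"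
  let ?u = "uniform_measure lborel ?B"
  have linT: "linear T" using T by (simp add: orthogonal_transformation_linear)
  have nT: "norm (T x) = norm x" for x using T by (simp add: orthogonal_transformation_norm)
  have mT [measurable]: "T \<in> borel_measurable borel"
    using linT by (intro borel_measurable_continuous_onI linear_continuous_on linear_linear[THEN iffD2])
  have du: "distr ?u borel T = ?u"
  proof (rule measure_eqI)
    fix A assume "A \<in> sets (distr ?u borel T)"
    hence A [measurable]: "A \<in> sets borel" by simp
    have pA: "T -` A \<in> sets borel" using measurable_sets[OF mT A] by simp
    have "emeasure (distr ?u borel T) A = emeasure ?u (T -` A)"
      by (subst emeasure_distr) auto
    also have "\<dots> = emeasure lborel (?B \<inter> T -` A) / emeasure lborel ?B"
      using pA by simp
    also have "?B \<inter> T -` A = T -` (?B \<inter> A)" by (auto simp: nT)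
    also have "emeasure lborel (T -` (?B \<inter> A)) = emeasure (distr lborel borel T) (?B \<inter> A)"
      by (subst emeasure_distr) auto
    also have "\<dots> = emeasure lborel (?B \<inter> A)" by (simp add: distr_lborel_orthogonal[OF T])
    finally show "emeasure (distr ?u borel T) A = emeasure ?u A" by simp
  qed simp
  have "distr sphere_measure borel T = distr ?u borel (T \<circ> sgn)"
    unfolding sphere_measure_def by (rule distr_distr) simp_all
  also have "T \<circ> sgn = sgn \<circ> T"
    by (auto simp: sgn_div_norm nT linear_cmul[OF linT])
  also have "distr ?u borel (sgn \<circ> T) = distr (distr ?u borel T) borel sgn"
    by (rule distr_distr[symmetric]) simp_all
  finally show ?thesis by (simp add: du sphere_measure_def)
qed

lemma integral_sphere_orthogonal:
  fixes T :: "complex ^ 'n \<Rightarrow> complex ^ 'n" and f :: "complex ^ 'n \<Rightarrow> 'b::{banach,second_countable_topology}"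
  assumes T: "orthogonal_transformation T" and f [measurable]: "f \<in> borel_measurable borel"
  shows "(\<integral>\<zeta>. f (T \<zeta>) \<partial>sphere_measure) = (\<integral>\<zeta>. f \<zeta> \<partial>sphere_measure)"
proof -
  have mT: "T \<in> borel_measurable borel"
    using T by (intro borel_measurable_continuous_onI linear_continuous_on linear_linear[THEN iffD2])
      (simp add: orthogonal_transformation_linear)
  have "(\<integral>\<zeta>. f (T \<zeta>) \<partial>sphere_measure) = (\<integral>\<zeta>. f \<zeta> \<partial>distr sphere_measure borel T)"
    using mT f by (intro integral_distr[symmetric]) measurable
  thus ?thesis by (simp add: distr_sphere_orthogonal[OF T])
qed

lemma orthogonal_transformation_cisometryI:
  fixes T :: "complex ^ 'n \<Rightarrow> complex ^ 'n"
  assumes "\<And>x y. T (x + y) = T x + T y" "\<And>c x. T (c *s x) = c *s T x" "\<And>x. norm (T x) = norm x"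
  shows "orthogonal_transformation T"
proof -
  have "linear T" by (rule linearI) (simp_all only: assms scaleR_eq_smult)
  thus ?thesis unfolding orthogonal_transformation using assms(3) by blast
qed


section \<open>Holomorphic functions of several variables\<close>

lemma holomorphic_fun_onD:
  assumes "holomorphic_fun_on f S" "open S" "z \<in> S"
  obtains D where "(f has_derivative D) (at z)" "\<And>c v. D (c *s v) = c * D v"
  using assms unfolding holomorphic_fun_on_def by (metis at_within_open)

lemma holomorphic_fun_onI:
  assumes "\<And>z. z \<in> S \<Longrightarrow> \<exists>D. (f has_derivative D) (at z) \<and> (\<forall>c v. D (c *s v) = c * D v)"
  shows "holomorphic_fun_on f S"
  unfolding holomorphic_fun_on_def using assms has_derivative_at_withinI by blast

lemma holomorphic_fun_on_cong:
  assumes "holomorphic_fun_on f S" "\<And>z. z \<in> S \<Longrightarrow> f z = g z"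
  shows "holomorphic_fun_on g S"
  unfolding holomorphic_fun_on_def
proof
  fix z assume z: "z \<in> S"
  then obtain D where "(f has_derivative D) (at z within S)" "\<forall>c v. D (c *s v) = c * D v"
    using assms(1) unfolding holomorphic_fun_on_def by blast
  moreover have "(g has_derivative D) (at z within S)"
    by (rule has_derivative_transform[OF z _ calculation(1)]) (simp add: assms(2))
  ultimately show "\<exists>D. (g has_derivative D) (at z within S) \<and> (\<forall>c v. D (c *s v) = c * D v)"
    by blast
qed

lemma holomorphic_fun_on_imp_continuous_on:
  "holomorphic_fun_on f S \<Longrightarrow> continuous_on S f"
  unfolding holomorphic_fun_on_def continuous_on_eq_continuous_within
  using has_derivative_continuous by blast

lemma holomorphic_fun_on_const: "holomorphic_fun_on (\<lambda>_. c) S"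
  unfolding holomorphic_fun_on_def by (intro ballI exI[of _ "\<lambda>_. 0"]) auto

lemma holomorphic_fun_on_cinner: "holomorphic_fun_on (\<lambda>z. cinner z w) S"
  unfolding holomorphic_fun_on_def
  by (intro ballI exI[of _ "\<lambda>z. cinner z w"])
     (auto simp: cinner_simps intro!: bounded_linear_imp_has_derivative bounded_linear_cinner_left)

lemma holomorphic_fun_on_nth: "holomorphic_fun_on (\<lambda>z. z $ i) S"
  unfolding holomorphic_fun_on_def
  by (intro ballI exI[of _ "\<lambda>z. z $ i"])
     (auto intro!: bounded_linear_imp_has_derivative bounded_linear_vec_nth)

lemma holomorphic_fun_on_add:
  assumes "holomorphic_fun_on f S" "holomorphic_fun_on g S"
  shows "holomorphic_fun_on (\<lambda>z. f z + g z) S"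
  unfolding holomorphic_fun_on_def
proof
  fix z assume "z \<in> S"
  then obtain D E where "(f has_derivative D) (at z within S)" "\<forall>c v. D (c *s v) = c * D v"
    "(g has_derivative E) (at z within S)" "\<forall>c v. E (c *s v) = c * E v"
    using assms unfolding holomorphic_fun_on_def by meson
  thus "\<exists>D. ((\<lambda>z. f z + g z) has_derivative D) (at z within S) \<and> (\<forall>c v. D (c *s v) = c * D v)"
    by (intro exI[of _ "\<lambda>v. D v + E v"]) (auto intro: has_derivative_add simp: algebra_simps)
qed

lemma holomorphic_fun_on_mult:
  assumes "holomorphic_fun_on f S" "holomorphic_fun_on g S"
  shows "holomorphic_fun_on (\<lambda>z. f z * g z) S"
  unfolding holomorphic_fun_on_def
proof
  fix z assume "z \<in> S"
  then obtain D E where "(f has_derivative D) (at z within S)" "\<forall>c v. D (c *s v) = c * D v"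
    "(g has_derivative E) (at z within S)" "\<forall>c v. E (c *s v) = c * E v"
    using assms unfolding holomorphic_fun_on_def by meson
  thus "\<exists>D. ((\<lambda>z. f z * g z) has_derivative D) (at z within S) \<and> (\<forall>c v. D (c *s v) = c * D v)"
    by (intro exI[of _ "\<lambda>v. f z * E v + D v * g z"] conjI has_derivative_mult)
       (auto simp: algebra_simps)
qed

lemma holomorphic_fun_on_diff:
  assumes "holomorphic_fun_on f S" "holomorphic_fun_on g S"
  shows "holomorphic_fun_on (\<lambda>z. f z - g z) S"
  using holomorphic_fun_on_add[OF assms(1)
      holomorphic_fun_on_mult[OF holomorphic_fun_on_const[of "-1"] assms(2)]] by simp

lemma holomorphic_fun_on_sum:
  assumes "\<And>i. i \<in> I \<Longrightarrow> holomorphic_fun_on (f i) S"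
  shows "holomorphic_fun_on (\<lambda>z. \<Sum>i\<in>I. f i z) S"
  using assms
  by (induction I rule: infinite_finite_induct)
     (auto intro: holomorphic_fun_on_add holomorphic_fun_on_const)

lemma holomorphic_fun_on_compose_complex:
  assumes f: "holomorphic_fun_on f S" and g: "g holomorphic_on T" "open T" and fS: "f ` S \<subseteq> T"
  shows "holomorphic_fun_on (\<lambda>z. g (f z)) S"
  unfolding holomorphic_fun_on_def
proof
  fix z assume z: "z \<in> S"
  then obtain D where D: "(f has_derivative D) (at z within S)" "\<forall>c v. D (c *s v) = c * D v"
    using f unfolding holomorphic_fun_on_def by blast
  have "(g has_derivative (*) (deriv g (f z))) (at (f z))"
    using holomorphic_derivI[OF g] z fS unfolding has_field_derivative_def by blast
  from has_derivative_compose[OF D(1) this]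
  show "\<exists>D. ((\<lambda>z. g (f z)) has_derivative D) (at z within S) \<and> (\<forall>c v. D (c *s v) = c * D v)"
    using D(2) by (intro exI[of _ "\<lambda>v. deriv g (f z) * D v"]) auto
qed

lemma holomorphic_fun_on_inverse:
  assumes "holomorphic_fun_on f S" "\<And>z. z \<in> S \<Longrightarrow> f z \<noteq> 0"
  shows "holomorphic_fun_on (\<lambda>z. inverse (f z)) S"
  by (rule holomorphic_fun_on_compose_complex[OF assms(1), of inverse "- {0}"])
     (use assms(2) in \<open>auto intro!: holomorphic_intros\<close>)

lemma holomorphic_fun_on_power:
  assumes "holomorphic_fun_on f S"
  shows "holomorphic_fun_on (\<lambda>z. f z ^ k) S"
  by (rule holomorphic_fun_on_compose_complex[OF assms, of "\<lambda>w. w ^ k" UNIV])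
     (auto intro!: holomorphic_intros)

lemma holomorphic_fun_on_divide:
  assumes "holomorphic_fun_on f S" "holomorphic_fun_on g S" "\<And>z. z \<in> S \<Longrightarrow> g z \<noteq> 0"
  shows "holomorphic_fun_on (\<lambda>z. f z / g z) S"
  using holomorphic_fun_on_mult[OF assms(1) holomorphic_fun_on_inverse[OF assms(2,3)]]
  by (simp add: divide_inverse)

lemmas holomorphic_fun_intros = holomorphic_fun_on_const holomorphic_fun_on_cinner
  holomorphic_fun_on_nth holomorphic_fun_on_add holomorphic_fun_on_diff holomorphic_fun_on_mult
  holomorphic_fun_on_power holomorphic_fun_on_divide holomorphic_fun_on_inverse
  holomorphic_fun_on_sum

lemma holomorphic_fun_on_compose_map:
  fixes F :: "complex ^ 'n \<Rightarrow> complex ^ 'n"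
  assumes f: "holomorphic_fun_on f T" and F: "holomorphic_map_on F S"
    and S: "open S" and T: "open T" and FS: "F ` S \<subseteq> T"
  shows "holomorphic_fun_on (\<lambda>z. f (F z)) S"
proof (rule holomorphic_fun_onI)
  fix z assume z: "z \<in> S"
  hence FzT: "F z \<in> T" using FS by blast
  have "\<forall>i. \<exists>D. ((\<lambda>z. F z $ i) has_derivative D) (at z) \<and> (\<forall>c v. D (c *s v) = c * D v)"
    using F z S unfolding holomorphic_map_on_def holomorphic_fun_on_def by (metis at_within_open)
  then obtain D where D: "\<And>i. ((\<lambda>z. F z $ i) has_derivative D i) (at z)"
    "\<And>i c v. D i (c *s v) = c * D i v" by metis
  have "(F has_derivative (\<lambda>h. \<chi> i. D i h)) (at z)"
    unfolding has_derivative_componentwise_within[where 'b = "complex ^ 'n"]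
  proof
    fix b :: "complex ^ 'n" assume "b \<in> Basis"
    then obtain i u where b: "b = axis i u" "u \<in> Basis" by (auto simp: Basis_vec_def)
    have "((\<lambda>x. F x $ i \<bullet> u) has_derivative (\<lambda>h. D i h \<bullet> u)) (at z)"
      by (intro derivative_intros D)
    thus "((\<lambda>x. F x \<bullet> b) has_derivative (\<lambda>h. (\<chi> i. D i h) \<bullet> b)) (at z)"
      by (simp add: b inner_axis)
  qed
  moreover obtain E where E: "(f has_derivative E) (at (F z))" "\<And>c v. E (c *s v) = c * E v"
    using holomorphic_fun_onD[OF f T FzT] by blast
  ultimately have "((\<lambda>z. f (F z)) has_derivative (\<lambda>h. E (\<chi> i. D i h))) (at z)"
    using has_derivative_compose by blast
  moreover have "E (\<chi> i. D i (c *s v)) = c * E (\<chi> i. D i v)" for c v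
    unfolding D(2) E(2)[symmetric] by (simp add: vector_scalar_mult_def)
  ultimately show "\<exists>D. ((\<lambda>z. f (F z)) has_derivative D) (at z) \<and> (\<forall>c v. D (c *s v) = c * D v)"
    by blast
qed

text \<open>Power series and Cauchy estimates for functions on the ball are obtained from such
  restrictions to complex lines.\<close>

lemma holomorphic_on_line:
  assumes f: "holomorphic_fun_on f S" "open S"
  shows "(\<lambda>u. f (a + u *s b)) holomorphic_on {u. a + u *s b \<in> S}"
proof -
  have op: "open {u. a + u *s b \<in> S}"
    by (rule open_vimage[OF f(2), of "\<lambda>u. a + u *s b", unfolded vimage_def])
       (intro continuous_intros)
  have "\<exists>f'. ((\<lambda>u. f (a + u *s b)) has_field_derivative f') (at u)" if u: "a + u *s b \<in> S" for u
  proof -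
    obtain D where D: "(f has_derivative D) (at (a + u *s b))" "\<And>c v. D (c *s v) = c * D v"
      using holomorphic_fun_onD[OF f u] by blast
    have "((\<lambda>u. a + u *s b) has_derivative (\<lambda>u. u *s b)) (at u)"
      using bounded_linear_imp_has_derivative[OF bounded_linear_smult_left[of b]]
      by (auto intro!: derivative_eq_intros)
    from has_derivative_compose[OF this D(1)]
    have "((\<lambda>u. f (a + u *s b)) has_derivative (\<lambda>u. D b * u)) (at u)"
      by (simp add: D(2) mult.commute)
    thus ?thesis unfolding has_field_derivative_def by (auto simp: mult_commute_abs)
  qed
  thus ?thesis using holomorphic_on_open[OF op] by blast
qed


section \<open>Homogeneous expansions and quadratic means\<close>

section \<open>Taylor coefficients along complex lines\<close>

text \<open>The Hardy space without its growth condition. Fixing the values off the ball makes these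
  functions Borel measurable on the whole space.\<close>

definition ball_hol :: "(complex ^ 'n \<Rightarrow> complex) \<Rightarrow> bool" where
  "ball_hol f \<longleftrightarrow> holomorphic_fun_on f (ball 0 1) \<and> (\<forall>z. z \<notin> ball 0 1 \<longrightarrow> f z = 0)"

text \<open>The homogeneous Taylor polynomial of degree \<open>k\<close>, evaluated at
  \<open>\<zeta>\<close>. Taking it along the slice through \<open>\<zeta>\<close> avoids
  multi-indices and makes sense for every \<open>\<zeta>\<close>, also off the ball.\<close>

definition slice_coeff :: "(complex ^ 'n \<Rightarrow> complex) \<Rightarrow> nat \<Rightarrow> complex ^ 'n \<Rightarrow> complex" where
  "slice_coeff f k \<zeta> = (deriv ^^ k) (\<lambda>u. f (u *s \<zeta>)) 0 / fact k"

lemma ball_hol_cut: "holomorphic_fun_on f (ball 0 1) \<Longrightarrow> ball_hol (\<lambda>z. if z \<in> ball 0 1 then f z else 0)"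
  unfolding ball_hol_def by (auto intro: holomorphic_fun_on_cong)

lemma ball_hol_add: "ball_hol f \<Longrightarrow> ball_hol g \<Longrightarrow> ball_hol (\<lambda>z. f z + g z)"
  unfolding ball_hol_def by (auto intro: holomorphic_fun_intros)

lemma ball_hol_cmult: "ball_hol f \<Longrightarrow> ball_hol (\<lambda>z. c * f z)"
  unfolding ball_hol_def by (auto intro: holomorphic_fun_intros)

lemma ball_hol_continuous_on: "ball_hol f \<Longrightarrow> continuous_on (ball 0 1) f"
  unfolding ball_hol_def by (auto intro: holomorphic_fun_on_imp_continuous_on)

lemma ball_hol_measurable:
  assumes "ball_hol f" shows "f \<in> borel_measurable borel"
proof -
  have "(\<lambda>z. if z \<in> ball 0 1 then f z else 0) \<in> borel_measurable borel"
    using ball_hol_continuous_on[OF assms] by (intro borel_measurable_continuous_on_if) auto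
  also have "(\<lambda>z. if z \<in> ball 0 1 then f z else 0) = f"
    using assms by (auto simp: ball_hol_def)
  finally show ?thesis .
qed

lemma ball_hol_bounded:
  assumes "ball_hol f" "r < 1"
  obtains B where "0 < B" "\<And>z. norm z \<le> r \<Longrightarrow> cmod (f z) \<le> B"
proof -
  have "continuous_on (cball 0 r) f"
    by (rule continuous_on_subset[OF ball_hol_continuous_on[OF assms(1)]]) (use assms(2) in auto)
  hence "bounded (f ` cball 0 r)" by (intro compact_imp_bounded compact_continuous_image) auto
  then obtain B where "\<And>z. z \<in> cball 0 r \<Longrightarrow> cmod (f z) \<le> B" "0 < B"
    unfolding bounded_pos by blast
  thus ?thesis by (intro that[of B]) auto
qed

text \<open>Radii for slices: the disc of radius \<open>1 / (norm x + 1)\<close> in the line of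
  \<open>x\<close> stays inside the ball, and adding 1 keeps the radius finite at
  \<open>x = 0\<close>.\<close>

lemma inverse_norm_bounds:
  "0 < 1 / (norm x + 1)" "1 / (norm x + 1) * norm x \<le> 1" "1 / (norm x + 1) * norm x < 1"
  for x :: "complex ^ 'n"
proof -
  have "0 < norm x + 1" by (simp add: add_nonneg_pos)
  thus "0 < 1 / (norm x + 1)" "1 / (norm x + 1) * norm x \<le> 1" "1 / (norm x + 1) * norm x < 1"
    by (simp_all add: divide_le_eq divide_less_eq)
qed

lemma slice_holomorphic:
  assumes "ball_hol f" "R * norm \<zeta> \<le> 1"
  shows "(\<lambda>u. f (u *s \<zeta>)) holomorphic_on ball 0 R"
proof -
  have "u *s \<zeta> \<in> ball 0 1" if "u \<in> ball 0 R" for u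
  proof (cases "\<zeta> = 0")
    case False
    hence "cmod u * norm \<zeta> < R * norm \<zeta>" using that by auto
    thus ?thesis using assms(2) by (simp add: norm_smult)
  qed (simp add: norm_smult)
  thus ?thesis
    using holomorphic_on_line[of f "ball 0 1" 0 \<zeta>] assms(1)
    by (auto simp: ball_hol_def elim!: holomorphic_on_subset)
qed

lemma slice_sums:
  assumes "ball_hol f" "cmod u * norm \<zeta> < 1"
  shows "(\<lambda>k. slice_coeff f k \<zeta> * u ^ k) sums f (u *s \<zeta>)"
proof -
  obtain R where R: "R * norm \<zeta> \<le> 1" "cmod u < R"
  proof (cases "\<zeta> = 0")
    case True thus ?thesis by (intro that[of "cmod u + 1"]) auto
  next
    case False thus ?thesis using assms(2) by (intro that[of "1 / norm \<zeta>"]) (auto simp: field_simps)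
  qed
  from holomorphic_power_series[OF slice_holomorphic[OF assms(1) R(1)], of u] R(2)
  show ?thesis by (simp add: slice_coeff_def)
qed

lemma slice_coeff_smult:
  assumes "ball_hol f"
  shows "slice_coeff f k (c *s \<zeta>) = c ^ k * slice_coeff f k \<zeta>"
proof -
  define R where "R = 1 / (norm \<zeta> + 1)"
  \<comment> \<open>Keeps \<open>c * w\<close> inside the first disc; adding 1 allows
    \<open>c = 0\<close>.\<close>
  define R' where "R' = R / (cmod c + 1)"
  have R: "0 < R" "R * norm \<zeta> \<le> 1"
    unfolding R_def by (fact inverse_norm_bounds)+
  moreover have "0 < R'" unfolding R'_def using R by (intro divide_pos_pos add_nonneg_pos) auto
  ultimately have RR: "0 < R" "0 < R'" "R * norm \<zeta> \<le> 1" by auto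
  have "c * w \<in> ball 0 R" if "w \<in> ball 0 R'" for w
  proof -
    have "cmod c * cmod w \<le> (cmod c + 1) * cmod w" by (intro mult_right_mono) auto
    also have "\<dots> < R"
      using that pos_less_divide_eq[of "cmod c + 1" "cmod w" R] norm_ge_zero[of c]
      by (simp add: R'_def mult.commute add_nonneg_pos)
    finally show ?thesis by (simp add: norm_mult)
  qed
  hence "(deriv ^^ k) (\<lambda>u. f ((c * u) *s \<zeta>)) 0 = c ^ k * (deriv ^^ k) (\<lambda>u. f (u *s \<zeta>)) (c * 0)"
    using RR
    by (intro higher_deriv_compose_linear[OF slice_holomorphic[OF assms RR(3)], of "ball 0 R'"]) auto
  thus ?thesis by (simp add: slice_coeff_def mult.commute)
qed

lemma slice_coeff_bound:
  assumes "ball_hol f" "0 < \<rho>" "\<rho> < 1" "\<And>z. norm z \<le> \<rho> \<Longrightarrow> cmod (f z) \<le> M" "norm \<zeta> \<le> 1"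
  shows "cmod (slice_coeff f k \<zeta>) \<le> M / \<rho> ^ k"
proof -
  have hol: "(\<lambda>u. f (u *s \<zeta>)) holomorphic_on ball 0 1"
    using assms(1,5) by (intro slice_holomorphic) auto
  have "cmod ((deriv ^^ k) (\<lambda>u. f (u *s \<zeta>)) 0) \<le> fact k * M / \<rho> ^ k"
  proof (rule Cauchy_inequality)
    show "(\<lambda>u. f (u *s \<zeta>)) holomorphic_on ball 0 \<rho>"
      using hol assms(3) by (rule_tac holomorphic_on_subset) auto
    show "continuous_on (cball 0 \<rho>) (\<lambda>u. f (u *s \<zeta>))"
      using holomorphic_on_imp_continuous_on[OF hol] assms(3)
      by (rule_tac continuous_on_subset) auto
    fix x :: complex assume "cmod (0 - x) = \<rho>"
    hence "norm (x *s \<zeta>) \<le> \<rho>" using assms(2,5) by (simp add: norm_smult mult_left_le)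
    thus "cmod (f (x *s \<zeta>)) \<le> M" by (rule assms(4))
  qed (use assms in auto)
  thus ?thesis by (simp add: slice_coeff_def norm_divide field_simps)
qed

lemma slice_coeff_add:
  assumes "ball_hol f" "ball_hol g"
  shows "slice_coeff (\<lambda>z. f z + g z) k \<zeta> = slice_coeff f k \<zeta> + slice_coeff g k \<zeta>"
proof -
  define R where "R = 1 / (norm \<zeta> + 1)"
  have RR: "0 < R" "R * norm \<zeta> \<le> 1" 
    unfolding R_def by (fact inverse_norm_bounds)+
  show ?thesis unfolding slice_coeff_def
    using RR(1) higher_deriv_add[OF slice_holomorphic[OF assms(1) RR(2)]
        slice_holomorphic[OF assms(2) RR(2)], of 0 k]
    by (simp add: add_divide_distrib)
qed

lemma slice_coeff_cmult:
  assumes "ball_hol f"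
  shows "slice_coeff (\<lambda>z. c * f z) k \<zeta> = c * slice_coeff f k \<zeta>"
proof -
  define R where "R = 1 / (norm \<zeta> + 1)"
  have RR: "0 < R" "R * norm \<zeta> \<le> 1" 
    unfolding R_def by (fact inverse_norm_bounds)+
  show ?thesis unfolding slice_coeff_def
    using RR(1) higher_deriv_cmult[OF slice_holomorphic[OF assms(1) RR(2)], of 0 k c]
    by simp
qed

text \<open>By induction the coefficient is a pointwise limit of measurable functions: subtract the
  lower Taylor terms from \<open>f (e *s \<zeta>)\<close>, divide by \<open>e ^ k\<close> and let
  \<open>e\<close> tend to 0 along a sequence.\<close>

lemma slice_coeff_measurable:
  assumes "ball_hol f"
  shows "slice_coeff f k \<in> borel_measurable borel"
proof (induction k rule: less_induct)
  case (less k)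
  have [measurable]: "f \<in> borel_measurable borel" using assms by (rule ball_hol_measurable)
  have [measurable]: "(\<lambda>\<zeta>. \<Sum>j<k. slice_coeff f j \<zeta> * c ^ j) \<in> borel_measurable borel" for c
    using less by (intro borel_measurable_sum borel_measurable_times borel_measurable_const) auto
  define e where "e m = complex_of_real (1 / real (Suc m))" for m
  have lim: "(\<lambda>m. (f (e m *s \<zeta>) - (\<Sum>j<k. slice_coeff f j \<zeta> * e m ^ j)) / e m ^ k) \<longlonglongrightarrow> slice_coeff f k \<zeta>"
    for \<zeta>
  proof -
    \<comment> \<open>For fixed \<open>\<zeta>\<close> only small \<open>e\<close> matter to the
      limit, so the values of \<open>f\<close> off the ball do no harm.\<close>
    define R where "R = 1 / (norm \<zeta> + 1)"
    have R: "0 < R" unfolding R_def by (fact inverse_norm_bounds)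
    define F where "F u = (if u = 0 then slice_coeff f k \<zeta>
        else (f (u *s \<zeta>) - (\<Sum>j<k. slice_coeff f j \<zeta> * u ^ j)) / u ^ k)" for u
    have "(\<lambda>n. slice_coeff f (n + k) \<zeta> * u ^ n) sums F u" if "cmod u < R" for u
    proof (cases "u = 0")
      case True
      thus ?thesis using powser_sums_zero[of "\<lambda>n. slice_coeff f (n + k) \<zeta>"] by (simp add: F_def)
    next
      case False
      have "cmod u * norm \<zeta> \<le> R * norm \<zeta>" using that by (intro mult_right_mono) auto
      also have "\<dots> < 1" unfolding R_def by (fact inverse_norm_bounds)
      finally have "(\<lambda>k. slice_coeff f k \<zeta> * u ^ k) sums f (u *s \<zeta>)" by (rule slice_sums[OF assms])
      hence "(\<lambda>n. slice_coeff f (n + k) \<zeta> * u ^ (n + k)) sums (f (u *s \<zeta>) - (\<Sum>j<k. slice_coeff f j \<zeta> * u ^ j))"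
        by (rule sums_split_initial_segment)
      from sums_divide[OF this, of "u ^ k"] show ?thesis
        using False by (simp add: F_def power_add)
    qed
    hence "(F \<longlongrightarrow> slice_coeff f (0 + k) \<zeta>) (at 0)" by (rule powser_limit_0[OF R])
    moreover have e0: "e m \<noteq> 0" for m by (simp add: e_def del: of_nat_Suc)
    moreover have "filterlim e (at 0) sequentially"
      unfolding filterlim_at using LIMSEQ_Suc[OF lim_const_over_n[of "1::complex"]] e0
      by (simp add: of_real_divide e_def[abs_def])
    ultimately have "(\<lambda>m. F (e m)) \<longlonglongrightarrow> slice_coeff f k \<zeta>"
      using filterlim_compose by fastforce
    with e0 show ?thesis by (simp add: F_def)
  qed
  show ?case by (rule borel_measurable_LIMSEQ_metric[OF _ lim]) measurable
qed


lemma measurable_cnj [measurable]: "cnj \<in> borel_measurable borel"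
  by (intro borel_measurable_continuous_onI continuous_intros)


section \<open>Orthogonal expansion of the quadratic means\<close>

lemma orthogonal_transformation_smult:
  "cmod c = 1 \<Longrightarrow> orthogonal_transformation (\<lambda>x :: complex ^ 'n. c *s x)"
  by (intro orthogonal_transformation_cisometryI) (auto simp: norm_smult vec_eq_iff algebra_simps)

text \<open>A single rotation is enough: since \<open>k\<close> and \<open>l\<close> differ, some
  angle \<open>\<theta>\<close> makes the factor equal to -1, so the integral is its own
  negative.\<close>

lemma sphere_integral_rotation_zero:
  fixes F :: "complex ^ 'n \<Rightarrow> complex"
  assumes "F \<in> borel_measurable borel" "k \<noteq> l"
    and T: "\<And>c. cmod c = 1 \<Longrightarrow> orthogonal_transformation (T c)"
    and hom: "\<And>c \<zeta>. cmod c = 1 \<Longrightarrow> F (T c \<zeta>) = c ^ k * cnj c ^ l * F \<zeta>"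
  shows "(\<integral>\<zeta>. F \<zeta> \<partial>sphere_measure) = 0"
proof -
  define \<theta> where "\<theta> = pi / (real k - real l)"
  have "cis \<theta> ^ k * cnj (cis \<theta>) ^ l = cis ((real k - real l) * \<theta>)"
    by (simp add: cis_cnj Complex.DeMoivre cis_mult left_diff_distrib)
  also have "(real k - real l) * \<theta> = pi" using assms(2) by (simp add: \<theta>_def)
  finally have c: "cis \<theta> ^ k * cnj (cis \<theta>) ^ l = -1" by simp
  have "(\<integral>\<zeta>. F \<zeta> \<partial>sphere_measure) = (\<integral>\<zeta>. F (T (cis \<theta>) \<zeta>) \<partial>sphere_measure)"
    using assms(1) T by (intro integral_sphere_orthogonal[symmetric]) auto
  also have "\<dots> = - (\<integral>\<zeta>. F \<zeta> \<partial>sphere_measure)" by (simp add: hom c)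
  finally show ?thesis by simp
qed

text \<open>The inner product of the homogeneous parts of degree \<open>k\<close> over the sphere.
  Parts of different degree are orthogonal, so these numbers determine all quadratic means.\<close>

definition coeff_prod :: "(complex ^ 'n \<Rightarrow> complex) \<Rightarrow> (complex ^ 'n \<Rightarrow> complex) \<Rightarrow> nat \<Rightarrow> complex" where
  "coeff_prod f g k = (\<integral>\<zeta>. slice_coeff f k \<zeta> * cnj (slice_coeff g k \<zeta>) \<partial>sphere_measure)"

definition coeff_sq :: "(complex ^ 'n \<Rightarrow> complex) \<Rightarrow> nat \<Rightarrow> real" where
  "coeff_sq f k = (\<integral>\<zeta>. (cmod (slice_coeff f k \<zeta>))\<^sup>2 \<partial>sphere_measure)"

lemma AE_slice_coeff_bounded:
  assumes "ball_hol (f :: complex ^ 'n \<Rightarrow> complex)"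
  obtains B where "AE \<zeta> in sphere_measure. cmod (slice_coeff f k \<zeta>) \<le> B"
proof -
  obtain M where M: "\<And>z. norm z \<le> 1/2 \<Longrightarrow> cmod (f z) \<le> M"
    using ball_hol_bounded[OF assms, of "1/2"] by auto
  have "AE \<zeta> in sphere_measure. cmod (slice_coeff f k \<zeta>) \<le> M / (1/2) ^ k"
    using AE_sphere_norm by eventually_elim (rule slice_coeff_bound[OF assms], use M in auto)
  thus ?thesis by (rule that)
qed

lemma integrable_slice_coeff_prod:
  assumes "ball_hol f" "ball_hol g"
  shows "integrable sphere_measure (\<lambda>\<zeta>. slice_coeff f k \<zeta> * cnj (slice_coeff g l \<zeta>))"
proof -
  obtain A B where A: "AE \<zeta> in sphere_measure. cmod (slice_coeff f k \<zeta>) \<le> A"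
    and B: "AE \<zeta> in sphere_measure. cmod (slice_coeff g l \<zeta>) \<le> B"
    using AE_slice_coeff_bounded assms by metis
  note [measurable] = slice_coeff_measurable[OF assms(1)] slice_coeff_measurable[OF assms(2)]
  show ?thesis
  proof (rule sphere.integrable_const_bound[of _ "A * B"])
    show "AE \<zeta> in sphere_measure. cmod (slice_coeff f k \<zeta> * cnj (slice_coeff g l \<zeta>)) \<le> A * B"
      using A B
    proof eventually_elim
      case (elim \<zeta>)
      have "0 \<le> A" using elim(1) norm_ge_zero order_trans by blast
      thus ?case using elim by (auto simp: norm_mult intro: mult_mono)
    qed
  qed measurable
qed

lemma coeff_prod_self: "coeff_prod f f k = of_real (coeff_sq f k)"
proof -
  have "slice_coeff f k \<zeta> * cnj (slice_coeff f k \<zeta>) = of_real ((cmod (slice_coeff f k \<zeta>))\<^sup>2)" for \<zeta>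
    by (simp only: complex_norm_square)
  thus ?thesis unfolding coeff_prod_def coeff_sq_def by (simp del: of_real_power)
qed

lemma coeff_sq_nonneg: "0 \<le> coeff_sq f k"
  by (simp add: coeff_sq_def)

lemma square_mean_nonneg: "0 \<le> square_mean f r"
  by (simp add: square_mean_def)

text \<open>Both functions are expanded into homogeneous parts; different degrees are orthogonal by
  rotation invariance, and each degree contributes \<open>r ^ k\<close> twice. Dominated convergence
  allows the exchange of sum and integral.\<close>

lemma mean_prod_sums:
  assumes f: "ball_hol f" and g: "ball_hol g" and r: "0 \<le> r" "r < 1"
  shows "(\<lambda>k. of_real (r ^ (2 * k)) * coeff_prod f g k) sums
    (\<integral>\<zeta>. f (r *\<^sub>R \<zeta>) * cnj (g (r *\<^sub>R \<zeta>)) \<partial>sphere_measure)"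
proof -
  note mf [measurable] = slice_coeff_measurable[OF f] slice_coeff_measurable[OF g]
    ball_hol_measurable[OF f] ball_hol_measurable[OF g]
  define S where "S h n \<zeta> = (\<Sum>k<n. slice_coeff h k \<zeta> * of_real r ^ k)" for h n and \<zeta> :: "complex ^ 'a"
  \<comment> \<open>Cauchy estimates at a radius above \<open>r\<close> give a geometric majorant
    with ratio \<open>r / \<rho>\<close>, uniformly on the sphere.\<close>
  define \<rho> where "\<rho> = (r + 1) / 2"
  have \<rho>: "0 < \<rho>" "\<rho> < 1" "r < \<rho>" using r by (auto simp: \<rho>_def)
  have bnd: "\<exists>B. \<forall>n \<zeta>. norm \<zeta> = 1 \<longrightarrow> cmod (S h n \<zeta>) \<le> B"
    if h: "ball_hol h" for h :: "complex ^ 'a \<Rightarrow> complex"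
  proof -
    obtain M where M: "0 < M" "\<And>z. norm z \<le> \<rho> \<Longrightarrow> cmod (h z) \<le> M"
      using ball_hol_bounded[OF h \<rho>(2)] by auto
    have "cmod (S h n \<zeta>) \<le> M * (1 / (1 - r / \<rho>))" if "norm \<zeta> = 1" for n \<zeta>
    proof -
      have "cmod (S h n \<zeta>) \<le> (\<Sum>k<n. M * (r / \<rho>) ^ k)"
        unfolding S_def
      proof (rule sum_norm_le)
        fix k
        have "cmod (slice_coeff h k \<zeta>) * r ^ k \<le> (M / \<rho> ^ k) * r ^ k"
          using slice_coeff_bound[OF h \<rho>(1,2) M(2)] that r by (intro mult_right_mono) auto
        thus "cmod (slice_coeff h k \<zeta> * of_real r ^ k) \<le> M * (r / \<rho>) ^ k"
          using r by (simp add: norm_mult norm_power power_divide)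
      qed
      also have "\<dots> = M * (\<Sum>k<n. (r / \<rho>) ^ k)" by (simp add: sum_distrib_left)
      also have "(\<Sum>k<n. (r / \<rho>) ^ k) \<le> (\<Sum>k. (r / \<rho>) ^ k)"
        using r \<rho> by (intro sum_le_suminf summable_geometric) auto
      also have "\<dots> = 1 / (1 - r / \<rho>)" using r \<rho> by (intro suminf_geometric) auto
      finally show ?thesis using M(1) by simp
    qed
    thus ?thesis by blast
  qed
  obtain A where A: "\<And>n \<zeta>. norm \<zeta> = 1 \<Longrightarrow> cmod (S f n \<zeta>) \<le> A" using bnd[OF f] by blast
  obtain B where B: "\<And>n \<zeta>. norm \<zeta> = 1 \<Longrightarrow> cmod (S g n \<zeta>) \<le> B" using bnd[OF g] by blast
  have lim: "(\<lambda>n. S h n \<zeta>) \<longlonglongrightarrow> h (r *\<^sub>R \<zeta>)" if "ball_hol h" "norm \<zeta> = 1" for h \<zeta>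
    using slice_sums[OF that(1), of "of_real r" \<zeta>] that(2) r
    by (simp add: sums_def S_def scaleR_eq_smult)
  have "(\<lambda>n. \<integral>\<zeta>. S f n \<zeta> * cnj (S g n \<zeta>) \<partial>sphere_measure) \<longlonglongrightarrow>
      (\<integral>\<zeta>. f (r *\<^sub>R \<zeta>) * cnj (g (r *\<^sub>R \<zeta>)) \<partial>sphere_measure)"
  proof (rule integral_dominated_convergence[where w = "\<lambda>_. A * B"])
    show "AE \<zeta> in sphere_measure. (\<lambda>n. S f n \<zeta> * cnj (S g n \<zeta>)) \<longlonglongrightarrow> f (r *\<^sub>R \<zeta>) * cnj (g (r *\<^sub>R \<zeta>))"
      using AE_sphere_norm by eventually_elim (intro tendsto_mult tendsto_cnj lim f g)
    show "AE \<zeta> in sphere_measure. cmod (S f n \<zeta> * cnj (S g n \<zeta>)) \<le> A * B" for n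
      using AE_sphere_norm
    proof eventually_elim
      case (elim \<zeta>)
      have "0 \<le> A" using A[OF elim, of 0] norm_ge_zero order_trans by blast
      thus ?case using A[OF elim, of n] B[OF elim, of n] by (auto simp: norm_mult intro: mult_mono)
    qed
    show "(\<lambda>\<zeta>. f (r *\<^sub>R \<zeta>) * cnj (g (r *\<^sub>R \<zeta>))) \<in> borel_measurable sphere_measure"
      by measurable
    show "(\<lambda>\<zeta>. S f n \<zeta> * cnj (S g n \<zeta>)) \<in> borel_measurable sphere_measure" for n
      unfolding S_def by measurable
  qed simp
  moreover have "(\<integral>\<zeta>. S f n \<zeta> * cnj (S g n \<zeta>) \<partial>sphere_measure) = (\<Sum>k<n. of_real (r ^ (2 * k)) * coeff_prod f g k)" for n
  proof -
    have orth: "(\<integral>\<zeta>. slice_coeff f k \<zeta> * cnj (slice_coeff g l \<zeta>) \<partial>sphere_measure) = (if k = l then coeff_prod f g k else 0)" for k l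
    proof (cases "k = l")
      case False
      have "(\<integral>\<zeta>. slice_coeff f k \<zeta> * cnj (slice_coeff g l \<zeta>) \<partial>sphere_measure) = 0"
        by (rule sphere_integral_rotation_zero[OF _ False orthogonal_transformation_smult])
           (auto simp: slice_coeff_smult f g)
      thus ?thesis using False by simp
    qed (simp add: coeff_prod_def)
    have "(\<integral>\<zeta>. S f n \<zeta> * cnj (S g n \<zeta>) \<partial>sphere_measure) =
        (\<integral>\<zeta>. (\<Sum>k<n. \<Sum>l<n. of_real (r ^ (k + l)) * (slice_coeff f k \<zeta> * cnj (slice_coeff g l \<zeta>))) \<partial>sphere_measure)"
      unfolding S_def by (intro Bochner_Integration.integral_cong)
        (auto simp: sum_product power_add mult_ac intro!: sum.cong)
    also have "\<dots> = (\<Sum>k<n. \<Sum>l<n. of_real (r ^ (k + l)) * (if k = l then coeff_prod f g k else 0))"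
      by (subst Bochner_Integration.integral_sum, intro Bochner_Integration.integrable_sum integrable_mult_right
          integrable_slice_coeff_prod f g, rule sum.cong[OF refl],
          subst Bochner_Integration.integral_sum, intro integrable_mult_right
          integrable_slice_coeff_prod f g) (simp add: orth)
    also have "\<dots> = (\<Sum>k<n. of_real (r ^ (2 * k)) * coeff_prod f g k)"
      by (simp add: if_distrib mult_2 cong: if_cong)
    finally show ?thesis .
  qed
  ultimately show ?thesis by (simp add: sums_def)
qed

lemma square_mean_sums:
  assumes f: "ball_hol f" and r: "0 \<le> r" "r < 1"
  shows "(\<lambda>k. r ^ (2 * k) * coeff_sq f k) sums square_mean f r"
proof -
  have "f (r *\<^sub>R \<zeta>) * cnj (f (r *\<^sub>R \<zeta>)) = of_real ((cmod (f (r *\<^sub>R \<zeta>)))\<^sup>2)" for \<zeta>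
    by (simp only: complex_norm_square)
  hence "(\<lambda>k. complex_of_real (r ^ (2 * k) * coeff_sq f k)) sums of_real (square_mean f r)"
    using mean_prod_sums[OF f f r] by (simp add: coeff_prod_self square_mean_def del: of_real_power)
  thus ?thesis by (simp only: sums_of_real_iff)
qed

lemma square_mean_mono:
  assumes f: "ball_hol f" and r: "0 \<le> r" "r \<le> s" "s < 1"
  shows "square_mean f r \<le> square_mean f s"
  using r by (intro sums_le[OF _ square_mean_sums[OF f] square_mean_sums[OF f]])
    (auto intro!: mult_right_mono power_mono coeff_sq_nonneg)

lemma hardy2_iff: "f \<in> hardy2 \<longleftrightarrow> ball_hol f \<and> bdd_above (square_mean f ` {0<..<1})"
  by (auto simp: hardy2_def ball_hol_def)

lemma hardy2_ball_hol: "f \<in> hardy2 \<Longrightarrow> ball_hol f"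
  by (simp add: hardy2_iff)

lemma hardy2_norm_nonneg: "f \<in> hardy2 \<Longrightarrow> 0 \<le> hardy2_norm f"
proof -
  assume "f \<in> hardy2"
  hence "square_mean f (1/2) \<le> (SUP r\<in>{0<..<1}. square_mean f r)"
    by (intro cSUP_upper) (auto simp: hardy2_iff)
  thus ?thesis unfolding hardy2_norm_def using square_mean_nonneg[of f "1/2"] by simp
qed

lemma square_mean_le_norm:
  assumes "f \<in> hardy2" "0 < r" "r < 1"
  shows "square_mean f r \<le> (hardy2_norm f)\<^sup>2"
proof -
  have "square_mean f r \<le> (SUP r\<in>{0<..<1}. square_mean f r)"
    using assms by (intro cSUP_upper) (auto simp: hardy2_iff)
  moreover have "0 \<le> square_mean f r" by (rule square_mean_nonneg)
  ultimately show ?thesis unfolding hardy2_norm_def by simp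
qed

lemma hardy2I:
  assumes "ball_hol f" "\<And>r. 0 < r \<Longrightarrow> r < 1 \<Longrightarrow> square_mean f r \<le> M\<^sup>2" "0 \<le> M"
  shows "f \<in> hardy2" "hardy2_norm f \<le> M"
proof -
  show "f \<in> hardy2" using assms by (auto simp: hardy2_iff intro!: bdd_aboveI2)
  have "(SUP r\<in>{0<..<1}. square_mean f r) \<le> M\<^sup>2" using assms by (intro cSUP_least) auto
  thus "hardy2_norm f \<le> M" unfolding hardy2_norm_def using assms(3) by (simp add: real_le_lsqrt)
qed

text \<open>Parseval's identity. Each partial sum is bounded by letting \<open>r\<close> tend to 1
  in finitely many terms; conversely the full series dominates every mean term by term.\<close>

lemma hardy2_coeff_sums:
  assumes f: "f \<in> hardy2"
  shows "coeff_sq f sums (hardy2_norm f)\<^sup>2"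
proof -
  have bf: "ball_hol f" using f by (rule hardy2_ball_hol)
  have part: "(\<Sum>k<n. coeff_sq f k) \<le> (hardy2_norm f)\<^sup>2" for n
  proof -
    have "((\<lambda>r. \<Sum>k<n. r ^ (2 * k) * coeff_sq f k) \<longlongrightarrow> (\<Sum>k<n. 1 ^ (2 * k) * coeff_sq f k)) (at_left 1)"
      by (intro tendsto_intros)
    moreover have "\<forall>\<^sub>F r in at_left 1. (\<Sum>k<n. r ^ (2 * k) * coeff_sq f k) \<le> (hardy2_norm f)\<^sup>2"
      using eventually_at_left_real[of 0 1]
    proof (rule eventually_mono)
      fix r :: real assume r: "r \<in> {0<..<1}"
      have "(\<Sum>k<n. r ^ (2 * k) * coeff_sq f k) \<le> square_mean f r"
        using square_mean_sums[OF bf, of r] r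
        by (metis (no_types, lifting) coeff_sq_nonneg greaterThanLessThan_iff less_eq_real_def
            mult_nonneg_nonneg sum_le_suminf sums_iff zero_le_power finite_lessThan)
      also have "\<dots> \<le> (hardy2_norm f)\<^sup>2" using r f by (intro square_mean_le_norm) auto
      finally show "(\<Sum>k<n. r ^ (2 * k) * coeff_sq f k) \<le> (hardy2_norm f)\<^sup>2" .
    qed simp
    ultimately show ?thesis using tendsto_upperbound by fastforce
  qed
  have sm: "summable (coeff_sq f)"
    by (rule bounded_imp_summable[of _ "(hardy2_norm f)\<^sup>2"])
       (use coeff_sq_nonneg part[of "Suc _"] in \<open>auto simp: lessThan_Suc_atMost\<close>)
  have "square_mean f r \<le> (suminf (coeff_sq f))" if "0 < r" "r < 1" for r
    using that
    by (intro sums_le[OF _ square_mean_sums[OF bf] summable_sums[OF sm]])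
       (auto intro!: mult_left_le_one_le coeff_sq_nonneg power_le_one)
  moreover have "0 \<le> suminf (coeff_sq f)" by (intro suminf_nonneg sm coeff_sq_nonneg)
  ultimately have "hardy2_norm f \<le> sqrt (suminf (coeff_sq f))"
    by (intro hardy2I(2)[OF bf]) auto
  hence "(hardy2_norm f)\<^sup>2 \<le> suminf (coeff_sq f)"
    using hardy2_norm_nonneg[OF f] \<open>0 \<le> suminf (coeff_sq f)\<close>
    by (metis power_mono real_sqrt_pow2)
  moreover have "suminf (coeff_sq f) \<le> (hardy2_norm f)\<^sup>2" by (intro suminf_le_const sm part)
  ultimately show ?thesis using sm by (simp add: sums_iff)
qed


section \<open>Moments of the sphere and the reproducing kernel\<close>

section \<open>Moments of the sphere measure\<close>

lemma prob_sphere_UNIV [simp]: "measure sphere_measure (UNIV :: (complex ^ 'n) set) = 1"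
  using sphere.prob_space by simp

lemma measurable_vec_nth_complex [measurable]:
  "(\<lambda>x :: complex ^ 'n. x $ i) \<in> borel_measurable borel"
  by (intro borel_measurable_continuous_onI continuous_intros)

lemma unit_nth_le: "norm \<zeta> = 1 \<Longrightarrow> cmod ((\<zeta> :: complex ^ 'n) $ i) \<le> 1"
  using Finite_Cartesian_Product.norm_nth_le[of \<zeta> i] by simp

lemma norm_axis_complex [simp]: "norm (axis i (1 :: complex)) = 1"
  by (simp add: norm_eq_1 inner_axis_axis)

lemma norm_eqI_cinner: "cinner x x = cinner y y \<Longrightarrow> norm x = norm y"
  unfolding cinner_self of_real_eq_iff by (simp add: power2_eq_iff_nonneg)

text \<open>The complex reflection that multiplies the line of \<open>u\<close> by \<open>b\<close>
  and fixes its orthogonal complement.\<close>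

lemma orthogonal_transformation_reflection:
  fixes u :: "complex ^ 'n"
  assumes u: "norm u = 1" and b: "cmod b = 1"
  shows "orthogonal_transformation (\<lambda>x. x + ((b - 1) * cinner x u) *s u)"
proof (rule orthogonal_transformation_cisometryI)
  show "x + y + ((b - 1) * cinner (x + y) u) *s u
      = x + ((b - 1) * cinner x u) *s u + (y + ((b - 1) * cinner y u) *s u)" for x y
    by (simp add: cinner_simps vec_eq_iff algebra_simps)
  show "c *s x + ((b - 1) * cinner (c *s x) u) *s u = c *s (x + ((b - 1) * cinner x u) *s u)" for c x
    by (simp add: cinner_simps vec_eq_iff algebra_simps)
  have bb: "b * cnj b = 1" using b complex_norm_square[of b] by simp
  have uu: "cinner u u = 1" using u by (simp add: cinner_self)
  fix x
  have xu: "cinner u x = cnj (cinner x u)" by (rule cinner_commute)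
  have "cinner (x + ((b - 1) * cinner x u) *s u) (x + ((b - 1) * cinner x u) *s u)
      = cinner x x + cinner x u * cnj (cinner x u) * ((b - 1) + (cnj b - 1) + (b - 1) * (cnj b - 1))"
    unfolding cinner_simps uu xu complex_cnj_mult complex_cnj_diff complex_cnj_one
    by (simp add: algebra_simps)
  also have "(b - 1) + (cnj b - 1) + (b - 1) * (cnj b - 1) = 0"
    by (simp add: algebra_simps bb)
  finally show "norm (x + ((b - 1) * cinner x u) *s u) = norm x"
    by (intro norm_eqI_cinner) simp
qed

text \<open>Real parts are preserved by assumption; the imaginary part is the real part after
  replacing \<open>x\<close> by \<open>(-\<i>) *s x\<close>.\<close>

lemma orthogonal_transformation_cinner:
  fixes T :: "complex ^ 'n \<Rightarrow> complex ^ 'n"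
  assumes T: "orthogonal_transformation T" and c: "\<And>c x. T (c *s x) = c *s T x"
  shows "cinner (T x) (T y) = cinner x y"
proof (rule complex_eqI)
  have re: "Re (cinner (T x) (T y)) = Re (cinner x y)" for x y
    using T by (simp add: orthogonal_transformation_def inner_eq_Re_cinner)
  show "Re (cinner (T x) (T y)) = Re (cinner x y)" by (rule re)
  show "Im (cinner (T x) (T y)) = Im (cinner x y)"
    using re[of "(-\<i>) *s x" y] unfolding c cinner_simps by simp
qed

definition sphere_moment :: "complex ^ 'n \<Rightarrow> nat \<Rightarrow> real" where
  "sphere_moment v k = (\<integral>\<zeta>. cmod (cinner \<zeta> v) ^ (2 * k) \<partial>sphere_measure)"

text \<open>A complex reflection along \<open>e - e'\<close> carries \<open>e\<close> to
  \<open>e'\<close>, and the measure is invariant under it.\<close>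

lemma sphere_moment_unit_cong:
  fixes e e' :: "complex ^ 'n"
  assumes e: "norm e = 1" and e': "norm e' = 1"
  shows "sphere_moment e k = sphere_moment e' k"
proof (cases "e = e'")
  case False
  define s where "s = cinner e e'"
  define m where "m = norm (e - e')"
  define u where "u = (1 / of_real m) *s (e - e')"
  \<comment> \<open>Solves \<open>T e = e'\<close>: the condition is
    \<open>(b - 1) * cinner e u = - m\<close>, and \<open>cinner e u = (1 - s) / m\<close>. The
    solution is unimodular because \<open>m\<^sup>2\<close> is the sum of \<open>1 - s\<close> and
    its conjugate.\<close>
  define b where "b = 1 - of_real (m\<^sup>2) / (1 - s)"
  have m0: "m \<noteq> 0" using False by (simp add: m_def)
  have ee: "cinner e e = 1" "cinner e' e' = 1" using e e' by (simp_all add: cinner_self)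
  have m2: "complex_of_real (m\<^sup>2) = 2 - s - cnj s"
    unfolding m_def cinner_self[symmetric] cinner_simps ee s_def cinner_commute[of e e'] by simp
  have s1: "1 - s \<noteq> 0"
  proof
    assume "1 - s = 0"
    hence "complex_of_real (m\<^sup>2) = 0" unfolding m2 by (simp add: algebra_simps flip: eq_iff_diff_eq_0)
    thus False using m0 by simp
  qed
  have "b = - cnj (1 - s) / (1 - s)"
    unfolding b_def m2 using s1 by (simp add: field_simps)
  hence b1: "cmod b = 1" using s1 complex_mod_cnj[of "1 - s"]
    by (simp add: norm_divide norm_minus_commute)
  have u1: "norm u = 1" using m0 unfolding u_def norm_smult by (simp add: norm_divide m_def)
  define T where "T x = x + ((b - 1) * cinner x u) *s u" for x
  have oT: "orthogonal_transformation T" unfolding T_def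
    by (rule orthogonal_transformation_reflection[OF u1 b1])
  have cT: "T (c *s x) = c *s T x" for c x
    by (simp add: T_def cinner_simps vec_eq_iff algebra_simps)
  have "(b - 1) * cinner e u / of_real m = - 1"
  proof -
    have "cinner e u = (1 - s) / of_real m" by (simp add: u_def cinner_simps ee s_def diff_divide_distrib)
    hence "(b - 1) * cinner e u / of_real m = - of_real (m\<^sup>2) / of_real m / of_real m"
      using s1 by (simp add: b_def)
    thus ?thesis using m0 by (simp add: power2_eq_square)
  qed
  hence "((b - 1) * cinner e u) *s u = - (e - e')"
    by (simp add: u_def vector_smult_assoc)
  hence Te: "T e = e'" by (simp add: T_def)
  have "sphere_moment e' k = (\<integral>\<zeta>. cmod (cinner (T \<zeta>) e') ^ (2 * k) \<partial>sphere_measure)"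
    unfolding sphere_moment_def by (rule integral_sphere_orthogonal[OF oT, symmetric]) measurable
  also have "\<dots> = sphere_moment e k"
    unfolding sphere_moment_def Te[symmetric] orthogonal_transformation_cinner[OF oT cT] ..
  finally show ?thesis ..
qed simp

lemma integrable_sphere_bounded:
  fixes F :: "complex ^ 'n \<Rightarrow> 'b::{banach,second_countable_topology}"
  assumes "F \<in> borel_measurable borel" "\<And>\<zeta>. norm \<zeta> = 1 \<Longrightarrow> norm (F \<zeta>) \<le> B"
  shows "integrable sphere_measure F"
  using AE_sphere_norm assms
  by (intro sphere.integrable_const_bound[of _ B]) (auto elim!: eventually_mono)

lemma sphere_moment_scale:
  fixes v e :: "complex ^ 'n"
  shows "norm v = a \<Longrightarrow> norm e = 1 \<Longrightarrow> sphere_moment v k = a ^ (2 * k) * sphere_moment e k"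
proof -
  assume v: "norm v = a" and e: "norm e = 1"
  show ?thesis
  proof (cases "a = 0")
    case True
    hence "v = 0" using v by simp
    thus ?thesis using True by (cases k) (auto simp: sphere_moment_def)
  next
    case False
    define w where "w = (1 / of_real a) *s v"
    have vw: "v = of_real a *s w" using False by (simp add: w_def)
    have a: "0 \<le> a" using v by auto
    have "norm w = 1" using False v a by (simp add: w_def norm_smult norm_divide)
    from sphere_moment_unit_cong[OF this e, of k]
    have "sphere_moment w k = sphere_moment e k" .
    moreover have "sphere_moment v k = a ^ (2 * k) * sphere_moment w k"
      using a unfolding sphere_moment_def vw
      by (simp add: cinner_simps norm_mult power_mult_distrib)
    ultimately show ?thesis by simp
  qed
qed

text \<open>The moment along \<open>axis i 1 + s *s axis j 1\<close>, for real s, is computed twice: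
  by scaling it is \<open>(1 + s\<^sup>2) ^ k\<close> times the unit moment; by the binomial
  expansion, whose cross terms integrate to 0, it is a polynomial in \<open>s\<^sup>2\<close>. The
  coefficient of \<open>s\<^sup>2\<close> is k times the moment in the first form and k^2 times the
  wanted integral in the second.\<close>

lemma sphere_moment_mixed:
  fixes i j :: "'n::finite"
  assumes ij: "i \<noteq> j" and k: "k > 0" and e: "norm (e :: complex ^ 'n) = 1"
  shows "(\<integral>\<zeta>. cmod (\<zeta> $ i) ^ (2 * (k - 1)) * (cmod (\<zeta> $ j))\<^sup>2 \<partial>sphere_measure)
    = sphere_moment e k / real k"
proof -
  define Q where "Q b \<zeta> = (\<zeta> $ i) ^ (k - b) * (\<zeta> $ j) ^ b" for b and \<zeta> :: "complex ^ 'n"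
  define A where "A b = (\<integral>\<zeta>. (cmod (Q b \<zeta>))\<^sup>2 \<partial>sphere_measure)" for b
  have mQ [measurable]: "Q b \<in> borel_measurable borel" for b
    unfolding Q_def by measurable
  have nQ: "cmod (Q b \<zeta>) \<le> 1" if "norm \<zeta> = 1" for b and \<zeta> :: "complex ^ 'n"
    using that by (auto simp: Q_def norm_mult norm_power intro!: mult_le_one power_le_one unit_nth_le)
  have iQ: "integrable sphere_measure (\<lambda>\<zeta>. Q b \<zeta> * cnj (Q d \<zeta>))" for b d
    by (rule integrable_sphere_bounded[of _ 1]) (auto simp: norm_mult intro!: mult_le_one nQ)
  have orth: "(\<integral>\<zeta>. Q b \<zeta> * cnj (Q d \<zeta>) \<partial>sphere_measure) = (if b = d then of_real (A b) else 0)" for b d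
  proof (cases "b = d")
    case True
    thus ?thesis unfolding A_def by (simp only: complex_norm_square[symmetric] refl if_True integral_complex_of_real)
  next
    case False
    \<comment> \<open>Rotates the coordinate \<open>j\<close> alone, so different powers of that
      coordinate become orthogonal.\<close>
    define T where "T c x = x + ((c - 1) * cinner x (axis j 1)) *s axis j 1" for c and x :: "complex ^ 'n"
    have cin: "cinner x (axis j 1) = x $ j" for x :: "complex ^ 'n"
      by (simp add: cinner_def axis_def if_distrib cong: if_cong)
    have Ti: "T c x $ i = x $ i" and Tj: "T c x $ j = c * x $ j" for c x
      unfolding T_def cin using ij by (simp_all add: axis_def algebra_simps)
    have "(\<integral>\<zeta>. Q b \<zeta> * cnj (Q d \<zeta>) \<partial>sphere_measure) = 0"
    proof (rule sphere_integral_rotation_zero[OF _ False])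
      show "orthogonal_transformation (T c)" if "cmod c = 1" for c
        unfolding T_def by (rule orthogonal_transformation_reflection[OF _ that]) simp
      show "Q b (T c \<zeta>) * cnj (Q d (T c \<zeta>)) = c ^ b * cnj c ^ d * (Q b \<zeta> * cnj (Q d \<zeta>))" for c \<zeta>
        by (simp add: Q_def Ti Tj power_mult_distrib)
    qed measurable
    thus ?thesis using False by simp
  qed
  have main: "(\<Sum>b\<le>k. (real (k choose b))\<^sup>2 * A b * (s\<^sup>2) ^ b) = sphere_moment e k * (1 + s\<^sup>2) ^ k" for s :: real
  proof -
    define v :: "complex ^ 'n" where "v = axis i 1 + of_real s *s axis j 1"
    have cv: "cinner x v = x $ i + of_real s * x $ j" for x
      by (simp add: v_def cinner_simps) (simp add: cinner_def axis_def if_distrib cong: if_cong)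
    have "cinner v v = of_real (1 + s\<^sup>2)"
      using ij by (simp add: cv) (simp add: v_def axis_def power2_eq_square)
    hence nv: "(norm v)\<^sup>2 = 1 + s\<^sup>2" unfolding cinner_self of_real_eq_iff .
    have ex: "cinner x v ^ k = (\<Sum>b\<le>k. of_nat (k choose b) * of_real s ^ b * Q b x)" for x
      unfolding cv add.commute[of "x $ i"] binomial_ring
      by (simp add: Q_def power_mult_distrib mult_ac)
    have "complex_of_real (sphere_moment v k) = (\<integral>\<zeta>. cinner \<zeta> v ^ k * cnj (cinner \<zeta> v ^ k) \<partial>sphere_measure)"
      unfolding sphere_moment_def complex_norm_square[symmetric] integral_complex_of_real norm_power
      by (simp add: power_mult mult.commute)
    also have "\<dots> = (\<integral>\<zeta>. (\<Sum>b\<le>k. \<Sum>d\<le>k. of_real (real (k choose b) * real (k choose d) * s ^ (b + d)) * (Q b \<zeta> * cnj (Q d \<zeta>))) \<partial>sphere_measure)"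
      unfolding ex by (simp add: sum_product power_add mult_ac)
    also have "\<dots> = (\<Sum>b\<le>k. \<Sum>d\<le>k. of_real (real (k choose b) * real (k choose d) * s ^ (b + d)) * (if b = d then of_real (A b) else 0))"
      by (subst Bochner_Integration.integral_sum, intro Bochner_Integration.integrable_sum integrable_mult_right iQ,
          rule sum.cong[OF refl], subst Bochner_Integration.integral_sum, intro integrable_mult_right iQ)
         (simp add: orth)
    also have "\<dots> = (\<Sum>b\<le>k. of_real (real (k choose b) * real (k choose b) * s ^ (b + b)) * of_real (A b))"
      by (simp add: if_distrib cong: if_cong)
    also have "\<dots> = of_real (\<Sum>b\<le>k. (real (k choose b))\<^sup>2 * A b * (s\<^sup>2) ^ b)"
      by (simp add: power2_eq_square power_add power_mult_distrib mult_ac)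
    finally have "sphere_moment v k = (\<Sum>b\<le>k. (real (k choose b))\<^sup>2 * A b * (s\<^sup>2) ^ b)"
      by (simp only: of_real_eq_iff)
    moreover have "sphere_moment v k = (norm v) ^ (2 * k) * sphere_moment e k"
      by (rule sphere_moment_scale[OF refl e])
    moreover have "norm v ^ (2 * k) = (1 + s\<^sup>2) ^ k" by (simp only: power_mult nv)
    ultimately show ?thesis by (simp add: mult.commute)
  qed
  \<comment> \<open>The difference of the two coefficients of \<open>x ^ b\<close> for
    \<open>x = s\<^sup>2\<close>. All of them vanish because the polynomial has infinitely many
    roots.\<close>
  define D where "D b = (real (k choose b))\<^sup>2 * A b - sphere_moment e k * real (k choose b)" for b
  have "(\<Sum>b\<le>k. D b * x ^ b) = 0" if "x \<ge> 0" for x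
  proof -
    have "(1 + x) ^ k = (\<Sum>b\<le>k. real (k choose b) * x ^ b)"
      unfolding add.commute[of 1 x] binomial_ring by simp
    hence "sphere_moment e k * (1 + x) ^ k = (\<Sum>b\<le>k. sphere_moment e k * real (k choose b) * x ^ b)"
      by (simp add: sum_distrib_left mult_ac)
    with main[of "sqrt x"] that show ?thesis
      by (simp add: D_def left_diff_distrib sum_subtractf)
  qed
  hence "{0..} \<subseteq> {x. (\<Sum>b\<le>k. D b * x ^ b) = 0}" by auto
  hence "infinite {x. (\<Sum>b\<le>k. D b * x ^ b) = 0}"
    using infinite_Ici infinite_super by blast
  hence "D 1 = 0" using polyfun_finite_roots[of D k] k by force
  hence "real k * (real k * A 1) = real k * sphere_moment e k"
    by (simp add: D_def power2_eq_square)
  hence "A 1 = sphere_moment e k / real k" using k by (simp add: field_simps)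
  thus ?thesis by (simp add: A_def Q_def norm_mult norm_power power_mult_distrib power_mult mult.commute
      flip: power_mult)
qed

text \<open>Insert the sum of all |zeta_j|^2, which is 1 on the sphere, into the moment of degree k
  along a coordinate axis: one summand is the moment of degree k + 1, and each of the other N - 1 is
  that moment divided by k + 1. The binomial coefficients satisfy the reciprocal recursion.\<close>

lemma sphere_moment_eq:
  assumes e: "norm (e :: complex ^ 'n) = 1"
  shows "sphere_moment e k * real (CARD('n) + k - 1 choose k) = 1"
proof (induction k)
  case 0
  show ?case by (simp add: sphere_moment_def)
next
  case (Suc k)
  obtain i :: 'n where True by blast
  let ?N = "CARD('n)"
  have N: "?N > 0" by simp
  have ai: "sphere_moment (axis i 1 :: complex ^ 'n) m = (\<integral>\<zeta>. cmod ((\<zeta> :: complex ^ 'n) $ i) ^ (2 * m) \<partial>sphere_measure)" for m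
    by (simp add: sphere_moment_def cinner_def axis_def if_distrib cong: if_cong)
  have ce: "sphere_moment e m = (\<integral>\<zeta>. cmod ((\<zeta> :: complex ^ 'n) $ i) ^ (2 * m) \<partial>sphere_measure)" for m
    using sphere_moment_unit_cong[OF e, of "axis i 1" m] unfolding ai by simp
  have int: "integrable sphere_measure (\<lambda>\<zeta>. cmod ((\<zeta> :: complex ^ 'n) $ i) ^ (2 * k) * (cmod (\<zeta> $ j))\<^sup>2)" for j
    by (rule integrable_sphere_bounded[of _ 1])
       (auto simp: norm_mult norm_power intro!: mult_le_one power_le_one unit_nth_le)
  have "sphere_moment e k = (\<integral>\<zeta>. (\<Sum>j\<in>UNIV. cmod ((\<zeta> :: complex ^ 'n) $ i) ^ (2 * k) * (cmod (\<zeta> $ j))\<^sup>2) \<partial>sphere_measure)"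
    unfolding ce
  proof (rule integral_cong_AE)
    show "AE \<zeta> in sphere_measure. cmod ((\<zeta> :: complex ^ 'n) $ i) ^ (2 * k) = (\<Sum>j\<in>UNIV. cmod (\<zeta> $ i) ^ (2 * k) * (cmod (\<zeta> $ j))\<^sup>2)"
      using AE_sphere_norm
    proof eventually_elim
      case (elim \<zeta>)
      have "(\<Sum>j\<in>UNIV. (cmod (\<zeta> $ j))\<^sup>2) = (norm \<zeta>)\<^sup>2"
        by (simp add: norm_vec_def L2_set_def sum_nonneg)
      thus ?case using elim by (simp add: sum_distrib_left[symmetric])
    qed
  qed measurable
  also have "\<dots> = (\<Sum>j\<in>UNIV. \<integral>\<zeta>. cmod ((\<zeta> :: complex ^ 'n) $ i) ^ (2 * k) * (cmod (\<zeta> $ j))\<^sup>2 \<partial>sphere_measure)"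
    by (rule Bochner_Integration.integral_sum) (rule int)
  also have "\<dots> = (\<Sum>j\<in>UNIV. if j = i then sphere_moment e (Suc k) else sphere_moment e (Suc k) / real (Suc k))"
  proof (rule sum.cong[OF refl])
    fix j :: 'n
    show "(\<integral>\<zeta>. cmod ((\<zeta> :: complex ^ 'n) $ i) ^ (2 * k) * (cmod (\<zeta> $ j))\<^sup>2 \<partial>sphere_measure)
       = (if j = i then sphere_moment e (Suc k) else sphere_moment e (Suc k) / real (Suc k))"
    proof (cases "j = i")
      case True
      thus ?thesis unfolding ce by (simp add: power_add[symmetric] del: power_Suc)
    next
      case False
      thus ?thesis using sphere_moment_mixed[of i j "Suc k" e] e by auto
    qed
  qed
  also have "\<dots> = sphere_moment e (Suc k) + (real ?N - 1) * (sphere_moment e (Suc k) / real (Suc k))"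
    using N by (subst sum.remove[of _ i]) (auto simp: card_Diff_singleton of_nat_diff Suc_leI)
  also have "\<dots> = sphere_moment e (Suc k) * (real (?N + k) / real (Suc k))"
    by (simp add: field_simps)
  finally have rec: "sphere_moment e k = sphere_moment e (Suc k) * (real (?N + k) / real (Suc k))" .
  have "Suc k * (Suc (?N + k - 1) choose Suc k) = Suc (?N + k - 1) * (?N + k - 1 choose k)"
    by (rule Suc_times_binomial)
  moreover have "Suc (?N + k - 1) = ?N + k" "?N + Suc k - 1 = ?N + k" using N by auto
  ultimately have "real (Suc k) * real (?N + Suc k - 1 choose Suc k) = real (?N + k) * real (?N + k - 1 choose k)"
    by (metis of_nat_mult)
  hence "real (?N + Suc k - 1 choose Suc k) = real (?N + k) / real (Suc k) * real (?N + k - 1 choose k)"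
    by (simp add: field_simps del: of_nat_Suc)
  hence "sphere_moment e (Suc k) * real (?N + Suc k - 1 choose Suc k) = sphere_moment e k * real (?N + k - 1 choose k)"
    unfolding rec by (simp only: mult.assoc)
  thus ?case using Suc.IH by simp
qed


section \<open>The reproducing formula\<close>

text \<open>The mean value property with finite averages in place of a circle integral, so that it
  commutes with integration over the sphere. The n-th roots of unity cancel the degrees 1 to n - 1,
  and the rest is bounded by a tail of an absolutely convergent series.\<close>

lemma roots_of_unity_average:
  assumes g: "g holomorphic_on ball 0 R" and R: "R > 1"
  shows "(\<lambda>n. (\<Sum>j<n. g (cis (2 * pi * real j / real n))) / of_nat n) \<longlonglongrightarrow> g 0"
proof -
  define a where "a k = (deriv ^^ k) g 0 / fact k" for k
  have sums: "(\<lambda>k. a k * w ^ k) sums g w" if "cmod w < R" for w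
    using holomorphic_power_series[OF g, of w] that by (simp add: a_def)
  \<comment> \<open>Convergence at a radius above 1 makes the coefficients absolutely
    summable.\<close>
  define \<rho> where "\<rho> = (1 + R) / 2"
  have \<rho>: "1 < \<rho>" "\<rho> < R" using R by (auto simp: \<rho>_def)
  have "summable (\<lambda>k. a k * of_real \<rho> ^ k)" using sums[of "of_real \<rho>"] \<rho> by (auto simp: sums_iff)
  hence sa: "summable (\<lambda>k. cmod (a k))" using powser_insidea[of a "of_real \<rho>" 1] \<rho> by simp
  have g0: "g 0 = a 0" by (simp add: a_def)
  define t where "t n k = (\<Sum>j<n. cis (2 * pi * real j / real n) ^ k) / of_nat n" for n k
  have t0: "t n 0 = 1" if "n > 0" for n using that by (simp add: t_def)
  have tz: "t n k = 0" if "0 < k" "k < n" for n k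
  proof -
    define w where "w = cis (2 * pi * real k / real n)"
    have "cis (2 * pi * real j / real n) ^ k = w ^ j" for j
      by (simp add: w_def Complex.DeMoivre mult_ac)
    hence "t n k = (\<Sum>j<n. w ^ j) / of_nat n" by (simp add: t_def)
    moreover have "w ^ n = 1"
      using that cis_multiple_2pi[of "real k"] by (simp add: w_def Complex.DeMoivre mult_ac)
    moreover have "w \<noteq> 1"
    proof
      assume "w = 1"
      hence "cos (2 * pi * real k / real n) = 1" unfolding w_def by (metis Re_complex_of_real cis.sel(1) of_real_1)
      then obtain x :: int where "2 * pi * real k / real n = of_int x * 2 * pi"
        using cos_one_2pi_int by auto
      hence "real k = of_int x * real n" using that by (simp add: field_simps)
      hence "int k = x * int n" by (metis of_int_eq_iff of_int_mult of_int_of_nat_eq)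
      thus False using that by (metis dvd_triv_right int_dvd_int_iff nat_dvd_not_less)
    qed
    ultimately show ?thesis by (simp add: geometric_sum)
  qed
  have t1: "cmod (t n k) \<le> 1" for n k
  proof (cases "n = 0")
    case False
    have "cmod (\<Sum>j<n. cis (2 * pi * real j / real n) ^ k) \<le> (\<Sum>j<n. 1)"
      by (rule sum_norm_le) (simp add: norm_power)
    thus ?thesis using False by (simp add: t_def norm_divide divide_le_eq)
  qed (simp add: t_def)
  have avg: "(\<lambda>k. a k * t n k) sums ((\<Sum>j<n. g (cis (2 * pi * real j / real n))) / of_nat n)" for n
  proof -
    have "(\<lambda>k. \<Sum>j<n. a k * cis (2 * pi * real j / real n) ^ k) sums (\<Sum>j<n. g (cis (2 * pi * real j / real n)))"
      using R by (intro sums_sum sums) simp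
    from sums_divide[OF this, of "of_nat n"] show ?thesis
      by (simp add: t_def sum_distrib_left)
  qed
  have bound: "cmod ((\<Sum>j<n. g (cis (2 * pi * real j / real n))) / of_nat n - g 0) \<le> (\<Sum>k. cmod (a (k + n)))"
    if n: "n > 0" for n
  proof -
    have "(\<lambda>k. a (k + n) * t n (k + n)) sums
      ((\<Sum>j<n. g (cis (2 * pi * real j / real n))) / of_nat n - (\<Sum>k<n. a k * t n k))"
      by (rule sums_split_initial_segment[OF avg])
    moreover have "(\<Sum>k<n. a k * t n k) = (\<Sum>k<n. if k = 0 then a 0 else 0)"
      by (rule sum.cong) (auto simp: t0 tz n)
    moreover have "\<dots> = g 0" using n by (simp add: g0)
    ultimately have s: "(\<lambda>k. a (k + n) * t n (k + n)) sums ((\<Sum>j<n. g (cis (2 * pi * real j / real n))) / of_nat n - g 0)"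
      by simp
    have sn: "summable (\<lambda>k. cmod (a (k + n)))" by (rule summable_ignore_initial_segment[OF sa])
    have le: "cmod (a (k + n) * t n (k + n)) \<le> cmod (a (k + n))" for k
      using t1 by (simp add: norm_mult mult_left_le)
    have sn': "summable (\<lambda>k. cmod (a (k + n) * t n (k + n)))"
      by (rule summable_comparison_test'[OF sn]) (use le in auto)
    have "cmod (\<Sum>k. a (k + n) * t n (k + n)) \<le> (\<Sum>k. cmod (a (k + n) * t n (k + n)))"
      by (rule summable_norm[OF sn'])
    also have "\<dots> \<le> (\<Sum>k. cmod (a (k + n)))" by (rule suminf_le[OF le sn' sn])
    finally show ?thesis using s by (simp add: sums_iff)
  qed
  have "(\<lambda>n. (\<Sum>k. cmod (a (k + n)))) \<longlonglongrightarrow> 0" by (rule suminf_exist_split2[OF sa])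
  hence "(\<lambda>n. (\<Sum>j<n. g (cis (2 * pi * real j / real n))) / of_nat n - g 0) \<longlonglongrightarrow> 0"
    by (rule Lim_null_comparison[rotated])
       (use bound in \<open>auto simp: eventually_sequentially intro!: exI[of _ 1]\<close>)
  thus ?thesis by (simp add: LIM_zero_iff)
qed

text \<open>Averaging over the rotations that fix \<open>e\<close> and using the mean value property on the discs
  \<open>u \<mapsto> \<langle>\<zeta>,e\<rangle> e + u (\<zeta> - \<langle>\<zeta>,e\<rangle> e)\<close>.\<close>

lemma sphere_integral_project:
  fixes f :: "complex ^ 'n \<Rightarrow> complex"
  assumes f: "ball_hol f" and r: "0 \<le> r" "r < 1" and e: "norm e = 1"
  shows "(\<integral>\<zeta>. f (r *\<^sub>R \<zeta>) * cnj (cinner \<zeta> e) ^ k \<partial>sphere_measure)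
    = (\<integral>\<zeta>. f (cinner \<zeta> e *s (r *\<^sub>R e)) * cnj (cinner \<zeta> e) ^ k \<partial>sphere_measure)"
proof -
  have [measurable]: "f \<in> borel_measurable borel" by (rule ball_hol_measurable[OF f])
  have ee: "cinner e e = 1" using e by (simp add: cinner_self)
  \<comment> \<open>Multiplies the orthogonal complement of \<open>e\<close> by \<open>u\<close> and
    fixes \<open>e\<close>: the identity for \<open>u = 1\<close>, unitary for unimodular
    \<open>u\<close>, and the projection to the line of \<open>e\<close> for
    \<open>u = 0\<close>.\<close>
  define T where "T u x = u *s x + ((1 - u) * cinner x e) *s e" for u and x :: "complex ^ 'n"
  have mT [measurable]: "T u \<in> borel_measurable borel" for u unfolding T_def by measurable
  have T1: "T 1 x = x" for x by (simp add: T_def)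
  have T0: "T 0 x = cinner x e *s e" for x by (simp add: T_def)
  have cT: "cinner (T u x) e = cinner x e" for u x by (simp add: T_def cinner_simps ee algebra_simps)
  have oT: "orthogonal_transformation (T u)" if u: "cmod u = 1" for u
  proof (rule orthogonal_transformation_cisometryI)
    show "T u (x + y) = T u x + T u y" for x y
      by (simp add: T_def cinner_simps vec_eq_iff algebra_simps)
    show "T u (c *s x) = c *s T u x" for c x
      by (simp add: T_def cinner_simps vec_eq_iff algebra_simps)
    fix x
    have "u \<noteq> 0" using u by auto
    have "T u x = u *s (x + ((cnj u - 1) * cinner x e) *s e)"
    proof -
      have "u * cnj u = 1" using u complex_norm_square[of u] by simp
      thus ?thesis by (simp add: T_def vec_eq_iff algebra_simps)
    qed
    moreover have "norm (x + ((cnj u - 1) * cinner x e) *s e) = norm x"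
      using orthogonal_transformation_norm[OF orthogonal_transformation_reflection[OF e, of "cnj u"], of x] u
      by simp
    ultimately show "norm (T u x) = norm x" by (simp only: norm_smult u mult_1_left)
  qed
  \<comment> \<open>Factors \<open>u\<close> of modulus above 1 are included because the averaging
    lemma asks for a disc of radius \<open>R > 1\<close>.\<close>
  have nT: "norm (T u x) \<le> max 1 (cmod u) * norm x" for u x
  proof -
    have "cinner (T u x) (T u x) = cinner x e * cnj (cinner x e) + u * cnj u * (cinner x x - cinner x e * cnj (cinner x e))"
      unfolding T_def cinner_simps ee cinner_commute[of x e] complex_cnj_mult complex_cnj_diff complex_cnj_one
      by (simp add: algebra_simps)
    hence eq: "(norm (T u x))\<^sup>2 = (cmod (cinner x e))\<^sup>2 + (cmod u)\<^sup>2 * ((norm x)\<^sup>2 - (cmod (cinner x e))\<^sup>2)"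
      unfolding cinner_self complex_norm_square[symmetric]
      by (simp only: of_real_eq_iff of_real_add[symmetric] of_real_mult[symmetric] of_real_diff[symmetric])
    have "cmod (cinner x e) \<le> norm x" using cmod_cinner_le[of x e] e by simp
    hence d: "(cmod (cinner x e))\<^sup>2 \<le> (norm x)\<^sup>2" by (intro power_mono) auto
    let ?m = "max 1 (cmod u)"
    have m: "1 \<le> ?m\<^sup>2" "(cmod u)\<^sup>2 \<le> ?m\<^sup>2"
      by (auto intro!: power_mono one_le_power)
    have "(norm (T u x))\<^sup>2 \<le> ?m\<^sup>2 * (cmod (cinner x e))\<^sup>2 + ?m\<^sup>2 * ((norm x)\<^sup>2 - (cmod (cinner x e))\<^sup>2)"
      unfolding eq
    proof (rule add_mono)
      show "(cmod (cinner x e))\<^sup>2 \<le> ?m\<^sup>2 * (cmod (cinner x e))\<^sup>2"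
        using mult_right_mono[OF m(1), of "(cmod (cinner x e))\<^sup>2"] by simp
      show "(cmod u)\<^sup>2 * ((norm x)\<^sup>2 - (cmod (cinner x e))\<^sup>2) \<le> ?m\<^sup>2 * ((norm x)\<^sup>2 - (cmod (cinner x e))\<^sup>2)"
        using m(2) d by (intro mult_right_mono) auto
    qed
    also have "\<dots> = (?m * norm x)\<^sup>2" by (simp add: power_mult_distrib algebra_simps)
    finally show ?thesis by (rule power2_le_imp_le) (simp add: zero_le_mult_iff)
  qed
  define \<psi> where "\<psi> \<zeta> = cnj (cinner \<zeta> e) ^ k" for \<zeta>
  have [measurable]: "\<psi> \<in> borel_measurable borel" unfolding \<psi>_def by measurable
  have \<psi>1: "cmod (\<psi> \<zeta>) \<le> 1" if "norm \<zeta> = 1" for \<zeta>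
    using cmod_cinner_le[of \<zeta> e] that e by (simp add: \<psi>_def norm_power power_le_one)
  obtain M where M: "0 < M" "\<And>z. norm z \<le> r \<Longrightarrow> cmod (f z) \<le> M"
    using ball_hol_bounded[OF f r(2)] by auto
  define F where "F u \<zeta> = f (r *\<^sub>R T u \<zeta>) * \<psi> \<zeta>" for u \<zeta>
  have [measurable]: "F u \<in> borel_measurable borel" for u unfolding F_def by measurable
  have F_le: "cmod (F u \<zeta>) \<le> M" if "norm \<zeta> = 1" "cmod u \<le> 1" for u \<zeta>
  proof -
    have "norm (T u \<zeta>) \<le> 1" using nT[of u \<zeta>] that by (simp add: max_def split: if_splits)
    hence "cmod (f (r *\<^sub>R T u \<zeta>)) \<le> M" using r by (intro M(2)) (simp add: mult_left_le)
    hence "cmod (f (r *\<^sub>R T u \<zeta>)) * cmod (\<psi> \<zeta>) \<le> M * 1"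
      using \<psi>1[OF that(1)] M(1) by (intro mult_mono) auto
    thus ?thesis by (simp add: F_def norm_mult)
  qed
  define G where "G n \<zeta> = (\<Sum>j<n. F (cis (2 * pi * real j / real n)) \<zeta>) / of_nat n" for n \<zeta>
  have IG: "(\<integral>\<zeta>. G n \<zeta> \<partial>sphere_measure) = (\<integral>\<zeta>. F 1 \<zeta> \<partial>sphere_measure)" if "n > 0" for n
  proof -
    have eq: "(\<integral>\<zeta>. F u \<zeta> \<partial>sphere_measure) = (\<integral>\<zeta>. F 1 \<zeta> \<partial>sphere_measure)" if "cmod u = 1" for u
    proof -
      have "F u \<zeta> = F 1 (T u \<zeta>)" for \<zeta> by (simp add: F_def T1 \<psi>_def cT)
      thus ?thesis using integral_sphere_orthogonal[OF oT[OF that], of "F 1"] by simp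
    qed
    have int: "integrable sphere_measure (F u)" if "cmod u = 1" for u
      by (rule integrable_sphere_bounded[of _ M]) (use F_le that in auto)
    have "(\<integral>\<zeta>. G n \<zeta> \<partial>sphere_measure)
        = (\<Sum>j<n. \<integral>\<zeta>. F (cis (2 * pi * real j / real n)) \<zeta> \<partial>sphere_measure) / of_nat n"
      unfolding G_def by (subst integral_divide_zero, subst Bochner_Integration.integral_sum) (auto intro: int)
    also have "\<dots> = (\<Sum>j<n. \<integral>\<zeta>. F 1 \<zeta> \<partial>sphere_measure) / of_nat n"
      by (intro arg_cong2[of _ _ _ _ "(/)"] sum.cong refl eq) simp
    finally show ?thesis using that by simp
  qed
  have "(\<lambda>n. \<integral>\<zeta>. G n \<zeta> \<partial>sphere_measure) \<longlonglongrightarrow> (\<integral>\<zeta>. F 0 \<zeta> \<partial>sphere_measure)"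
  proof (rule integral_dominated_convergence[where w = "\<lambda>_. M"])
    show "AE \<zeta> in sphere_measure. (\<lambda>n. G n \<zeta>) \<longlonglongrightarrow> F 0 \<zeta>"
      using AE_sphere_norm
    proof eventually_elim
      case (elim \<zeta>)
      \<comment> \<open>Larger than 1, while \<open>r * R\<close> stays below 1.\<close>
      define R where "R = 2 / (1 + r)"
      have R: "R > 1" "r * R < 1" using r by (auto simp: R_def field_simps)
      define p where "p = r *\<^sub>R (cinner \<zeta> e *s e)"
      define q where "q = r *\<^sub>R (\<zeta> - cinner \<zeta> e *s e)"
      have pq: "r *\<^sub>R T u \<zeta> = p + u *s q" for u
        by (simp add: p_def q_def T_def vec_eq_iff algebra_simps scaleR_conv_of_real[where 'a=complex])
      have "(\<lambda>u. f (p + u *s q)) holomorphic_on ball 0 R"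
      proof (rule holomorphic_on_subset[OF holomorphic_on_line[of f "ball 0 1"]])
        show "ball 0 R \<subseteq> {u. p + u *s q \<in> ball 0 1}"
        proof
          fix u :: complex assume "u \<in> ball 0 R"
          hence "max 1 (cmod u) \<le> R" using R by simp
          moreover have "norm (T u \<zeta>) \<le> max 1 (cmod u)" using nT[of u \<zeta>] elim by simp
          ultimately have "r * norm (T u \<zeta>) \<le> r * R" using r by (intro mult_left_mono) auto
          hence "norm (r *\<^sub>R T u \<zeta>) < 1" using R(2) r by simp
          thus "u \<in> {u. p + u *s q \<in> ball 0 1}" by (simp add: pq)
        qed
      qed (use f in \<open>auto simp: ball_hol_def\<close>)
      hence "(\<lambda>u. F u \<zeta>) holomorphic_on ball 0 R"
        unfolding F_def pq by (intro holomorphic_intros)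
      from roots_of_unity_average[OF this R(1)] show ?case by (simp add: G_def)
    qed
    show "AE \<zeta> in sphere_measure. norm (G n \<zeta>) \<le> M" for n
      using AE_sphere_norm
    proof eventually_elim
      case (elim \<zeta>)
      have "cmod (\<Sum>j<n. F (cis (2 * pi * real j / real n)) \<zeta>) \<le> (\<Sum>j<n. M)"
        by (rule sum_norm_le) (use F_le[OF elim] in auto)
      thus ?case using M(1) by (cases "n = 0") (auto simp: G_def norm_divide field_simps)
    qed
  qed (simp_all add: G_def)
  moreover have "(\<lambda>n. \<integral>\<zeta>. G n \<zeta> \<partial>sphere_measure) \<longlonglongrightarrow> (\<integral>\<zeta>. F 1 \<zeta> \<partial>sphere_measure)"
    by (rule tendsto_eventually) (use IG in \<open>auto simp: eventually_sequentially intro!: exI[of _ 1]\<close>)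
  ultimately have "(\<integral>\<zeta>. F 1 \<zeta> \<partial>sphere_measure) = (\<integral>\<zeta>. F 0 \<zeta> \<partial>sphere_measure)"
    using LIMSEQ_unique by blast
  thus ?thesis
    by (simp add: F_def T1 T0 \<psi>_def scaleR_eq_smult vector_smult_assoc mult.commute)
qed

text \<open>After projection to the line of \<open>e\<close> the function is a power series in
  \<open>cinner \<zeta> e\<close>, and rotations leave only its term of degree
  \<open>k\<close>.\<close>

lemma sphere_integral_coeff:
  fixes f :: "complex ^ 'n \<Rightarrow> complex"
  assumes f: "ball_hol f" and r: "0 \<le> r" "r < 1" and e: "norm e = 1"
  shows "(\<integral>\<zeta>. f (r *\<^sub>R \<zeta>) * cnj (cinner \<zeta> e) ^ k \<partial>sphere_measure)
    = of_real (r ^ k * sphere_moment e k) * slice_coeff f k e"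
proof -
  have [measurable]: "f \<in> borel_measurable borel" by (rule ball_hol_measurable[OF f])
  have ee: "cinner e e = 1" using e by (simp add: cinner_self)
  have le1: "cmod (cinner \<zeta> e) \<le> 1" if "norm \<zeta> = 1" for \<zeta> using cmod_cinner_le[of \<zeta> e] e that by simp
  define a where "a l = slice_coeff f l e * of_real r ^ l" for l
  have "(\<lambda>l. a l * w ^ l) sums f (w *s (r *\<^sub>R e))" if "cmod w \<le> 1" for w
  proof -
    have "cmod (of_real r * w) * norm e < 1" using that r e mult_left_le[of "cmod w" r] by (simp add: norm_mult)
    from slice_sums[OF f this] show ?thesis
      by (simp add: a_def power_mult_distrib scaleR_eq_smult vector_smult_assoc mult_ac)
  qed
  note sums = this
  have sa: "summable (\<lambda>l. cmod (a l))"
  proof -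
    define \<rho> where "\<rho> = (1 + r) / 2"
    have \<rho>: "r < \<rho>" "\<rho> < 1" "0 < \<rho>" using r by (auto simp: \<rho>_def)
    have "summable (\<lambda>l. slice_coeff f l e * of_real \<rho> ^ l)"
      using slice_sums[OF f, of "of_real \<rho>" e] \<rho> e by (auto simp: sums_iff)
    from powser_insidea[OF this, of "of_real r"] show ?thesis
      using \<rho> r by (simp add: a_def)
  qed
  define I where "I l = (\<integral>\<zeta>. cinner \<zeta> e ^ l * cnj (cinner \<zeta> e) ^ k \<partial>sphere_measure)" for l
  have I: "I l = (if l = k then of_real (sphere_moment e k) else 0)" for l
  proof (cases "l = k")
    case True
    thus ?thesis unfolding I_def sphere_moment_def
      by (simp add: power_mult_distrib[symmetric] complex_norm_square[symmetric] power_mult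
        flip: of_real_power integral_complex_of_real)
  next
    case False
    have "I l = 0" unfolding I_def
      by (rule sphere_integral_rotation_zero[OF _ False orthogonal_transformation_smult])
         (auto simp: cinner_simps power_mult_distrib)
    thus ?thesis using False by simp
  qed
  define S where "S n \<zeta> = (\<Sum>l<n. a l * (cinner \<zeta> e ^ l * cnj (cinner \<zeta> e) ^ k))" for n \<zeta>
  have "(\<lambda>n. \<integral>\<zeta>. S n \<zeta> \<partial>sphere_measure) \<longlonglongrightarrow>
    (\<integral>\<zeta>. f (cinner \<zeta> e *s (r *\<^sub>R e)) * cnj (cinner \<zeta> e) ^ k \<partial>sphere_measure)"
  proof (rule integral_dominated_convergence[where w = "\<lambda>_. \<Sum>l. cmod (a l)"])
    show "AE \<zeta> in sphere_measure. (\<lambda>n. S n \<zeta>) \<longlonglongrightarrow> f (cinner \<zeta> e *s (r *\<^sub>R e)) * cnj (cinner \<zeta> e) ^ k"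
      using AE_sphere_norm
    proof eventually_elim
      case (elim \<zeta>)
      from sums_mult2[OF sums[OF le1[OF elim]], of "cnj (cinner \<zeta> e) ^ k"]
      show ?case by (simp add: S_def sums_def mult.assoc)
    qed
    show "AE \<zeta> in sphere_measure. norm (S n \<zeta>) \<le> (\<Sum>l. cmod (a l))" for n
      using AE_sphere_norm
    proof eventually_elim
      case (elim \<zeta>)
      have "cmod (S n \<zeta>) \<le> (\<Sum>l<n. cmod (a l))" unfolding S_def
        using le1[OF elim]
        by (intro sum_norm_le)
           (auto simp: norm_mult norm_power intro!: mult_left_le mult_le_one power_le_one)
      also have "\<dots> \<le> (\<Sum>l. cmod (a l))" by (intro sum_le_suminf sa) auto
      finally show ?case .
    qed
  qed (simp_all add: S_def)
  moreover have "(\<integral>\<zeta>. S n \<zeta> \<partial>sphere_measure) = (\<Sum>l<n. a l * I l)" for n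
    unfolding S_def I_def
    by (subst Bochner_Integration.integral_sum, intro integrable_mult_right integrable_sphere_bounded[of _ 1])
       (auto simp: norm_mult norm_power intro!: mult_le_one power_le_one le1)
  ultimately have "(\<lambda>l. a l * I l) sums
    (\<integral>\<zeta>. f (cinner \<zeta> e *s (r *\<^sub>R e)) * cnj (cinner \<zeta> e) ^ k \<partial>sphere_measure)"
    by (simp add: sums_def)
  moreover have "(\<lambda>l. a l * I l) sums (a k * of_real (sphere_moment e k))"
    unfolding I using sums_single[of k "\<lambda>l. a l * of_real (sphere_moment e k)"]
    by (simp add: if_distrib cong: if_cong)
  ultimately have "(\<integral>\<zeta>. f (cinner \<zeta> e *s (r *\<^sub>R e)) * cnj (cinner \<zeta> e) ^ k \<partial>sphere_measure)
    = a k * of_real (sphere_moment e k)" using sums_unique2 by blast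
  thus ?thesis unfolding sphere_integral_project[OF f r e] by (simp add: a_def)
qed

text \<open>The Szego kernel of the ball, which reproduces the Hardy space.\<close>

definition hardy_kernel :: "complex ^ 'n \<Rightarrow> complex ^ 'n \<Rightarrow> complex" where
  "hardy_kernel z w = inverse (1 - cinner z w) ^ CARD('n)"

lemma negative_binomial_sums:
  fixes x :: complex
  assumes "cmod x < 1" "N > 0"
  shows "(\<lambda>k. of_nat (N + k - 1 choose k) * x ^ k) sums inverse (1 - x) ^ N"
proof -
  have "(\<lambda>k. ((- of_nat N :: complex) gchoose k) * (- x) ^ k) sums (1 + (- x)) powr (- of_nat N)"
    using assms by (intro gen_binomial_complex) simp
  moreover have "((- of_nat N :: complex) gchoose k) * (- x) ^ k = of_nat (N + k - 1 choose k) * x ^ k" for k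
  proof -
    have "(- of_nat N :: complex) gchoose k = (- 1) ^ k * ((of_nat N + of_nat k - 1) gchoose k)"
      by (rule gbinomial_minus)
    also have "(of_nat N + of_nat k - 1 :: complex) = of_nat (N + k - 1)" using assms(2) by (simp add: of_nat_diff)
    finally have "(- of_nat N :: complex) gchoose k = (- 1) ^ k * of_nat (N + k - 1 choose k)"
      by (simp add: binomial_gbinomial)
    thus ?thesis by (simp add: power_mult_distrib[symmetric] mult_ac flip: power_mult_distrib)
  qed
  moreover have "(1 + (- x)) powr (- of_nat N) = inverse (1 - x) ^ N"
  proof -
    have "1 - x \<noteq> 0" using assms(1) by auto
    thus ?thesis by (simp add: powr_minus powr_nat' power_inverse)
  qed
  ultimately show ?thesis by simp
qed

lemma negative_binomial_summable:
  fixes x :: real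
  assumes "0 \<le> x" "x < 1" "N > 0"
  shows "summable (\<lambda>k. real (N + k - 1 choose k) * x ^ k)"
proof -
  have "summable (\<lambda>k. of_nat (N + k - 1 choose k) * complex_of_real x ^ k)"
    using negative_binomial_sums[of "of_real x" N] assms by (auto simp: sums_iff)
  hence "summable (\<lambda>k. complex_of_real (real (N + k - 1 choose k) * x ^ k))" by simp
  thus ?thesis by (simp only: summable_of_real_iff)
qed

text \<open>The coefficients of the negative binomial series of the kernel are exactly the
  reciprocals of the sphere moments. The formula is stated for a dilate of \<open>f\<close>, which
  is defined up to the sphere.\<close>

lemma reproducing_formula:
  fixes f :: "complex ^ 'n \<Rightarrow> complex"
  assumes f: "ball_hol f" and r: "0 \<le> r" "r < 1" and z: "norm z < 1"
  shows "(\<integral>\<zeta>. f (r *\<^sub>R \<zeta>) * hardy_kernel z \<zeta> \<partial>sphere_measure) = f (r *\<^sub>R z)"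
proof -
  let ?N = "CARD('n)"
  have [measurable]: "f \<in> borel_measurable borel" by (rule ball_hol_measurable[OF f])
  obtain e :: "complex ^ 'n" where e: "norm e = 1" and ze: "z = of_real (norm z) *s e"
  proof (cases "z = 0")
    case True
    show ?thesis using True by (intro that[of "axis undefined 1"]) auto
  next
    case False
    thus ?thesis by (intro that[of "(1 / of_real (norm z)) *s z"])
      (auto simp: norm_smult norm_divide vector_smult_assoc)
  qed
  define c where "c k = (of_nat (?N + k - 1 choose k) :: complex)" for k
  have cin: "cinner z \<zeta> ^ k = of_real (norm z ^ k) * cnj (cinner \<zeta> e) ^ k" for \<zeta> k
    by (subst ze) (simp add: cinner_simps power_mult_distrib flip: cinner_commute)
  have coeff: "(\<integral>\<zeta>. f (r *\<^sub>R \<zeta>) * (c k * cinner z \<zeta> ^ k) \<partial>sphere_measure) = slice_coeff f k z * of_real r ^ k" for k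
  proof -
    have "(\<integral>\<zeta>. f (r *\<^sub>R \<zeta>) * (c k * cinner z \<zeta> ^ k) \<partial>sphere_measure)
      = (\<integral>\<zeta>. (c k * of_real (norm z ^ k)) * (f (r *\<^sub>R \<zeta>) * cnj (cinner \<zeta> e) ^ k) \<partial>sphere_measure)"
      unfolding cin by (simp only: mult_ac)
    also have "\<dots> = (c k * of_real (norm z ^ k)) * (of_real (r ^ k * sphere_moment e k) * slice_coeff f k e)"
      by (simp only: integral_mult_right_zero sphere_integral_coeff[OF f r e])
    also have "\<dots> = of_real (sphere_moment e k * real (?N + k - 1 choose k)) * of_real r ^ k * (of_real (norm z) ^ k * slice_coeff f k e)"
      by (simp add: c_def mult_ac)
    also have "\<dots> = of_real r ^ k * slice_coeff f k z"
      unfolding sphere_moment_eq[OF e] by (subst (2) ze) (simp add: slice_coeff_smult[OF f])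
    finally show ?thesis by (simp add: mult.commute)
  qed
  have le: "cmod (cinner z \<zeta>) \<le> norm z" if "norm \<zeta> = 1" for \<zeta>
    using cmod_cinner_le[of z \<zeta>] that by simp
  obtain M where M: "0 < M" "\<And>z. norm z \<le> r \<Longrightarrow> cmod (f z) \<le> M"
    using ball_hol_bounded[OF f r(2)] by auto
  have sc: "summable (\<lambda>k. cmod (c k) * norm z ^ k)"
    using negative_binomial_summable[of "norm z" ?N] z by (simp add: c_def)
  define S where "S n \<zeta> = (\<Sum>k<n. f (r *\<^sub>R \<zeta>) * (c k * cinner z \<zeta> ^ k))" for n \<zeta>
  have bnd: "cmod (f (r *\<^sub>R \<zeta>) * (c k * cinner z \<zeta> ^ k)) \<le> M * (cmod (c k) * norm z ^ k)"
    if "norm \<zeta> = 1" for k \<zeta>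
    unfolding norm_mult norm_power using M(1) le[OF that] that r
    by (intro mult_mono power_mono M(2)) auto
  have "(\<lambda>n. \<integral>\<zeta>. S n \<zeta> \<partial>sphere_measure) \<longlonglongrightarrow> (\<integral>\<zeta>. f (r *\<^sub>R \<zeta>) * hardy_kernel z \<zeta> \<partial>sphere_measure)"
  proof (rule integral_dominated_convergence[where w = "\<lambda>_. M * (\<Sum>k. cmod (c k) * norm z ^ k)"])
    show "AE \<zeta> in sphere_measure. (\<lambda>n. S n \<zeta>) \<longlonglongrightarrow> f (r *\<^sub>R \<zeta>) * hardy_kernel z \<zeta>"
      using AE_sphere_norm
    proof eventually_elim
      case (elim \<zeta>)
      have "cmod (cinner z \<zeta>) < 1" using le[OF elim] z by simp
      from sums_mult[OF negative_binomial_sums[OF this, of ?N], of "f (r *\<^sub>R \<zeta>)"]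
      show ?case by (simp add: S_def sums_def c_def hardy_kernel_def)
    qed
    show "AE \<zeta> in sphere_measure. norm (S n \<zeta>) \<le> M * (\<Sum>k. cmod (c k) * norm z ^ k)" for n
      using AE_sphere_norm
    proof eventually_elim
      case (elim \<zeta>)
      have "cmod (S n \<zeta>) \<le> (\<Sum>k<n. M * (cmod (c k) * norm z ^ k))"
        unfolding S_def by (rule sum_norm_le) (rule bnd[OF elim])
      also have "\<dots> \<le> M * (\<Sum>k. cmod (c k) * norm z ^ k)"
        unfolding sum_distrib_left[symmetric] using M(1) sc by (intro mult_left_mono sum_le_suminf) auto
      finally show ?case .
    qed
  qed (simp_all add: S_def hardy_kernel_def)
  moreover have "(\<integral>\<zeta>. S n \<zeta> \<partial>sphere_measure) = (\<Sum>k<n. slice_coeff f k z * of_real r ^ k)" for n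
    unfolding S_def coeff[symmetric]
    by (rule Bochner_Integration.integral_sum, rule integrable_sphere_bounded) (measurable, rule bnd)
  ultimately have "(\<lambda>k. slice_coeff f k z * of_real r ^ k) sums (\<integral>\<zeta>. f (r *\<^sub>R \<zeta>) * hardy_kernel z \<zeta> \<partial>sphere_measure)"
    by (simp add: sums_def)
  moreover have "(\<lambda>k. slice_coeff f k z * of_real r ^ k) sums f (of_real r *s z)"
    using r z mult_left_le[of "norm z" r] by (intro slice_sums[OF f]) auto
  ultimately show ?thesis using sums_unique2 by (fastforce simp: scaleR_eq_smult)
qed


section \<open>Norm, point evaluations and inner product of the Hardy space\<close>

section \<open>The Hardy space as a normed space\<close>

lemma sphere_Cauchy_Schwarz:
  fixes f g :: "complex ^ 'n \<Rightarrow> complex"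
  assumes [measurable]: "f \<in> borel_measurable borel" "g \<in> borel_measurable borel"
    and f: "\<And>\<zeta>. norm \<zeta> = 1 \<Longrightarrow> cmod (f \<zeta>) \<le> A" and g: "\<And>\<zeta>. norm \<zeta> = 1 \<Longrightarrow> cmod (g \<zeta>) \<le> B"
  shows "cmod (\<integral>\<zeta>. f \<zeta> * g \<zeta> \<partial>sphere_measure)
    \<le> sqrt (\<integral>\<zeta>. (cmod (f \<zeta>))\<^sup>2 \<partial>sphere_measure) * sqrt (\<integral>\<zeta>. (cmod (g \<zeta>))\<^sup>2 \<partial>sphere_measure)"
proof -
  let ?S = "sphere_measure :: (complex ^ 'n) measure"
  define a where "a = (\<integral>\<zeta>. cmod (f \<zeta>) * cmod (g \<zeta>) \<partial>?S)"
  define F where "F = (\<integral>\<zeta>. (cmod (f \<zeta>))\<^sup>2 \<partial>?S)"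
  define G where "G = (\<integral>\<zeta>. (cmod (g \<zeta>))\<^sup>2 \<partial>?S)"
  have nn: "0 \<le> a" "0 \<le> F" "0 \<le> G" by (auto simp: a_def F_def G_def)
  have "ennreal a = (\<integral>\<^sup>+\<zeta>. ennreal (cmod (f \<zeta>) * cmod (g \<zeta>)) \<partial>?S)"
    unfolding a_def
    by (rule nn_integral_eq_integral[symmetric], rule integrable_sphere_bounded[of _ "A * B"])
       (auto simp: norm_mult intro!: mult_mono f g order_trans[OF norm_ge_zero f])
  moreover have "ennreal F = (\<integral>\<^sup>+\<zeta>. ennreal (cmod (f \<zeta>)) ^ 2 \<partial>?S)"
    unfolding F_def ennreal_power[OF norm_ge_zero]
    by (rule nn_integral_eq_integral[symmetric], rule integrable_sphere_bounded[of _ "A\<^sup>2"])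
       (auto intro!: power_mono f)
  moreover have "ennreal G = (\<integral>\<^sup>+\<zeta>. ennreal (cmod (g \<zeta>)) ^ 2 \<partial>?S)"
    unfolding G_def ennreal_power[OF norm_ge_zero]
    by (rule nn_integral_eq_integral[symmetric], rule integrable_sphere_bounded[of _ "B\<^sup>2"])
       (auto intro!: power_mono g)
  ultimately have "(ennreal a)\<^sup>2 \<le> ennreal F * ennreal G"
    using Cauchy_Schwarz_nn_integral[of "\<lambda>\<zeta>. ennreal (cmod (f \<zeta>))" ?S "\<lambda>\<zeta>. ennreal (cmod (g \<zeta>))"]
    by (simp add: ennreal_mult)
  hence "a\<^sup>2 \<le> F * G" using nn by (simp add: ennreal_power flip: ennreal_mult)
  hence "a \<le> sqrt F * sqrt G" using real_le_rsqrt real_sqrt_mult by metis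
  moreover have "cmod (\<integral>\<zeta>. f \<zeta> * g \<zeta> \<partial>?S) \<le> a"
    unfolding a_def using integral_norm_bound[of ?S "\<lambda>\<zeta>. f \<zeta> * g \<zeta>"] by (simp add: norm_mult)
  ultimately show ?thesis by (simp add: F_def G_def)
qed

lemma ball_hol_dilate:
  assumes "ball_hol f" "0 \<le> r" "r < 1"
  shows "(\<lambda>\<zeta>. f (r *\<^sub>R \<zeta>)) \<in> borel_measurable borel"
    and "\<exists>B. \<forall>\<zeta>. norm \<zeta> = 1 \<longrightarrow> cmod (f (r *\<^sub>R \<zeta>)) \<le> B"
proof -
  have [measurable]: "f \<in> borel_measurable borel" by (rule ball_hol_measurable[OF assms(1)])
  show "(\<lambda>\<zeta>. f (r *\<^sub>R \<zeta>)) \<in> borel_measurable borel" by measurable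
  obtain M where "\<And>z. norm z \<le> r \<Longrightarrow> cmod (f z) \<le> M"
    using ball_hol_bounded[OF assms(1,3)] by auto
  thus "\<exists>B. \<forall>\<zeta>. norm \<zeta> = 1 \<longrightarrow> cmod (f (r *\<^sub>R \<zeta>)) \<le> B"
    using assms(2) by (intro exI[of _ M]) auto
qed

lemma cmod_mean_prod_le:
  assumes "ball_hol f" "ball_hol g" "0 \<le> r" "r < 1" "0 \<le> s" "s < 1"
  shows "cmod (\<integral>\<zeta>. f (r *\<^sub>R \<zeta>) * cnj (g (s *\<^sub>R \<zeta>)) \<partial>sphere_measure)
    \<le> sqrt (square_mean f r) * sqrt (square_mean g s)"
proof -
  note [measurable] = ball_hol_dilate(1)[OF assms(1,3,4)] ball_hol_dilate(1)[OF assms(2,5,6)]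
  obtain A B where "\<And>\<zeta>. norm \<zeta> = 1 \<Longrightarrow> cmod (f (r *\<^sub>R \<zeta>)) \<le> A"
    "\<And>\<zeta>. norm \<zeta> = 1 \<Longrightarrow> cmod (g (s *\<^sub>R \<zeta>)) \<le> B"
    using ball_hol_dilate(2)[OF assms(1,3,4)] ball_hol_dilate(2)[OF assms(2,5,6)] by blast
  hence "cmod (\<integral>\<zeta>. f (r *\<^sub>R \<zeta>) * cnj (g (s *\<^sub>R \<zeta>)) \<partial>sphere_measure)
    \<le> sqrt (\<integral>\<zeta>. (cmod (f (r *\<^sub>R \<zeta>)))\<^sup>2 \<partial>sphere_measure)
      * sqrt (\<integral>\<zeta>. (cmod (cnj (g (s *\<^sub>R \<zeta>))))\<^sup>2 \<partial>sphere_measure)"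
    by (intro sphere_Cauchy_Schwarz[where A = A and B = B]) auto
  thus ?thesis by (simp add: square_mean_def)
qed

lemma square_mean_of_real:
  "complex_of_real (square_mean f r) = (\<integral>\<zeta>. f (r *\<^sub>R \<zeta>) * cnj (f (r *\<^sub>R \<zeta>)) \<partial>sphere_measure)"
  unfolding square_mean_def by (simp only: complex_norm_square[symmetric] integral_complex_of_real)

lemma integrable_mean_prod:
  assumes "ball_hol f" "ball_hol g" "0 \<le> r" "r < 1"
  shows "integrable sphere_measure (\<lambda>\<zeta>. f (r *\<^sub>R \<zeta>) * cnj (g (r *\<^sub>R \<zeta>)))"
proof -
  note [measurable] = ball_hol_dilate(1)[OF assms(1,3,4)] ball_hol_dilate(1)[OF assms(2,3,4)]
  obtain A B where AB: "\<And>\<zeta>. norm \<zeta> = 1 \<Longrightarrow> cmod (f (r *\<^sub>R \<zeta>)) \<le> A"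
    "\<And>\<zeta>. norm \<zeta> = 1 \<Longrightarrow> cmod (g (r *\<^sub>R \<zeta>)) \<le> B"
    using ball_hol_dilate(2)[OF assms(1,3,4)] ball_hol_dilate(2)[OF assms(2,3,4)] by blast
  show ?thesis
    by (rule integrable_sphere_bounded[of _ "A * B"])
       (auto simp: norm_mult intro!: mult_mono AB order_trans[OF norm_ge_zero AB(1)])
qed

lemma square_mean_add_le:
  assumes f: "ball_hol f" and g: "ball_hol g" and r: "0 \<le> r" "r < 1"
  shows "sqrt (square_mean (\<lambda>z. f z + g z) r) \<le> sqrt (square_mean f r) + sqrt (square_mean g r)"
proof -
  let ?I = "\<lambda>u v. \<integral>\<zeta>. u (r *\<^sub>R \<zeta>) * cnj (v (r *\<^sub>R \<zeta>)) \<partial>sphere_measure"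
  have "complex_of_real (square_mean (\<lambda>z. f z + g z) r) = ?I f f + ?I f g + (?I g f + ?I g g)"
    unfolding square_mean_of_real using f g r
    by (simp add: algebra_simps Bochner_Integration.integral_add integrable_mean_prod Bochner_Integration.integrable_add)
  also have "?I g f = cnj (?I f g)"
    by (subst Bochner_Integration.integral_cnj[symmetric]) (simp add: mult.commute)
  finally have "complex_of_real (square_mean (\<lambda>z. f z + g z) r)
      = of_real (square_mean f r) + ?I f g + (cnj (?I f g) + of_real (square_mean g r))"
    by (simp only: square_mean_of_real)
  hence "square_mean (\<lambda>z. f z + g z) r = square_mean f r + square_mean g r + 2 * Re (?I f g)"
    by (simp add: complex_eq_iff)
  also have "\<dots> \<le> square_mean f r + square_mean g r + 2 * (sqrt (square_mean f r) * sqrt (square_mean g r))"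
    using order_trans[OF complex_Re_le_cmod cmod_mean_prod_le[OF f g r r]] by simp
  also have "\<dots> = (sqrt (square_mean f r) + sqrt (square_mean g r))\<^sup>2"
    by (simp add: power2_sum square_mean_nonneg)
  finally show ?thesis by (intro real_le_lsqrt) (auto simp: square_mean_nonneg)
qed

lemma square_mean_cmult: "square_mean (\<lambda>z. c * f z) r = (cmod c)\<^sup>2 * square_mean f r"
  by (simp add: square_mean_def norm_mult power_mult_distrib)

lemma hardy2_add:
  assumes f: "f \<in> hardy2" and g: "g \<in> hardy2"
  shows "(\<lambda>z. f z + g z) \<in> hardy2" "hardy2_norm (\<lambda>z. f z + g z) \<le> hardy2_norm f + hardy2_norm g"
proof -
  have "square_mean (\<lambda>z. f z + g z) r \<le> (hardy2_norm f + hardy2_norm g)\<^sup>2" if "0 < r" "r < 1" for r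
  proof -
    have "sqrt (square_mean (\<lambda>z. f z + g z) r) \<le> sqrt (square_mean f r) + sqrt (square_mean g r)"
      using that f g by (intro square_mean_add_le) (auto simp: hardy2_ball_hol)
    also have "\<dots> \<le> hardy2_norm f + hardy2_norm g"
      using square_mean_le_norm[OF f that] square_mean_le_norm[OF g that] f g
      by (intro add_mono real_le_lsqrt) (auto simp: hardy2_norm_nonneg square_mean_nonneg)
    finally show ?thesis using sqrt_le_D by blast
  qed
  note * = hardy2I[OF ball_hol_add[OF hardy2_ball_hol[OF f] hardy2_ball_hol[OF g]] this]
  show "(\<lambda>z. f z + g z) \<in> hardy2" "hardy2_norm (\<lambda>z. f z + g z) \<le> hardy2_norm f + hardy2_norm g"
    using * f g by (auto simp: hardy2_norm_nonneg)
qed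

lemma hardy2_cmult_le:
  assumes f: "f \<in> hardy2"
  shows "(\<lambda>z. c * f z) \<in> hardy2" "hardy2_norm (\<lambda>z. c * f z) \<le> cmod c * hardy2_norm f"
proof -
  have *: "square_mean (\<lambda>z. c * f z) r \<le> (cmod c * hardy2_norm f)\<^sup>2" if "0 < r" "r < 1" for r
    using square_mean_le_norm[OF f that]
    by (simp add: square_mean_cmult power_mult_distrib mult_left_mono)
  note ** = hardy2I[OF ball_hol_cmult[OF hardy2_ball_hol[OF f]] *]
  show "(\<lambda>z. c * f z) \<in> hardy2" "hardy2_norm (\<lambda>z. c * f z) \<le> cmod c * hardy2_norm f"
    using ** f by (auto simp: hardy2_norm_nonneg)
qed

lemma hardy2_norm_cmult:
  assumes f: "f \<in> hardy2"
  shows "hardy2_norm (\<lambda>z. c * f z) = cmod c * hardy2_norm f"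
proof (cases "c = 0")
  case True
  thus ?thesis using hardy2_cmult_le[OF f, of c] hardy2_norm_nonneg[OF hardy2_cmult_le(1)[OF f, of c]] by simp
next
  case False
  have le: "hardy2_norm f \<le> cmod (inverse c) * hardy2_norm (\<lambda>z. c * f z)"
    using hardy2_cmult_le(2)[OF hardy2_cmult_le(1)[OF f, of c], of "inverse c"] False
    by (simp add: mult.assoc[symmetric])
  have "cmod c * hardy2_norm f \<le> hardy2_norm (\<lambda>z. c * f z)"
    using mult_left_mono[OF le, of "cmod c"] False by (simp add: norm_inverse mult.assoc[symmetric])
  with hardy2_cmult_le(2)[OF f, of c] show ?thesis by simp
qed

lemma hardy2_diff:
  assumes f: "f \<in> hardy2" and g: "g \<in> hardy2"
  shows "(\<lambda>z. f z - g z) \<in> hardy2" "hardy2_norm (\<lambda>z. f z - g z) \<le> hardy2_norm f + hardy2_norm g"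
  using hardy2_add[OF f hardy2_cmult_le(1)[OF g, of "-1"]] hardy2_norm_cmult[OF g, of "-1"] by simp_all

lemma hardy2_zero:
  shows "(\<lambda>_ :: complex ^ 'n. 0) \<in> hardy2" "hardy2_norm (\<lambda>_ :: complex ^ 'n. 0) = 0"
proof -
  have "ball_hol (\<lambda>_ :: complex ^ 'n. 0)" by (simp add: ball_hol_def holomorphic_fun_on_const)
  hence *: "(\<lambda>_ :: complex ^ 'n. 0) \<in> hardy2" "hardy2_norm (\<lambda>_ :: complex ^ 'n. 0) \<le> 0"
    by (auto intro!: hardy2I[of _ 0] simp: square_mean_def)
  show "(\<lambda>_ :: complex ^ 'n. 0) \<in> hardy2" by (rule *)
  show "hardy2_norm (\<lambda>_ :: complex ^ 'n. 0) = 0"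
    using *(2) hardy2_norm_nonneg[OF *(1)] by simp
qed

text \<open>The means inherit a pointwise bound. Weighted functions and eigenfunctions are shown to
  lie in the space by comparing them with a known member.\<close>

lemma hardy2_comparison:
  assumes f: "f \<in> hardy2" and g: "ball_hol g" and le: "\<And>z. norm z < 1 \<Longrightarrow> cmod (g z) \<le> M * cmod (f z)"
    and M: "0 \<le> M"
  shows "g \<in> hardy2" "hardy2_norm g \<le> M * hardy2_norm f"
proof -
  have "square_mean g r \<le> (M * hardy2_norm f)\<^sup>2" if r: "0 < r" "r < 1" for r
  proof -
    have bf: "ball_hol f" using f by (rule hardy2_ball_hol)
    note [measurable] = ball_hol_measurable[OF bf] ball_hol_measurable[OF g]
    obtain A B where AB: "\<And>\<zeta>. norm \<zeta> = 1 \<Longrightarrow> cmod (f (r *\<^sub>R \<zeta>)) \<le> A"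
      "\<And>\<zeta>. norm \<zeta> = 1 \<Longrightarrow> cmod (g (r *\<^sub>R \<zeta>)) \<le> B"
      using ball_hol_dilate(2)[OF bf] ball_hol_dilate(2)[OF g] r by (meson less_imp_le)
    have "square_mean g r \<le> (\<integral>\<zeta>. M\<^sup>2 * (cmod (f (r *\<^sub>R \<zeta>)))\<^sup>2 \<partial>sphere_measure)"
      unfolding square_mean_def
    proof (rule integral_mono_AE)
      show "integrable sphere_measure (\<lambda>\<zeta>. (cmod (g (r *\<^sub>R \<zeta>)))\<^sup>2)"
        by (rule integrable_sphere_bounded[of _ "B\<^sup>2"]) (auto intro!: power_mono AB)
      show "integrable sphere_measure (\<lambda>\<zeta>. M\<^sup>2 * (cmod (f (r *\<^sub>R \<zeta>)))\<^sup>2)"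
        by (intro integrable_mult_right integrable_sphere_bounded[of _ "A\<^sup>2"]) (auto intro!: power_mono AB)
      show "AE \<zeta> in sphere_measure. (cmod (g (r *\<^sub>R \<zeta>)))\<^sup>2 \<le> M\<^sup>2 * (cmod (f (r *\<^sub>R \<zeta>)))\<^sup>2"
        using AE_sphere_norm
      proof eventually_elim
        case (elim \<zeta>)
        thus ?case using le[of "r *\<^sub>R \<zeta>"] r by (simp add: power_mono flip: power_mult_distrib)
      qed
    qed
    also have "\<dots> = M\<^sup>2 * square_mean f r" by (simp add: square_mean_def)
    also have "\<dots> \<le> M\<^sup>2 * (hardy2_norm f)\<^sup>2" using square_mean_le_norm[OF f r] by (intro mult_left_mono) auto
    finally show ?thesis by (simp add: power_mult_distrib)
  qed
  from hardy2I[OF g this] M hardy2_norm_nonneg[OF f]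
  show "g \<in> hardy2" "hardy2_norm g \<le> M * hardy2_norm f" by auto
qed

lemma hardy_kernel_measurable [measurable (raw)]:
  fixes f g :: "_ \<Rightarrow> complex ^ 'n"
  assumes "f \<in> borel_measurable M" "g \<in> borel_measurable M"
  shows "(\<lambda>x. hardy_kernel (f x) (g x)) \<in> borel_measurable M"
  using assms unfolding hardy_kernel_def by measurable

lemma cmod_hardy_kernel_le:
  fixes z w :: "complex ^ 'n"
  assumes "norm z * norm w \<le> \<rho>" "\<rho> < 1"
  shows "cmod (hardy_kernel z w) \<le> (1 / (1 - \<rho>)) ^ CARD('n)"
proof -
  have "1 - \<rho> \<le> cmod (1 - cinner z w)"
    using norm_triangle_ineq2[of 1 "cinner z w"] cmod_cinner_le[of z w] assms by simp
  hence "inverse (cmod (1 - cinner z w)) \<le> 1 / (1 - \<rho>)"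
    using assms(2) by (simp add: inverse_eq_divide frac_le)
  thus ?thesis unfolding hardy_kernel_def norm_power norm_inverse by (intro power_mono) auto
qed

text \<open>The reproducing formula at a radius between \<open>\<rho>\<close> and 1, followed by
  Cauchy-Schwarz. It makes convergence in norm locally uniform.\<close>

lemma hardy2_point_evaluation:
  assumes \<rho>: "\<rho> < 1"
  obtains C where "0 < C" "\<And>f z. (f :: complex ^ 'n \<Rightarrow> complex) \<in> hardy2 \<Longrightarrow> norm z \<le> \<rho> \<Longrightarrow> cmod (f z) \<le> C * hardy2_norm f"
proof -
  define \<rho>' where "\<rho>' = max \<rho> 0"
  have \<rho>': "0 \<le> \<rho>'" "\<rho>' < 1" "\<rho> \<le> \<rho>'" using \<rho> by (auto simp: \<rho>'_def)
  define r where "r = (1 + \<rho>') / 2"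
  have r: "0 < r" "r < 1" "\<rho>' < r" using \<rho>' by (auto simp: r_def)
  define C where "C = (1 / (1 - \<rho>' / r)) ^ CARD('n)"
  have q: "\<rho>' / r < 1" using r by simp
  have C: "0 < C" using q by (simp add: C_def)
  have "cmod (f z) \<le> C * hardy2_norm f" if f: "f \<in> hardy2" and z: "norm z \<le> \<rho>"
    for f :: "complex ^ 'n \<Rightarrow> complex" and z
  proof -
    have bf: "ball_hol f" using f by (rule hardy2_ball_hol)
    note [measurable] = ball_hol_measurable[OF bf]
    \<comment> \<open>Rescaled so that the formula for the dilate, taken at \<open>w\<close>,
      evaluates \<open>f\<close> at \<open>z\<close>.\<close>
    define w where "w = (1 / r) *\<^sub>R z"
    have w: "norm w \<le> \<rho>' / r" using z r \<rho>' by (simp add: w_def divide_right_mono)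
    have zw: "z = r *\<^sub>R w" using r by (simp add: w_def)
    have Kle: "cmod (hardy_kernel w \<zeta>) \<le> C" if "norm \<zeta> = 1" for \<zeta>
      unfolding C_def using w that q by (intro cmod_hardy_kernel_le) auto
    obtain A where A: "\<And>\<zeta>. norm \<zeta> = 1 \<Longrightarrow> cmod (f (r *\<^sub>R \<zeta>)) \<le> A"
      using ball_hol_dilate(2)[OF bf] r by (meson less_imp_le)
    have "f z = (\<integral>\<zeta>. f (r *\<^sub>R \<zeta>) * hardy_kernel w \<zeta> \<partial>sphere_measure)"
      unfolding zw using r le_less_trans[OF w q] by (intro reproducing_formula[OF bf, symmetric]) auto
    also have "cmod \<dots> \<le> sqrt (\<integral>\<zeta>. (cmod (f (r *\<^sub>R \<zeta>)))\<^sup>2 \<partial>sphere_measure) * sqrt (\<integral>\<zeta>. (cmod (hardy_kernel w \<zeta>))\<^sup>2 \<partial>sphere_measure)"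
      by (rule sphere_Cauchy_Schwarz[OF _ _ A Kle]) measurable
    also have "\<dots> \<le> hardy2_norm f * C"
    proof (rule mult_mono)
      show "sqrt (\<integral>\<zeta>. (cmod (f (r *\<^sub>R \<zeta>)))\<^sup>2 \<partial>sphere_measure) \<le> hardy2_norm f"
        using square_mean_le_norm[OF f r(1,2)] hardy2_norm_nonneg[OF f]
        by (intro real_le_lsqrt) (auto simp: square_mean_def)
      have "(\<integral>\<zeta>. (cmod (hardy_kernel w \<zeta>))\<^sup>2 \<partial>sphere_measure) \<le> (\<integral>\<zeta>. C\<^sup>2 \<partial>(sphere_measure :: (complex ^ 'n) measure))"
      proof (rule integral_mono_AE)
        show "integrable sphere_measure (\<lambda>\<zeta>. (cmod (hardy_kernel w \<zeta>))\<^sup>2)"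
          by (rule integrable_sphere_bounded[of _ "C\<^sup>2"]) (auto intro!: power_mono Kle)
        show "AE \<zeta> in sphere_measure. (cmod (hardy_kernel w \<zeta>))\<^sup>2 \<le> C\<^sup>2"
          using AE_sphere_norm by eventually_elim (auto intro!: power_mono Kle)
      qed simp
      thus "sqrt (\<integral>\<zeta>. (cmod (hardy_kernel w \<zeta>))\<^sup>2 \<partial>sphere_measure) \<le> C"
        using C by (intro real_le_lsqrt) auto
    qed (auto simp: hardy2_norm_nonneg f)
    finally show ?thesis by (simp add: mult.commute)
  qed
  thus ?thesis using C that by blast
qed

lemma hardy2_norm_eq_0:
  assumes f: "f \<in> hardy2" and "hardy2_norm f = 0"
  shows "f = 0"
proof
  fix z
  show "f z = 0 z"
  proof (cases "norm z < 1")
    case True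
    obtain C where "0 < C" "\<And>g y. (g :: complex ^ 'a \<Rightarrow> complex) \<in> hardy2 \<Longrightarrow> norm y \<le> norm z \<Longrightarrow> cmod (g y) \<le> C * hardy2_norm g"
      using hardy2_point_evaluation[OF True] by metis
    from this(2)[OF f order_refl] show ?thesis using assms(2) by simp
  next
    case False
    thus ?thesis using hardy2_ball_hol[OF f] by (simp add: ball_hol_def)
  qed
qed


text \<open>Defined through homogeneous parts, since no boundary values are at hand;
  \<open>summable_coeff_prod\<close> gives the convergence.\<close>

definition hardy2_inner :: "(complex ^ 'n \<Rightarrow> complex) \<Rightarrow> (complex ^ 'n \<Rightarrow> complex) \<Rightarrow> complex" where
  "hardy2_inner f g = (\<Sum>k. coeff_prod f g k)"

lemma coeff_prod_add_left:
  assumes "ball_hol f" "ball_hol g" "ball_hol h"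
  shows "coeff_prod (\<lambda>z. f z + g z) h k = coeff_prod f h k + coeff_prod g h k"
  unfolding coeff_prod_def using assms
  by (simp add: slice_coeff_add distrib_right Bochner_Integration.integral_add integrable_slice_coeff_prod)

lemma coeff_prod_cmult_left:
  assumes "ball_hol f"
  shows "coeff_prod (\<lambda>z. c * f z) h k = c * coeff_prod f h k"
  unfolding coeff_prod_def using assms by (simp add: slice_coeff_cmult mult.assoc)

lemma coeff_prod_commute: "coeff_prod g f k = cnj (coeff_prod f g k)"
  unfolding coeff_prod_def by (subst Bochner_Integration.integral_cnj[symmetric]) (simp add: mult.commute)

lemma coeff_sq_diff:
  assumes "ball_hol f" "ball_hol g"
  shows "coeff_sq (\<lambda>z. f z - g z) k = coeff_sq f k + coeff_sq g k - 2 * Re (coeff_prod f g k)"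
proof -
  let ?g = "\<lambda>z. (-1) * g z" let ?d = "\<lambda>z. f z + (-1) * g z"
  have bg: "ball_hol ?g" using ball_hol_cmult[OF assms(2)] .
  have bd: "ball_hol ?d" using ball_hol_add[OF assms(1) bg] .
  have 1: "coeff_prod ?d h k = coeff_prod f h k - coeff_prod g h k" if "ball_hol h" for h
    using coeff_prod_add_left[OF assms(1) bg that, of k] coeff_prod_cmult_left[OF assms(2), of "-1" h k] by simp
  have 2: "coeff_prod h ?d k = coeff_prod h f k - coeff_prod h g k" if "ball_hol h" for h
    using 1[OF that] by (metis coeff_prod_commute complex_cnj_diff)
  have "coeff_prod ?d ?d k = coeff_prod f f k - coeff_prod f g k - (coeff_prod g f k - coeff_prod g g k)"
    using 1[OF bd] 2[OF assms(1)] 2[OF assms(2)] by simp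
  thus ?thesis
    unfolding coeff_prod_self coeff_prod_commute[of g f] by (simp add: complex_eq_iff)
qed

text \<open>Multiply \<open>g\<close> by the phase that makes the product nonnegative and use that
  \<open>coeff_sq\<close> of the resulting difference is nonnegative.\<close>

lemma cmod_coeff_prod_le:
  assumes "ball_hol f" "ball_hol g"
  shows "cmod (coeff_prod f g k) \<le> (coeff_sq f k + coeff_sq g k) / 2"
proof -
  define c where "c = sgn (coeff_prod f g k)"
  have bg: "ball_hol (\<lambda>z. c * g z)" using ball_hol_cmult[OF assms(2)] .
  have "coeff_prod f (\<lambda>z. c * g z) k = cnj c * coeff_prod f g k"
    by (subst coeff_prod_commute, subst coeff_prod_cmult_left[OF assms(2)], subst coeff_prod_commute) simp
  also have "\<dots> = of_real (cmod (coeff_prod f g k))"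
    by (cases "coeff_prod f g k = 0")
       (auto simp: c_def sgn_eq mult.commute[of "cnj _"] complex_norm_square[symmetric] power2_eq_square)
  finally have "Re (coeff_prod f (\<lambda>z. c * g z) k) = cmod (coeff_prod f g k)" by simp
  moreover have "coeff_sq (\<lambda>z. c * g z) k = (cmod c)\<^sup>2 * coeff_sq g k"
    by (simp add: coeff_sq_def slice_coeff_cmult[OF assms(2)] norm_mult power_mult_distrib)
  moreover have "(cmod c)\<^sup>2 \<le> 1" by (auto simp: c_def norm_sgn)
  hence "(cmod c)\<^sup>2 * coeff_sq g k \<le> coeff_sq g k"
    using coeff_sq_nonneg[of g k] by (intro mult_left_le_one_le) auto
  ultimately show ?thesis
    using coeff_sq_nonneg[of "\<lambda>z. f z - c * g z" k] coeff_sq_diff[OF assms(1) bg, of k] by simp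
qed

lemma summable_coeff_prod:
  assumes f: "f \<in> hardy2" and g: "g \<in> hardy2"
  shows "summable (coeff_prod f g)"
proof (rule summable_comparison_test')
  show "summable (\<lambda>k. (coeff_sq f k + coeff_sq g k) / 2)"
    using hardy2_coeff_sums[OF f] hardy2_coeff_sums[OF g]
    by (intro summable_divide summable_add) (auto simp: sums_iff)
  show "norm (coeff_prod f g k) \<le> (coeff_sq f k + coeff_sq g k) / 2" for k
    using f g by (intro cmod_coeff_prod_le) (auto simp: hardy2_ball_hol)
qed

lemma hardy2_inner_add_left:
  assumes "f \<in> hardy2" "g \<in> hardy2" "h \<in> hardy2"
  shows "hardy2_inner (\<lambda>z. f z + g z) h = hardy2_inner f h + hardy2_inner g h"
proof -
  have "(\<lambda>k. coeff_prod f h k + coeff_prod g h k) sums (hardy2_inner f h + hardy2_inner g h)"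
    unfolding hardy2_inner_def by (intro sums_add summable_sums summable_coeff_prod assms)
  moreover have "coeff_prod (\<lambda>z. f z + g z) h = (\<lambda>k. coeff_prod f h k + coeff_prod g h k)"
    using assms by (auto simp: coeff_prod_add_left hardy2_ball_hol)
  ultimately show ?thesis unfolding hardy2_inner_def by (simp add: sums_iff)
qed

lemma hardy2_inner_cmult_left:
  assumes "f \<in> hardy2" "h \<in> hardy2"
  shows "hardy2_inner (\<lambda>z. c * f z) h = c * hardy2_inner f h"
proof -
  have "(\<lambda>k. c * coeff_prod f h k) sums (c * hardy2_inner f h)"
    unfolding hardy2_inner_def by (intro sums_mult summable_sums summable_coeff_prod assms)
  moreover have "coeff_prod (\<lambda>z. c * f z) h = (\<lambda>k. c * coeff_prod f h k)"
    using assms by (auto simp: coeff_prod_cmult_left hardy2_ball_hol)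
  ultimately show ?thesis unfolding hardy2_inner_def by (simp add: sums_iff)
qed

lemma hardy2_norm_diff:
  assumes f: "f \<in> hardy2" and g: "g \<in> hardy2"
  shows "(hardy2_norm (\<lambda>z. f z - g z))\<^sup>2 = (hardy2_norm f)\<^sup>2 + (hardy2_norm g)\<^sup>2 - 2 * Re (hardy2_inner f g)"
proof -
  have "(\<lambda>k. Re (coeff_prod f g k)) sums Re (hardy2_inner f g)"
    unfolding hardy2_inner_def by (intro sums_Re summable_sums summable_coeff_prod f g)
  hence "(\<lambda>k. coeff_sq f k + coeff_sq g k - 2 * Re (coeff_prod f g k)) sums
      ((hardy2_norm f)\<^sup>2 + (hardy2_norm g)\<^sup>2 - 2 * Re (hardy2_inner f g))"
    by (intro sums_diff sums_add sums_mult hardy2_coeff_sums f g)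
  moreover have "(\<lambda>k. coeff_sq f k + coeff_sq g k - 2 * Re (coeff_prod f g k)) sums
      (hardy2_norm (\<lambda>z. f z - g z))\<^sup>2"
    using hardy2_coeff_sums[OF hardy2_diff(1)[OF f g]] f g
    by (subst coeff_sq_diff[symmetric]) (simp_all add: hardy2_ball_hol)
  ultimately show ?thesis using sums_unique2 by blast
qed


section \<open>Positive kernels and the contraction estimate\<close>

section \<open>Positive kernels on the sphere\<close>

interpretation sphere2: pair_prob_space "sphere_measure :: (complex ^ 'n) measure" "sphere_measure :: (complex ^ 'n) measure"
  by unfold_locales

text \<open>Bounded at every point, not just almost everywhere, so that products, Fubini and
  dominated convergence apply without side conditions. The map \<open>clip\<close> below provides
  this.\<close>

definition bounded_meas :: "(complex ^ 'n \<Rightarrow> complex) \<Rightarrow> bool" where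
  "bounded_meas h \<longleftrightarrow> h \<in> borel_measurable borel \<and> (\<exists>B. \<forall>x. cmod (h x) \<le> B)"

definition bounded_meas2 :: "(complex ^ 'n \<Rightarrow> complex ^ 'n \<Rightarrow> complex) \<Rightarrow> bool" where
  "bounded_meas2 F \<longleftrightarrow> case_prod F \<in> borel_measurable (sphere_measure \<Otimes>\<^sub>M sphere_measure) \<and>
     (\<exists>B. \<forall>x y. cmod (F x y) \<le> B)"

lemma bounded_measI: "h \<in> borel_measurable borel \<Longrightarrow> (\<And>x. cmod (h x) \<le> B) \<Longrightarrow> bounded_meas h"
  by (auto simp: bounded_meas_def)

lemma bounded_meas_const: "bounded_meas (\<lambda>_. c)"
  by (auto simp: bounded_meas_def)

lemma bounded_meas_cnj: "bounded_meas h \<Longrightarrow> bounded_meas (\<lambda>x. cnj (h x))"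
  by (auto simp: bounded_meas_def)

lemma bounded_meas_mult:
  assumes "bounded_meas f" "bounded_meas g" shows "bounded_meas (\<lambda>x. f x * g x)"
proof -
  obtain A B where "\<And>x. cmod (f x) \<le> A" "\<And>x. cmod (g x) \<le> B"
    using assms by (auto simp: bounded_meas_def)
  hence "cmod (f x * g x) \<le> A * B" for x
    by (auto simp: norm_mult intro!: mult_mono order_trans[OF norm_ge_zero])
  thus ?thesis using assms by (auto simp: bounded_meas_def)
qed

lemma bounded_meas_power: "bounded_meas f \<Longrightarrow> bounded_meas (\<lambda>x. f x ^ k)"
  by (induction k) (auto intro: bounded_meas_const bounded_meas_mult)

lemma bounded_meas_integrable: "bounded_meas h \<Longrightarrow> integrable sphere_measure h"
  unfolding bounded_meas_def by (auto intro: integrable_sphere_bounded)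

lemma bounded_meas2_mult:
  assumes "bounded_meas2 F" "bounded_meas2 G" shows "bounded_meas2 (\<lambda>x y. F x y * G x y)"
proof -
  obtain A B where "\<And>x y. cmod (F x y) \<le> A" "\<And>x y. cmod (G x y) \<le> B"
    using assms by (auto simp: bounded_meas2_def)
  hence "cmod (F x y * G x y) \<le> A * B" for x y
    by (auto simp: norm_mult intro!: mult_mono order_trans[OF norm_ge_zero])
  moreover have "case_prod (\<lambda>x y. F x y * G x y) = (\<lambda>p. case_prod F p * case_prod G p)"
    by auto
  ultimately show ?thesis using assms by (auto simp: bounded_meas2_def)
qed

lemma bounded_meas2_add:
  assumes "bounded_meas2 F" "bounded_meas2 G" shows "bounded_meas2 (\<lambda>x y. F x y + G x y)"
proof -
  obtain A B where "\<And>x y. cmod (F x y) \<le> A" "\<And>x y. cmod (G x y) \<le> B"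
    using assms by (auto simp: bounded_meas2_def)
  hence "cmod (F x y + G x y) \<le> A + B" for x y
    by (meson add_mono norm_triangle_le)
  moreover have "case_prod (\<lambda>x y. F x y + G x y) = (\<lambda>p. case_prod F p + case_prod G p)"
    by auto
  ultimately show ?thesis using assms by (auto simp: bounded_meas2_def)
qed

lemma bounded_meas2_const: "bounded_meas2 (\<lambda>_ _. c)"
  by (auto simp: bounded_meas2_def)

lemma bounded_meas2_diff:
  assumes "bounded_meas2 F" "bounded_meas2 G" shows "bounded_meas2 (\<lambda>x y. F x y - G x y)"
  using bounded_meas2_add[OF assms(1) bounded_meas2_mult[OF bounded_meas2_const[of "-1"] assms(2)]]
  by simp

lemma bounded_meas2_sum:
  "(\<And>i. i \<in> I \<Longrightarrow> bounded_meas2 (F i)) \<Longrightarrow> bounded_meas2 (\<lambda>x y. \<Sum>i\<in>I. F i x y)"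
  by (induction I rule: infinite_finite_induct) (auto intro: bounded_meas2_const bounded_meas2_add)

lemma bounded_meas2_power: "bounded_meas2 F \<Longrightarrow> bounded_meas2 (\<lambda>x y. F x y ^ k)"
  by (induction k) (auto intro: bounded_meas2_const bounded_meas2_mult)

lemma bounded_meas2_fst: "bounded_meas h \<Longrightarrow> bounded_meas2 (\<lambda>x y. h x)"
  unfolding bounded_meas_def bounded_meas2_def by (auto simp: case_prod_beta')

lemma bounded_meas2_snd: "bounded_meas h \<Longrightarrow> bounded_meas2 (\<lambda>x y. h y)"
  unfolding bounded_meas_def bounded_meas2_def by (auto simp: case_prod_beta')

lemma bounded_meas2_cauchy:
  fixes Z W :: "complex ^ 'n \<Rightarrow> complex ^ 'n"
  assumes [measurable]: "Z \<in> borel_measurable borel" "W \<in> borel_measurable borel"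
    and le: "\<And>x y. norm (Z x) * norm (W y) \<le> \<rho>" and \<rho>: "\<rho> < 1"
  shows "bounded_meas2 (\<lambda>x y. inverse (1 - cinner (Z x) (W y)))"
proof -
  have "cmod (inverse (1 - cinner (Z x) (W y))) \<le> 1 / (1 - \<rho>)" for x y
  proof -
    have "1 - \<rho> \<le> cmod (1 - cinner (Z x) (W y))"
      using norm_triangle_ineq2[of 1 "cinner (Z x) (W y)"] cmod_cinner_le[of "Z x" "W y"] le[of x y] by simp
    thus ?thesis using \<rho> by (simp add: norm_divide inverse_eq_divide frac_le)
  qed
  moreover have "(\<lambda>p. inverse (1 - cinner (Z (fst p)) (W (snd p)))) \<in> borel_measurable (sphere_measure \<Otimes>\<^sub>M sphere_measure)"
    by measurable
  ultimately show ?thesis by (auto simp: bounded_meas2_def case_prod_beta')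
qed

lemma bounded_meas2_integrable:
  assumes "bounded_meas2 F"
  shows "integrable (sphere_measure \<Otimes>\<^sub>M sphere_measure) (case_prod F)"
proof -
  obtain B where B: "\<And>x y. cmod (F x y) \<le> B" using assms by (auto simp: bounded_meas2_def)
  show ?thesis
    using assms by (intro sphere2.P.integrable_const_bound[of _ B]) (auto simp: bounded_meas2_def B)
qed

lemma bounded_meas2_Fubini:
  assumes "bounded_meas2 F"
  shows "(\<integral>x. (\<integral>y. F x y \<partial>sphere_measure) \<partial>sphere_measure) = (\<integral>p. case_prod F p \<partial>(sphere_measure \<Otimes>\<^sub>M sphere_measure))"
    and "(\<integral>y. (\<integral>x. F x y \<partial>sphere_measure) \<partial>sphere_measure) = (\<integral>p. case_prod F p \<partial>(sphere_measure \<Otimes>\<^sub>M sphere_measure))"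
  using sphere2.integral_fst[OF bounded_meas2_integrable[OF assms]]
    sphere2.integral_snd[OF bounded_meas2_integrable[OF assms]] by simp_all

lemma bounded_meas_integral:
  fixes F :: "complex ^ 'n \<Rightarrow> complex ^ 'n \<Rightarrow> complex"
  assumes F: "bounded_meas2 F"
  shows "bounded_meas (\<lambda>x. \<integral>y. F x y \<partial>sphere_measure)"
proof -
  obtain B where B: "\<And>x y. cmod (F x y) \<le> B" using F by (auto simp: bounded_meas2_def)
  have mF: "case_prod F \<in> borel_measurable (sphere_measure \<Otimes>\<^sub>M sphere_measure)"
    using F by (simp add: bounded_meas2_def)
  have "(\<lambda>x. \<integral>y. F x y \<partial>sphere_measure) \<in> borel_measurable (sphere_measure :: (complex ^ 'n) measure)"
    by (rule sphere.borel_measurable_lebesgue_integral[OF mF])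
  hence m: "(\<lambda>x. \<integral>y. F x y \<partial>sphere_measure) \<in> borel_measurable borel"
    by measurable
  have B0: "0 \<le> B" using B[of undefined undefined] norm_ge_zero order_trans by blast
  show ?thesis
  proof (rule bounded_measI[OF m])
    fix x
    have "cmod (\<integral>y. F x y \<partial>sphere_measure) \<le> (\<integral>y. cmod (F x y) \<partial>sphere_measure)"
      by (rule integral_norm_bound)
    also have "\<dots> \<le> (\<integral>y. B \<partial>(sphere_measure :: (complex ^ 'n) measure))"
      by (rule integral_mono') (use B B0 in auto)
    finally show "cmod (\<integral>y. F x y \<partial>sphere_measure) \<le> B" by simp
  qed
qed

definition kernel_form :: "(complex ^ 'n \<Rightarrow> complex) \<Rightarrow> (complex ^ 'n \<Rightarrow> complex ^ 'n \<Rightarrow> complex) \<Rightarrow> complex" where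
  "kernel_form h P = (\<integral>p. case_prod (\<lambda>x y. h x * cnj (h y) * P x y) p \<partial>(sphere_measure \<Otimes>\<^sub>M sphere_measure))"

text \<open>Positive semidefiniteness tested with bounded functions under the integral instead of on
  finitely many points. Comparing norms involves the real part alone.\<close>

definition positive_kernel :: "(complex ^ 'n \<Rightarrow> complex ^ 'n \<Rightarrow> complex) \<Rightarrow> bool" where
  "positive_kernel P \<longleftrightarrow> bounded_meas2 P \<and> (\<forall>h. bounded_meas h \<longrightarrow> 0 \<le> Re (kernel_form h P))"

lemma bounded_meas2_form:
  "bounded_meas h \<Longrightarrow> bounded_meas2 P \<Longrightarrow> bounded_meas2 (\<lambda>x y. h x * cnj (h y) * P x y)"
  by (intro bounded_meas2_mult bounded_meas2_fst bounded_meas2_snd bounded_meas_cnj)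

lemma kernel_form_add:
  assumes "bounded_meas h" "bounded_meas2 P" "bounded_meas2 Q"
  shows "kernel_form h (\<lambda>x y. P x y + Q x y) = kernel_form h P + kernel_form h Q"
proof -
  have "kernel_form h (\<lambda>x y. P x y + Q x y) =
    (\<integral>p. case_prod (\<lambda>x y. h x * cnj (h y) * P x y) p + case_prod (\<lambda>x y. h x * cnj (h y) * Q x y) p \<partial>(sphere_measure \<Otimes>\<^sub>M sphere_measure))"
    unfolding kernel_form_def by (intro Bochner_Integration.integral_cong) (auto simp: algebra_simps)
  also have "\<dots> = kernel_form h P + kernel_form h Q"
    unfolding kernel_form_def
    by (intro Bochner_Integration.integral_add bounded_meas2_integrable bounded_meas2_form assms)
  finally show ?thesis .
qed

lemma positive_kernel_add:
  "positive_kernel P \<Longrightarrow> positive_kernel Q \<Longrightarrow> positive_kernel (\<lambda>x y. P x y + Q x y)"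
  by (auto simp: positive_kernel_def kernel_form_add intro: bounded_meas2_add)

lemma positive_kernel_zero: "positive_kernel (\<lambda>_ _. 0)"
  by (auto simp: positive_kernel_def kernel_form_def intro: bounded_meas2_const)

lemma positive_kernel_sum:
  "(\<And>i. i \<in> I \<Longrightarrow> positive_kernel (P i)) \<Longrightarrow> positive_kernel (\<lambda>x y. \<Sum>i\<in>I. P i x y)"
  by (induction I rule: infinite_finite_induct) (auto intro: positive_kernel_zero positive_kernel_add)

lemma positive_kernel_weight:
  assumes P: "positive_kernel P" and u: "bounded_meas u"
  shows "positive_kernel (\<lambda>x y. u x * cnj (u y) * P x y)"
  unfolding positive_kernel_def
proof (intro conjI allI impI)
  show "bounded_meas2 (\<lambda>x y. u x * cnj (u y) * P x y)"
    using P u by (intro bounded_meas2_form) (auto simp: positive_kernel_def)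
  fix h :: "complex ^ 'a \<Rightarrow> complex" assume h: "bounded_meas h"
  have "kernel_form h (\<lambda>x y. u x * cnj (u y) * P x y) = kernel_form (\<lambda>x. h x * u x) P"
    unfolding kernel_form_def by (simp add: mult_ac)
  thus "0 \<le> Re (kernel_form h (\<lambda>x y. u x * cnj (u y) * P x y))"
    using P bounded_meas_mult[OF h u] by (auto simp: positive_kernel_def)
qed

lemma positive_kernel_limit:
  assumes P: "\<And>n. positive_kernel (P n)" and lim: "\<And>x y. (\<lambda>n. P n x y) \<longlonglongrightarrow> Q x y"
    and B: "\<And>n x y. cmod (P n x y) \<le> B"
  shows "positive_kernel Q"
  unfolding positive_kernel_def
proof (intro conjI allI impI)
  let ?M = "sphere_measure \<Otimes>\<^sub>M (sphere_measure :: (complex ^ 'a) measure)"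
  have mP: "case_prod (P n) \<in> borel_measurable ?M" for n
    using P by (auto simp: positive_kernel_def bounded_meas2_def)
  have mQ: "case_prod Q \<in> borel_measurable ?M"
    by (rule borel_measurable_LIMSEQ_metric[OF mP]) (auto intro: lim)
  have "cmod (Q x y) \<le> B" for x y
    by (rule tendsto_upperbound[OF tendsto_norm[OF lim]]) (auto intro!: always_eventually B)
  thus bQ: "bounded_meas2 Q" using mQ by (auto simp: bounded_meas2_def)
  fix h :: "complex ^ 'a \<Rightarrow> complex" assume h: "bounded_meas h"
  then obtain C where C: "\<And>x. cmod (h x) \<le> C" by (auto simp: bounded_meas_def)
  have C0: "0 \<le> C" using C norm_ge_zero order_trans by blast
  have "(\<lambda>n. kernel_form h (P n)) \<longlonglongrightarrow> kernel_form h Q"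
    unfolding kernel_form_def
  proof (rule integral_dominated_convergence[where w = "\<lambda>_. C * C * B"])
    show "case_prod (\<lambda>x y. h x * cnj (h y) * Q x y) \<in> borel_measurable ?M"
      using bounded_meas2_form[OF h bQ] by (simp add: bounded_meas2_def)
    show "case_prod (\<lambda>x y. h x * cnj (h y) * P n x y) \<in> borel_measurable ?M" for n
      using bounded_meas2_form[OF h, of "P n"] P by (simp add: bounded_meas2_def positive_kernel_def)
    show "AE p in ?M. (\<lambda>n. case_prod (\<lambda>x y. h x * cnj (h y) * P n x y) p) \<longlonglongrightarrow> case_prod (\<lambda>x y. h x * cnj (h y) * Q x y) p"
      by (intro AE_I2) (auto intro!: tendsto_intros lim)
    show "AE p in ?M. norm (case_prod (\<lambda>x y. h x * cnj (h y) * P n x y) p) \<le> C * C * B" for n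
      using C0 by (intro AE_I2) (auto simp: norm_mult intro!: mult_mono C B)
  qed simp
  hence "(\<lambda>n. Re (kernel_form h (P n))) \<longlonglongrightarrow> Re (kernel_form h Q)" by (intro tendsto_intros)
  thus "0 \<le> Re (kernel_form h Q)"
    using P h by (intro tendsto_lowerbound[of _ _ sequentially]) (auto simp: positive_kernel_def)
qed

text \<open>Schur's product theorem for the Cauchy kernel, by expanding it into the geometric series.\<close>

lemma positive_kernel_cauchy:
  fixes Z :: "complex ^ 'n \<Rightarrow> complex ^ 'n"
  assumes P: "positive_kernel P" and [measurable]: "Z \<in> borel_measurable borel"
    and Z: "\<And>x. norm (Z x) \<le> \<rho>" and \<rho>: "\<rho> < 1"
  shows "positive_kernel (\<lambda>x y. inverse (1 - cinner (Z x) (Z y)) * P x y)"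
proof -
  have \<rho>0: "0 \<le> \<rho>" using Z norm_ge_zero order_trans by blast
  \<comment> \<open>\<open>cinner\<close> is a sum over the coordinates of kernels of rank one, and
    each of these is absorbed into the test function as a weight.\<close>
  have step: "positive_kernel (\<lambda>x y. cinner (Z x) (Z y) * Q x y)" if "positive_kernel Q" for Q
  proof -
    have "positive_kernel (\<lambda>x y. \<Sum>i\<in>UNIV. (Z x $ i) * cnj (Z y $ i) * Q x y)"
    proof (intro positive_kernel_sum positive_kernel_weight that bounded_measI)
      show "(\<lambda>x. Z x $ i) \<in> borel_measurable borel" for i by measurable
      show "cmod (Z x $ i) \<le> \<rho>" for x i
        using Finite_Cartesian_Product.norm_nth_le[of "Z x" i] Z[of x] by linarith
    qed
    thus ?thesis by (simp add: cinner_def sum_distrib_right)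
  qed
  have pow: "positive_kernel (\<lambda>x y. cinner (Z x) (Z y) ^ k * P x y)" for k
  proof (induction k)
    case (Suc k)
    from step[OF this] show ?case by (simp add: mult.assoc)
  qed (use P in simp)
  have c\<rho>: "cmod (cinner (Z x) (Z y)) \<le> \<rho>" for x y
  proof -
    have "norm (Z y) \<le> 1" using Z[of y] \<rho> by linarith
    hence "norm (Z x) * norm (Z y) \<le> \<rho> * 1" using Z \<rho>0 by (intro mult_mono) auto
    thus ?thesis using cmod_cinner_le[of "Z x" "Z y"] by simp
  qed
  obtain B where B: "\<And>x y. cmod (P x y) \<le> B"
    using P by (auto simp: positive_kernel_def bounded_meas2_def)
  have B0: "0 \<le> B" using B norm_ge_zero order_trans by blast
  show ?thesis
  proof (rule positive_kernel_limit)
    show "positive_kernel (\<lambda>x y. \<Sum>k<n. cinner (Z x) (Z y) ^ k * P x y)" for n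
      by (intro positive_kernel_sum pow)
    fix x y
    have "(\<lambda>k. cinner (Z x) (Z y) ^ k) sums (1 / (1 - cinner (Z x) (Z y)))"
      using c\<rho>[of x y] \<rho> by (intro geometric_sums) simp
    from sums_mult2[OF this, of "P x y"]
    show "(\<lambda>n. \<Sum>k<n. cinner (Z x) (Z y) ^ k * P x y) \<longlonglongrightarrow> inverse (1 - cinner (Z x) (Z y)) * P x y"
      by (simp add: sums_def inverse_eq_divide)
    fix n
    have "cmod (\<Sum>k<n. cinner (Z x) (Z y) ^ k * P x y) \<le> (\<Sum>k<n. \<rho> ^ k * B)"
      using c\<rho> \<rho>0 by (intro sum_norm_le) (auto simp: norm_mult norm_power intro!: mult_mono power_mono B)
    also have "\<dots> = (\<Sum>k<n. \<rho> ^ k) * B" by (simp add: sum_distrib_right)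
    also have "\<dots> \<le> (\<Sum>k. \<rho> ^ k) * B"
      using \<rho>0 \<rho> B0 by (intro mult_right_mono sum_le_suminf) auto
    finally show "cmod (\<Sum>k<n. cinner (Z x) (Z y) ^ k * P x y) \<le> (\<Sum>k. \<rho> ^ k) * B" .
  qed
qed

lemma kernel_form_split:
  fixes u v :: "complex ^ 'n \<Rightarrow> complex"
  assumes "bounded_meas u" "bounded_meas v"
  shows "(\<integral>p. case_prod (\<lambda>x y. u x * cnj (v y)) p \<partial>(sphere_measure \<Otimes>\<^sub>M sphere_measure))
    = (\<integral>x. u x \<partial>sphere_measure) * cnj (\<integral>x. v x \<partial>sphere_measure)"
proof -
  have "bounded_meas2 (\<lambda>x y. u x * cnj (v y))"
    by (intro bounded_meas2_mult bounded_meas2_fst bounded_meas2_snd bounded_meas_cnj assms)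
  from bounded_meas2_Fubini(1)[OF this] show ?thesis by simp
qed

lemma norm_vec_square: "complex_of_real ((norm (v :: complex ^ 'n))\<^sup>2) = (\<Sum>i\<in>UNIV. v $ i * cnj (v $ i))"
  unfolding cinner_self[symmetric] by (simp add: cinner_def)

text \<open>Integrating the test function against \<open>X\<close> and against 1 gives one vector
  and one scalar; the kernel form is the Hermitian form of \<open>psd\<close> at this single
  pair.\<close>

lemma positive_kernel_affine_form:
  fixes A :: "complex ^ 'n ^ 'n" and X :: "complex ^ 'n \<Rightarrow> complex ^ 'n"
  assumes psd: "\<And>x t. 0 \<le> (cmod (cinner x C + t * d))\<^sup>2 - (norm (A *v x + t *s B))\<^sup>2 - (cmod t)\<^sup>2 + (norm x)\<^sup>2"
    and X [measurable]: "X \<in> borel_measurable borel" and X1: "\<And>x. norm (X x) \<le> 1"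
  shows "positive_kernel (\<lambda>x y. (cinner (X x) C + d) * cnj (cinner (X y) C + d)
     - cinner (A *v X x + B) (A *v X y + B) - 1 + cinner (X x) (X y))"
proof -
  let ?M = "sphere_measure :: (complex ^ 'n) measure"
  define q where "q x = cinner (X x) C + d" for x
  define a where "a x = A *v X x + B" for x
  have Xi: "bounded_meas (\<lambda>x. X x $ i)" for i
  proof (rule bounded_measI)
    show "cmod (X x $ i) \<le> 1" for x
      using Finite_Cartesian_Product.norm_nth_le[of "X x" i] X1[of x] by linarith
  qed measurable
  have ai_eq: "a x $ i = (\<Sum>j\<in>UNIV. A $ i $ j * X x $ j) + B $ i" for x i
    by (simp add: a_def matrix_vector_mult_def)
  have bm_add: "bounded_meas (\<lambda>x. f x + g x)" if fg: "bounded_meas f" "bounded_meas g" for f g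
  proof -
    obtain F G where "\<And>x. cmod (f x) \<le> F" "\<And>x. cmod (g x) \<le> G"
      using fg by (auto simp: bounded_meas_def)
    hence "cmod (f x + g x) \<le> F + G" for x by (meson add_mono norm_triangle_le)
    thus ?thesis using fg by (auto simp: bounded_meas_def)
  qed
  have bm_sum: "bounded_meas (\<lambda>x. \<Sum>i\<in>I. f i x)" if "finite I" "\<And>i. bounded_meas (f i)" for I :: "'n set" and f
    using that by (induction rule: finite_induct) (auto intro: bounded_meas_const bm_add)
  have q: "bounded_meas q" unfolding q_def cinner_def
    by (intro bm_add bm_sum bounded_meas_mult Xi bounded_meas_const) auto
  have a: "bounded_meas (\<lambda>x. a x $ i)" for i unfolding ai_eq
    by (intro bm_add bm_sum bounded_meas_mult Xi bounded_meas_const) auto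
  define P where "P x y = q x * cnj (q y) - (\<Sum>i\<in>UNIV. a x $ i * cnj (a y $ i)) - 1 * cnj 1 + (\<Sum>i\<in>UNIV. X x $ i * cnj (X y $ i))" for x y
  have bP: "bounded_meas2 P" unfolding P_def
    by (intro bounded_meas2_add bounded_meas2_diff bounded_meas2_sum bounded_meas2_mult
        bounded_meas2_fst bounded_meas2_snd bounded_meas_cnj q a Xi bounded_meas_const)
  have "0 \<le> Re (kernel_form h P)" if h: "bounded_meas h" for h
  proof -
    define V where "V = (\<chi> i. \<integral>x. h x * X x $ i \<partial>?M)"
    define t where "t = (\<integral>x. h x \<partial>?M)"
    define S where "S u = (\<integral>p. case_prod (\<lambda>x y. (h x * u x) * cnj (h y * u y)) p \<partial>(?M \<Otimes>\<^sub>M ?M))" for u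
    have S: "S u = (\<integral>x. h x * u x \<partial>?M) * cnj (\<integral>x. h x * u x \<partial>?M)" if "bounded_meas u" for u
      unfolding S_def by (intro kernel_form_split bounded_meas_mult h that)
    have iS: "integrable (?M \<Otimes>\<^sub>M ?M) (case_prod (\<lambda>x y. (h x * u x) * cnj (h y * u y)))" if "bounded_meas u" for u
      by (intro bounded_meas2_integrable bounded_meas2_mult bounded_meas2_fst bounded_meas2_snd
          bounded_meas_cnj bounded_meas_mult h that)
    have "kernel_form h P = (\<integral>p. case_prod (\<lambda>x y. (h x * q x) * cnj (h y * q y)) p
        - (\<Sum>i\<in>UNIV. case_prod (\<lambda>x y. (h x * a x $ i) * cnj (h y * a y $ i)) p)
        - case_prod (\<lambda>x y. (h x * 1) * cnj (h y * 1)) p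
        + (\<Sum>i\<in>UNIV. case_prod (\<lambda>x y. (h x * X x $ i) * cnj (h y * X y $ i)) p) \<partial>(?M \<Otimes>\<^sub>M ?M))"
      unfolding kernel_form_def P_def
      by (intro Bochner_Integration.integral_cong refl)
         (auto simp: case_prod_beta' algebra_simps sum_distrib_left)
    also have "\<dots> = S q - (\<Sum>i\<in>UNIV. S (\<lambda>x. a x $ i)) - S (\<lambda>_. 1) + (\<Sum>i\<in>UNIV. S (\<lambda>x. X x $ i))"
      unfolding S_def
      by (simp only: Bochner_Integration.integral_add Bochner_Integration.integral_diff Bochner_Integration.integral_sum
          Bochner_Integration.integrable_add Bochner_Integration.integrable_diff Bochner_Integration.integrable_sum iS q a Xi bounded_meas_const)
    also have "(\<Sum>i\<in>UNIV. S (\<lambda>x. X x $ i)) = of_real ((norm V)\<^sup>2)"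
      unfolding norm_vec_square by (simp add: S Xi V_def)
    also have "S (\<lambda>_. 1) = of_real ((cmod t)\<^sup>2)"
      unfolding complex_norm_square by (simp add: S bounded_meas_const t_def)
    also have "(\<Sum>i\<in>UNIV. S (\<lambda>x. a x $ i)) = of_real ((norm (A *v V + t *s B))\<^sup>2)"
    proof -
      have "(\<integral>x. h x * a x $ i \<partial>?M) = (A *v V + t *s B) $ i" for i
      proof -
        have "(\<integral>x. h x * a x $ i \<partial>?M) = (\<integral>x. (\<Sum>j\<in>UNIV. A $ i $ j * (h x * X x $ j)) + h x * B $ i \<partial>?M)"
          unfolding ai_eq by (intro Bochner_Integration.integral_cong) (auto simp: algebra_simps sum_distrib_left)
        also have "\<dots> = (\<Sum>j\<in>UNIV. A $ i $ j * (\<integral>x. h x * X x $ j \<partial>?M)) + t * B $ i"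
          unfolding t_def
          by (subst Bochner_Integration.integral_add Bochner_Integration.integral_sum;
              (intro Bochner_Integration.integrable_sum integrable_mult_right integrable_mult_left
                bounded_meas_integrable bounded_meas_mult h Xi)?)+ simp
        finally show ?thesis by (simp add: V_def matrix_vector_mult_def)
      qed
      thus ?thesis unfolding norm_vec_square by (simp add: S a)
    qed
    also have "S q = of_real ((cmod (cinner V C + t * d))\<^sup>2)"
    proof -
      have "(\<integral>x. h x * q x \<partial>?M) = (\<integral>x. (\<Sum>j\<in>UNIV. (h x * X x $ j) * cnj (C $ j)) + h x * d \<partial>?M)"
        unfolding q_def cinner_def by (intro Bochner_Integration.integral_cong) (auto simp: algebra_simps sum_distrib_left)
      also have "\<dots> = (\<Sum>j\<in>UNIV. (\<integral>x. h x * X x $ j \<partial>?M) * cnj (C $ j)) + t * d"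
        unfolding t_def
        by (subst Bochner_Integration.integral_add Bochner_Integration.integral_sum;
            (intro Bochner_Integration.integrable_sum integrable_mult_right integrable_mult_left
              bounded_meas_integrable bounded_meas_mult h Xi)?)+ simp
      finally have "(\<integral>x. h x * q x \<partial>?M) = cinner V C + t * d" by (simp add: V_def cinner_def)
      thus ?thesis unfolding complex_norm_square by (simp add: S q)
    qed
    finally show ?thesis using psd[of V t] by simp
  qed
  hence "positive_kernel P" using bP by (simp add: positive_kernel_def)
  thus ?thesis unfolding P_def q_def a_def cinner_def[of "A *v X _ + B"] cinner_def[of "X _" "X _"] by simp
qed


section \<open>A contraction estimate for weighted composition\<close>

lemma holomorphic_lin_frac:
  assumes "\<And>z. z \<in> S \<Longrightarrow> cinner z C + d \<noteq> 0"
  shows "holomorphic_map_on (lin_frac A B C d) S"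
  unfolding holomorphic_map_on_def lin_frac_def
  by (auto simp: matrix_vector_mult_def intro!: holomorphic_fun_intros assms)

lemma bounded_meas2_cnj: "bounded_meas2 F \<Longrightarrow> bounded_meas2 (\<lambda>x y. cnj (F x y))"
proof -
  assume F: "bounded_meas2 F"
  have "case_prod (\<lambda>x y. cnj (F x y)) = (\<lambda>p. cnj (case_prod F p))" by auto
  thus ?thesis using F by (auto simp: bounded_meas2_def)
qed

text \<open>Points off the unit sphere form a null set; moving them to 0 makes all kernels
  bounded everywhere.\<close>

definition clip :: "complex ^ 'n \<Rightarrow> complex ^ 'n" where
  "clip \<zeta> = (if norm \<zeta> = 1 then \<zeta> else 0)"

lemma clip_measurable [measurable]: "clip \<in> borel_measurable borel"
  unfolding clip_def[abs_def] by measurable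

lemma norm_clip: "norm (clip \<zeta>) \<le> 1"
  by (simp add: clip_def)

lemma integral_clip:
  fixes F :: "complex ^ 'n \<Rightarrow> 'b::{banach,second_countable_topology}"
  assumes "F \<in> borel_measurable borel"
  shows "(\<integral>\<zeta>. F (clip \<zeta>) \<partial>sphere_measure) = (\<integral>\<zeta>. F \<zeta> \<partial>sphere_measure)"
proof (rule integral_cong_AE)
  show "AE \<zeta> in sphere_measure. F (clip \<zeta>) = F \<zeta>"
    using AE_sphere_norm by eventually_elim (simp add: clip_def)
qed (use assms in measurable)

lemma reproducing_clip:
  assumes f: "ball_hol f" and r: "0 \<le> r" "r < 1" and z: "norm z < 1"
  shows "(\<integral>\<zeta>. f (r *\<^sub>R clip \<zeta>) * hardy_kernel z (clip \<zeta>) \<partial>sphere_measure) = f (r *\<^sub>R z)"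
proof -
  note [measurable] = ball_hol_measurable[OF f]
  show ?thesis
    using integral_clip[of "\<lambda>\<zeta>. f (r *\<^sub>R \<zeta>) * hardy_kernel z \<zeta>"] reproducing_formula[OF assms]
    by simp
qed

lemma hardy_kernel_cnj: "cnj (hardy_kernel z w) = hardy_kernel w z"
  by (simp add: hardy_kernel_def cinner_commute[of z w])

text \<open>The kernel function of \<open>w\<close> is the dilate by \<open>s\<close> of the kernel
  function of \<open>w / s\<close>, with \<open>s\<close> between \<open>norm w\<close> and 1, so
  the reproducing formula applies to it.\<close>

lemma hardy_kernel_reproducing:
  fixes z w :: "complex ^ 'n"
  assumes z: "norm z < 1" and w: "norm w < 1"
  shows "(\<integral>\<xi>. hardy_kernel (clip \<xi>) w * hardy_kernel z (clip \<xi>) \<partial>sphere_measure) = hardy_kernel z w"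
proof -
  define s where "s = (1 + norm w) / 2"
  have s: "0 < s" "s < 1" "norm w < s" using w norm_ge_zero[of w] by (auto simp: s_def add_pos_nonneg)
  define v where "v = (1 / s) *\<^sub>R w"
  have v: "norm v < 1" using s by (simp add: v_def)
  define F where "F z = (if z \<in> ball 0 1 then hardy_kernel z v else 0)" for z
  have "1 - cinner z v \<noteq> 0" if "z \<in> ball 0 1" for z
  proof
    assume "1 - cinner z v = 0"
    hence "1 \<le> norm z * norm v" using cmod_cinner_le[of z v] by simp
    moreover have "norm z * norm v \<le> 1 * norm v" using that by (intro mult_right_mono) auto
    ultimately show False using v by simp
  qed
  hence F: "ball_hol F" unfolding F_def hardy_kernel_def
    by (intro ball_hol_cut holomorphic_fun_intros) auto
  have eq: "F (s *\<^sub>R x) = hardy_kernel x w" if "norm x \<le> 1" for x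
  proof -
    have "s * norm x \<le> s * 1" using s that by (intro mult_left_mono) auto
    hence "s * norm x < 1" using s by linarith
    thus ?thesis using s by (simp add: F_def hardy_kernel_def v_def cinner_simps)
  qed
  show ?thesis
    using reproducing_clip[OF F _ s(2) z] s z by (simp add: eq norm_clip)
qed

text \<open>A duality argument without adjoint operators. The mean m of \<open>g\<close> is the
  integral of \<open>a\<close> against \<open>f\<close> at the points \<open>Y\<close>. The
  reproducing formula turns this into a pairing of \<open>f\<close> with \<open>Q\<close>, and the
  squared norm of \<open>Q\<close> is the form of \<open>K2 ^ N\<close>. As
  \<open>K1 ^ N - K2 ^ N\<close> is positive, this is at most the form of \<open>K1 ^ N\<close>,
  which is at most m. Hence m is at most \<open>hardy2_norm f\<close> times the square root of
  m.\<close>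

lemma weighted_composition_square_mean_le:
  fixes A :: "complex ^ 'n ^ 'n" and B C :: "complex ^ 'n" and d :: complex
  defines "\<phi> \<equiv> lin_frac A B C d"
  assumes den: "\<And>z. z \<in> ball 0 1 \<Longrightarrow> cinner z C + d \<noteq> 0"
    and maps: "\<phi> ` ball 0 1 \<subseteq> ball 0 1"
    and psd: "\<And>x t. 0 \<le> (cmod (cinner x C + t * d))\<^sup>2 - (norm (A *v x + t *s B))\<^sup>2 - (cmod t)\<^sup>2 + (norm x)\<^sup>2"
    and f: "f \<in> hardy2"
    and g: "ball_hol g" "\<And>z. z \<in> ball 0 1 \<Longrightarrow> g z = inverse (cinner z C + d) ^ CARD('n) * f (\<phi> z)"
    and r: "0 < r" "r < 1"
  shows "square_mean g r \<le> (hardy2_norm f)\<^sup>2"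
proof -
  let ?N = "CARD('n)"
  let ?M = "sphere_measure :: (complex ^ 'n) measure"
  have N: "?N > 0" by simp
  have bf: "ball_hol f" using f by (rule hardy2_ball_hol)
  note [measurable] = ball_hol_measurable[OF bf] ball_hol_measurable[OF g(1)]
  define q where "q z = cinner z C + d" for z
  define X where "X \<zeta> = r *\<^sub>R clip \<zeta>" for \<zeta> :: "complex ^ 'n"
  have mX [measurable]: "X \<in> borel_measurable borel" unfolding X_def by measurable
  have X: "norm (X \<zeta>) \<le> r" for \<zeta> using norm_clip[of \<zeta>] r by (simp add: X_def mult_left_le)
  have Xb: "X \<zeta> \<in> ball 0 1" for \<zeta> using X[of \<zeta>] r by auto
  have qX: "q (X \<zeta>) \<noteq> 0" for \<zeta> unfolding q_def by (rule den[OF Xb])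
  define Y where "Y \<zeta> = \<phi> (X \<zeta>)" for \<zeta>
  define u where "u \<zeta> = inverse (q (X \<zeta>))" for \<zeta>
  have contphi: "continuous_on (cball 0 r) \<phi>"
    unfolding \<phi>_def lin_frac_def
    using r by (intro continuous_intros matrix_vector_mult_linear_continuous_on linear_continuous_on den)
      (auto simp: den linear_linear)
  \<comment> \<open>By compactness the image of the smaller ball stays away from the sphere, which
    keeps the pulled back kernels bounded.\<close>
  obtain \<rho> where \<rho>: "0 \<le> \<rho>" "\<rho> < 1" "\<And>z. norm z \<le> r \<Longrightarrow> norm (\<phi> z) \<le> \<rho>"
  proof -
    have "\<exists>z\<in>cball 0 r. \<forall>y\<in>cball 0 r. norm (\<phi> y) \<le> norm (\<phi> z)"
      using r by (intro continuous_attains_sup continuous_on_norm contphi) auto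
    then obtain z where z: "z \<in> cball 0 r" "\<And>y. y \<in> cball 0 r \<Longrightarrow> norm (\<phi> y) \<le> norm (\<phi> z)" by blast
    have "z \<in> ball 0 1" using z(1) r by auto
    hence "\<phi> z \<in> ball 0 1" using maps by blast
    thus ?thesis using z(2) by (intro that[of "norm (\<phi> z)"]) auto
  qed
  have Y: "norm (Y \<zeta>) \<le> \<rho>" for \<zeta> unfolding Y_def by (rule \<rho>(3)[OF X])
  have mq: "q \<in> borel_measurable borel" unfolding q_def by measurable
  have mu [measurable]: "u \<in> borel_measurable borel" unfolding u_def using mq by measurable
  have "(\<lambda>z. A *v z) \<in> borel_measurable borel"
    by (intro borel_measurable_continuous_onI continuous_intros matrix_vector_mult_linear_continuous_on)
  hence mY [measurable]: "Y \<in> borel_measurable borel"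
    unfolding Y_def \<phi>_def lin_frac_def by measurable
  have contq: "continuous_on (cball 0 r) (\<lambda>z. inverse (q z))"
    unfolding q_def using r by (intro continuous_intros) (auto simp: den)
  hence "bounded ((\<lambda>z. inverse (q z)) ` cball 0 r)" by (intro compact_imp_bounded compact_continuous_image) auto
  then obtain U where U': "\<forall>x\<in>(\<lambda>z. inverse (q z)) ` cball 0 r. cmod x \<le> U"
    unfolding bounded_iff by blast
  have U: "cmod (inverse (q z)) \<le> U" if "norm z \<le> r" for z
    by (rule bspec[OF U' imageI]) (use that in simp)
  have u: "bounded_meas u" by (rule bounded_measI[OF mu, of U]) (auto simp: u_def intro!: U X)
  obtain Mf where Mf: "0 < Mf" "\<And>z. norm z \<le> \<rho> \<Longrightarrow> cmod (f z) \<le> Mf"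
    using ball_hol_bounded[OF bf \<rho>(2)] by auto
  obtain Mg where Mg: "0 < Mg" "\<And>z. norm z \<le> r \<Longrightarrow> cmod (g z) \<le> Mg"
    using ball_hol_bounded[OF g(1) r(2)] by auto
  define G where "G \<zeta> = g (X \<zeta>)" for \<zeta>
  have mG [measurable]: "G \<in> borel_measurable borel" unfolding G_def by measurable
  have G: "bounded_meas G" by (rule bounded_measI[OF mG, of Mg]) (auto simp: G_def intro!: Mg X)
  have Geq: "G \<zeta> = u \<zeta> ^ ?N * f (Y \<zeta>)" for \<zeta> unfolding G_def g(2)[OF Xb] u_def q_def Y_def ..
  \<comment> \<open>The conjugate, so that the form of \<open>K1 ^ N\<close> pairs \<open>g\<close>
    with itself.\<close>
  define h where "h \<zeta> = cnj (G \<zeta>)" for \<zeta>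
  have h: "bounded_meas h" unfolding h_def by (rule bounded_meas_cnj[OF G])
  define a where "a \<zeta> = h \<zeta> * u \<zeta> ^ ?N" for \<zeta>
  have a: "bounded_meas a" unfolding a_def by (intro bounded_meas_mult h bounded_meas_power u)

  define K1 where "K1 x y = inverse (1 - cinner (X x) (X y))" for x y
  define K2 where "K2 x y = u x * cnj (u y) * inverse (1 - cinner (Y x) (Y y))" for x y
  define H where "H x y = q (X x) * cnj (q (X y)) - cinner (A *v X x + B) (A *v X y + B) - 1 + cinner (X x) (X y)" for x y
  have X1: "norm (X x) \<le> 1" for x using X[of x] r by linarith
  have posH: "positive_kernel H"
    unfolding H_def q_def by (rule positive_kernel_affine_form[OF psd mX X1])
  have op1: "positive_kernel (\<lambda>x y. K1 x y * P x y)" if "positive_kernel P" for P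
    unfolding K1_def by (rule positive_kernel_cauchy[OF that mX X r(2)])
  have op2: "positive_kernel (\<lambda>x y. K2 x y * P x y)" if "positive_kernel P" for P
    unfolding K2_def mult.assoc[of "u _ * cnj (u _)"]
    by (intro positive_kernel_weight u positive_kernel_cauchy[OF that mY Y \<rho>(2)])
  have op1': "positive_kernel (\<lambda>x y. K1 x y ^ k * P x y)" if "positive_kernel P" for P k
  proof (induction k)
    case (Suc k)
    from op1[OF this] show ?case by (simp add: mult.assoc)
  qed (use that in simp)
  have op2': "positive_kernel (\<lambda>x y. K2 x y ^ k * P x y)" if "positive_kernel P" for P k
  proof (induction k)
    case (Suc k)
    from op2[OF this] show ?case by (simp add: mult.assoc)
  qed (use that in simp)
  have nz: "1 - cinner x y \<noteq> 0" if "norm x \<le> \<sigma>" "norm y \<le> \<sigma>" "\<sigma> < 1" for x y :: "complex ^ 'n" and \<sigma>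
  proof
    assume "1 - cinner x y = 0"
    hence "1 \<le> norm x * norm y" using cmod_cinner_le[of x y] by simp
    also have "\<dots> \<le> \<sigma> * 1"
      using that order_trans[OF norm_ge_zero that(1)] by (intro mult_mono) auto
    finally show False using that by simp
  qed
  \<comment> \<open>The difference of two reciprocals is their product times the difference of the
    denominators, and that difference is \<open>H\<close>.\<close>
  have K12: "K1 x y - K2 x y = K1 x y * (K2 x y * H x y)" for x y
  proof -
    define b where "b = q (X x) * cnj (q (X y)) * (1 - cinner (Y x) (Y y))"
    define c where "c = 1 - cinner (X x) (X y)"
    have "cinner (Y x) (Y y) = u x * cnj (u y) * cinner (A *v X x + B) (A *v X y + B)"
      unfolding Y_def \<phi>_def lin_frac_def u_def q_def cinner_smult_left cinner_smult_right
      by (simp add: mult_ac)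
    hence bH: "b - c = H x y" using qX[of x] qX[of y] by (simp add: b_def c_def H_def u_def field_simps)
    have "b \<noteq> 0" using qX nz[OF Y Y \<rho>(2)] by (simp add: b_def)
    moreover have "c \<noteq> 0" unfolding c_def by (rule nz[OF X X r(2)])
    moreover have "K1 x y = inverse c" by (simp add: K1_def c_def)
    moreover have "K2 x y = inverse b" by (simp add: K2_def b_def u_def)
    ultimately show ?thesis unfolding bH[symmetric] by (simp add: field_simps)
  qed
  \<comment> \<open>The difference of N-th powers is factored; every summand arises from
    \<open>H\<close> by operations that keep a kernel positive.\<close>
  have "positive_kernel (\<lambda>x y. \<Sum>i<?N. K1 x y ^ i * (K2 x y ^ (?N - Suc i) * (K1 x y * (K2 x y * H x y))))"
    by (intro positive_kernel_sum op1' op2' op1 op2 posH)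
  moreover have "(\<Sum>i<?N. K1 x y ^ i * (K2 x y ^ (?N - Suc i) * (K1 x y * (K2 x y * H x y)))) = K1 x y ^ ?N - K2 x y ^ ?N" for x y
    unfolding power_diff_sumr2 K12[symmetric] by (simp add: sum_distrib_left mult_ac)
  ultimately have posd: "positive_kernel (\<lambda>x y. K1 x y ^ ?N - K2 x y ^ ?N)" by simp
  have bK1: "bounded_meas2 K1" unfolding K1_def
  proof (rule bounded_meas2_cauchy[OF mX mX _ r(2)])
    show "norm (X x) * norm (X y) \<le> r" for x y using mult_mono[OF X[of x] X1[of y]] r by simp
  qed
  have bK2: "bounded_meas2 K2" unfolding K2_def
  proof (intro bounded_meas2_mult bounded_meas2_fst bounded_meas2_snd bounded_meas_cnj u bounded_meas2_cauchy[OF mY mY _ \<rho>(2)])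
    show "norm (Y x) * norm (Y y) \<le> \<rho>" for x y
      using mult_mono[OF Y[of x] order_trans[OF Y[of y] less_imp_le[OF \<rho>(2)]]] \<rho> by simp
  qed
  have "kernel_form h (\<lambda>x y. K1 x y ^ ?N) = kernel_form h (\<lambda>x y. K1 x y ^ ?N - K2 x y ^ ?N) + kernel_form h (\<lambda>x y. K2 x y ^ ?N)"
    by (subst kernel_form_add[symmetric]) (auto intro!: h bounded_meas2_diff bounded_meas2_power bK1 bK2)
  hence J21: "Re (kernel_form h (\<lambda>x y. K2 x y ^ ?N)) \<le> Re (kernel_form h (\<lambda>x y. K1 x y ^ ?N))"
    using posd h by (simp add: positive_kernel_def)

  \<comment> \<open>\<open>cinner (X x) (X y)\<close> contains the factor \<open>r\<^sup>2\<close>,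
    so reproducing \<open>g\<close> at radius \<open>r\<close> yields its values at radius
    \<open>r ^ 3\<close>. Monotonicity of the means leads back to \<open>r\<close>.\<close>
  have J1: "Re (kernel_form h (\<lambda>x y. K1 x y ^ ?N)) \<le> square_mean g r"
  proof -
    have "r ^ 3 \<le> r ^ 1" "r\<^sup>2 \<le> r ^ 1" using r by (intro power_decreasing; simp)+
    hence r3: "0 \<le> r ^ 3" "r ^ 3 < 1" "r ^ 3 \<le> r" and r2': "r\<^sup>2 < 1" using r by auto
    have "kernel_form h (\<lambda>x y. K1 x y ^ ?N) = (\<integral>x. \<integral>y. h x * cnj (h y) * K1 x y ^ ?N \<partial>?M \<partial>?M)"
      unfolding kernel_form_def
      by (rule bounded_meas2_Fubini(1)[symmetric]) (intro bounded_meas2_form h bounded_meas2_power bK1)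
    also have "\<dots> = (\<integral>x. h x * g (r ^ 3 *\<^sub>R clip x) \<partial>?M)"
    proof (rule Bochner_Integration.integral_cong[OF refl])
      fix x :: "complex ^ 'n"
      have r2: "norm (r\<^sup>2 *\<^sub>R clip x) < 1"
      proof -
        have "r\<^sup>2 * norm (clip x) \<le> r\<^sup>2 * 1" using norm_clip[of x] by (intro mult_left_mono) auto
        also have "\<dots> < 1" using r2' by simp
        finally show ?thesis by simp
      qed
      have "(\<integral>y. h x * cnj (h y) * K1 x y ^ ?N \<partial>?M) = h x * (\<integral>y. G y * K1 x y ^ ?N \<partial>?M)"
        by (simp add: h_def mult.assoc)
      also have "(\<integral>y. G y * K1 x y ^ ?N \<partial>?M) = (\<integral>y. g (r *\<^sub>R clip y) * hardy_kernel (r\<^sup>2 *\<^sub>R clip x) (clip y) \<partial>?M)"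
        by (simp add: G_def K1_def X_def hardy_kernel_def cinner_simps power2_eq_square mult_ac)
      also have "\<dots> = g (r *\<^sub>R (r\<^sup>2 *\<^sub>R clip x))" using r by (intro reproducing_clip g r2) auto
      also have "r *\<^sub>R (r\<^sup>2 *\<^sub>R clip x) = r ^ 3 *\<^sub>R clip x" by (simp add: power3_eq_cube power2_eq_square mult.assoc)
      finally show "(\<integral>y. h x * cnj (h y) * K1 x y ^ ?N \<partial>?M) = h x * g (r ^ 3 *\<^sub>R clip x)" .
    qed
    also have "\<dots> = (\<integral>x. g (r ^ 3 *\<^sub>R x) * cnj (g (r *\<^sub>R x)) \<partial>?M)"
      using integral_clip[of "\<lambda>x. g (r ^ 3 *\<^sub>R x) * cnj (g (r *\<^sub>R x))"]
      by (simp add: h_def G_def X_def mult.commute)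
    finally have "Re (kernel_form h (\<lambda>x y. K1 x y ^ ?N)) \<le> sqrt (square_mean g (r ^ 3)) * sqrt (square_mean g r)"
      using order_trans[OF complex_Re_le_cmod cmod_mean_prod_le[OF g(1) g(1) r3(1,2)]] r by simp
    also have "\<dots> \<le> sqrt (square_mean g r) * sqrt (square_mean g r)"
      using square_mean_mono[OF g(1) r3(1,3) r(2)] by (intro mult_right_mono) (auto simp: square_mean_nonneg)
    finally show ?thesis by (simp add: square_mean_nonneg)
  qed

  define L where "L \<zeta> \<xi> = hardy_kernel (Y \<zeta>) (clip \<xi>)" for \<zeta> \<xi>
  define L' where "L' \<xi> \<zeta> = hardy_kernel (clip \<xi>) (Y \<zeta>)" for \<zeta> \<xi>
  have LL': "cnj (L \<zeta> \<xi>) = L' \<xi> \<zeta>" for \<zeta> \<xi> by (simp add: L_def L'_def hardy_kernel_cnj)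
  have bL: "bounded_meas2 L" unfolding L_def hardy_kernel_def
  proof (intro bounded_meas2_power bounded_meas2_cauchy[OF mY clip_measurable _ \<rho>(2)])
    show "norm (Y x) * norm (clip y) \<le> \<rho>" for x y using mult_mono[OF Y[of x] norm_clip[of y]] \<rho> by simp
  qed
  have bL': "bounded_meas2 L'" unfolding L'_def hardy_kernel_def
  proof (intro bounded_meas2_power bounded_meas2_cauchy[OF clip_measurable mY _ \<rho>(2)])
    show "norm (clip y) * norm (Y x) \<le> \<rho>" for x y using mult_mono[OF norm_clip[of y] Y[of x]] \<rho> by simp
  qed
  \<comment> \<open>Represents the functional that evaluates at the points \<open>Y\<close> and
    integrates against \<open>a\<close>.\<close>
  define Q where "Q \<xi> = (\<integral>\<zeta>. a \<zeta> * L \<zeta> \<xi> \<partial>?M)" for \<xi>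
  have "bounded_meas2 (\<lambda>\<xi> \<zeta>. a \<zeta> * cnj (L' \<xi> \<zeta>))"
    by (intro bounded_meas2_mult bounded_meas2_snd bounded_meas2_cnj a bL')
  from bounded_meas_integral[OF this] have Q: "bounded_meas Q"
    unfolding Q_def LL'[symmetric] by simp
  have IQ: "complex_of_real (\<integral>\<xi>. (cmod (Q \<xi>))\<^sup>2 \<partial>?M) = kernel_form h (\<lambda>x y. K2 x y ^ ?N)"
  proof -
    have inner: "(\<integral>\<xi>. Q \<xi> * L' \<xi> \<eta> \<partial>?M) = (\<integral>\<zeta>. a \<zeta> * hardy_kernel (Y \<zeta>) (Y \<eta>) \<partial>?M)" for \<eta>
    proof -
      have bm: "bounded_meas (\<lambda>\<xi>. L' \<xi> \<eta>)"
      proof (rule bounded_measI)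
        show "(\<lambda>\<xi>. L' \<xi> \<eta>) \<in> borel_measurable borel" unfolding L'_def by measurable
        show "cmod (L' \<xi> \<eta>) \<le> (1 / (1 - \<rho>)) ^ CARD('n)" for \<xi>
          unfolding L'_def using mult_mono[OF norm_clip[of \<xi>] Y[of \<eta>]] \<rho> by (intro cmod_hardy_kernel_le) auto
      qed
      have b2: "bounded_meas2 (\<lambda>\<zeta> \<xi>. a \<zeta> * L \<zeta> \<xi> * L' \<xi> \<eta>)"
        by (intro bounded_meas2_mult bounded_meas2_fst bounded_meas2_snd a bL bm)
      have "(\<integral>\<xi>. Q \<xi> * L' \<xi> \<eta> \<partial>?M) = (\<integral>\<xi>. \<integral>\<zeta>. a \<zeta> * L \<zeta> \<xi> * L' \<xi> \<eta> \<partial>?M \<partial>?M)"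
        by (simp add: Q_def)
      also have "\<dots> = (\<integral>\<zeta>. \<integral>\<xi>. a \<zeta> * L \<zeta> \<xi> * L' \<xi> \<eta> \<partial>?M \<partial>?M)"
        using bounded_meas2_Fubini[OF b2] by simp
      also have "\<dots> = (\<integral>\<zeta>. a \<zeta> * (\<integral>\<xi>. hardy_kernel (clip \<xi>) (Y \<eta>) * hardy_kernel (Y \<zeta>) (clip \<xi>) \<partial>?M) \<partial>?M)"
        by (simp add: L_def L'_def mult_ac)
      also have "\<dots> = (\<integral>\<zeta>. a \<zeta> * hardy_kernel (Y \<zeta>) (Y \<eta>) \<partial>?M)"
        using le_less_trans[OF Y \<rho>(2)] by (simp add: hardy_kernel_reproducing)
      finally show ?thesis .
    qed
    have b3: "bounded_meas2 (\<lambda>\<xi> \<eta>. Q \<xi> * (cnj (a \<eta>) * L' \<xi> \<eta>))"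
      by (intro bounded_meas2_mult bounded_meas2_fst bounded_meas2_snd bounded_meas_cnj a Q bL')
    have cQ: "cnj (Q \<xi>) = (\<integral>\<eta>. cnj (a \<eta>) * L' \<xi> \<eta> \<partial>?M)" for \<xi>
      unfolding Q_def by (subst Bochner_Integration.integral_cnj[symmetric]) (simp add: LL')
    have "complex_of_real (\<integral>\<xi>. (cmod (Q \<xi>))\<^sup>2 \<partial>?M) = (\<integral>\<xi>. Q \<xi> * cnj (Q \<xi>) \<partial>?M)"
      by (simp only: complex_norm_square[symmetric] integral_complex_of_real)
    also have "\<dots> = (\<integral>\<xi>. \<integral>\<eta>. Q \<xi> * (cnj (a \<eta>) * L' \<xi> \<eta>) \<partial>?M \<partial>?M)"
      unfolding cQ by simp
    also have "\<dots> = (\<integral>\<eta>. \<integral>\<xi>. Q \<xi> * (cnj (a \<eta>) * L' \<xi> \<eta>) \<partial>?M \<partial>?M)"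
      using bounded_meas2_Fubini[OF b3] by simp
    also have "\<dots> = (\<integral>\<eta>. cnj (a \<eta>) * (\<integral>\<xi>. Q \<xi> * L' \<xi> \<eta> \<partial>?M) \<partial>?M)"
      by (simp add: mult_ac flip: Bochner_Integration.integral_mult_right_zero)
    also have "\<dots> = (\<integral>\<eta>. \<integral>\<zeta>. h \<zeta> * cnj (h \<eta>) * K2 \<zeta> \<eta> ^ ?N \<partial>?M \<partial>?M)"
      unfolding inner
      by (simp add: a_def K2_def hardy_kernel_def power_mult_distrib mult_ac flip: Bochner_Integration.integral_mult_right_zero)
    also have "\<dots> = kernel_form h (\<lambda>x y. K2 x y ^ ?N)"
      unfolding kernel_form_def
      by (rule bounded_meas2_Fubini(2)) (intro bounded_meas2_form h bounded_meas2_power bK2)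
    finally show ?thesis .
  qed
  have IQle: "(\<integral>\<xi>. (cmod (Q \<xi>))\<^sup>2 \<partial>?M) \<le> square_mean g r"
    using J21 J1 unfolding IQ[symmetric] by simp

  \<comment> \<open>The reproducing formula covers dilates of \<open>f\<close> only;
    \<open>s\<close> tends to 1 afterwards.\<close>
  have Es: "cmod (\<integral>\<zeta>. a \<zeta> * f (s *\<^sub>R Y \<zeta>) \<partial>?M) \<le> hardy2_norm f * sqrt (square_mean g r)"
    if s: "0 < s" "s < 1" for s
  proof -
    obtain Ms where Ms: "\<And>z. norm z \<le> s \<Longrightarrow> cmod (f z) \<le> Ms"
      using ball_hol_bounded[OF bf s(2)] by auto
    define F where "F \<xi> = f (s *\<^sub>R clip \<xi>)" for \<xi>
    have F: "bounded_meas F"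
    proof (rule bounded_measI)
      show "F \<in> borel_measurable borel" unfolding F_def by measurable
      show "cmod (F \<xi>) \<le> Ms" for \<xi> unfolding F_def using s norm_clip[of \<xi>] by (intro Ms) (simp add: mult_left_le)
    qed
    have b: "bounded_meas2 (\<lambda>\<zeta> \<xi>. a \<zeta> * (F \<xi> * L \<zeta> \<xi>))"
      by (intro bounded_meas2_mult bounded_meas2_fst bounded_meas2_snd a F bL)
    have "(\<integral>\<zeta>. a \<zeta> * f (s *\<^sub>R Y \<zeta>) \<partial>?M) = (\<integral>\<zeta>. a \<zeta> * (\<integral>\<xi>. F \<xi> * L \<zeta> \<xi> \<partial>?M) \<partial>?M)"
      unfolding F_def L_def using s le_less_trans[OF Y \<rho>(2)] by (simp add: reproducing_clip[OF bf])
    also have "\<dots> = (\<integral>\<zeta>. \<integral>\<xi>. a \<zeta> * (F \<xi> * L \<zeta> \<xi>) \<partial>?M \<partial>?M)" by simp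
    also have "\<dots> = (\<integral>\<xi>. \<integral>\<zeta>. a \<zeta> * (F \<xi> * L \<zeta> \<xi>) \<partial>?M \<partial>?M)"
      using bounded_meas2_Fubini[OF b] by simp
    also have "\<dots> = (\<integral>\<xi>. F \<xi> * Q \<xi> \<partial>?M)"
      unfolding Q_def by (simp add: mult_ac flip: Bochner_Integration.integral_mult_right_zero)
    also have "cmod \<dots> \<le> sqrt (\<integral>\<xi>. (cmod (F \<xi>))\<^sup>2 \<partial>?M) * sqrt (\<integral>\<xi>. (cmod (Q \<xi>))\<^sup>2 \<partial>?M)"
    proof -
      obtain BQ BF where "\<And>x. cmod (F x) \<le> BF" "\<And>x. cmod (Q x) \<le> BQ"
        using F Q by (auto simp: bounded_meas_def)
      thus ?thesis using F Q by (intro sphere_Cauchy_Schwarz[of F Q BF BQ]) (auto simp: bounded_meas_def)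
    qed
    also have "(\<integral>\<xi>. (cmod (F \<xi>))\<^sup>2 \<partial>?M) = square_mean f s"
      unfolding square_mean_def F_def using integral_clip[of "\<lambda>\<xi>. (cmod (f (s *\<^sub>R \<xi>)))\<^sup>2"] by simp
    also have "sqrt (square_mean f s) * sqrt (\<integral>\<xi>. (cmod (Q \<xi>))\<^sup>2 \<partial>?M) \<le> hardy2_norm f * sqrt (square_mean g r)"
      using square_mean_le_norm[OF f s] IQle hardy2_norm_nonneg[OF f]
      by (intro mult_mono real_le_lsqrt) (auto simp: square_mean_nonneg)
    finally show ?thesis .
  qed
  \<comment> \<open>The sequence starts at 1/2, so every dilation factor is positive.\<close>
  define s where "s n = 1 - 1 / real (n + 2)" for n
  have s: "0 < s n" "s n < 1" for n by (auto simp: s_def field_simps)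
  have slim: "s \<longlonglongrightarrow> 1"
  proof -
    have "(\<lambda>n. 1 - 1 / real (n + 2)) \<longlonglongrightarrow> 1 - 0"
      by (intro tendsto_diff tendsto_const LIMSEQ_ignore_initial_segment lim_const_over_n)
    thus ?thesis by (simp add: s_def[abs_def])
  qed
  obtain Ma where Ma: "\<And>x. cmod (a x) \<le> Ma" using a by (auto simp: bounded_meas_def)
  have [measurable]: "a \<in> borel_measurable borel" using a by (simp add: bounded_meas_def)
  have "(\<lambda>n. \<integral>\<zeta>. a \<zeta> * f (s n *\<^sub>R Y \<zeta>) \<partial>?M) \<longlonglongrightarrow> (\<integral>\<zeta>. a \<zeta> * f (Y \<zeta>) \<partial>?M)"
  proof (rule integral_dominated_convergence[where w = "\<lambda>_. Ma * Mf"])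
    show "AE \<zeta> in ?M. (\<lambda>n. a \<zeta> * f (s n *\<^sub>R Y \<zeta>)) \<longlonglongrightarrow> a \<zeta> * f (Y \<zeta>)"
    proof (intro AE_I2 tendsto_mult tendsto_const)
      fix \<zeta>
      have "Y \<zeta> \<in> ball 0 1" using Y[of \<zeta>] \<rho> by auto
      hence "isCont f (Y \<zeta>)" using ball_hol_continuous_on[OF bf] by (simp add: continuous_on_eq_continuous_at)
      moreover have "(\<lambda>n. s n *\<^sub>R Y \<zeta>) \<longlonglongrightarrow> 1 *\<^sub>R Y \<zeta>" by (intro tendsto_intros slim)
      ultimately show "(\<lambda>n. f (s n *\<^sub>R Y \<zeta>)) \<longlonglongrightarrow> f (Y \<zeta>)"
        using isCont_tendsto_compose by fastforce
    qed
    show "AE \<zeta> in ?M. norm (a \<zeta> * f (s n *\<^sub>R Y \<zeta>)) \<le> Ma * Mf" for n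
    proof (rule AE_I2)
      fix \<zeta>
      have "s n * norm (Y \<zeta>) \<le> 1 * \<rho>" using s[of n] Y[of \<zeta>] by (intro mult_mono) auto
      hence "cmod (f (s n *\<^sub>R Y \<zeta>)) \<le> Mf" using s[of n] by (intro Mf) simp
      moreover have "0 \<le> Ma" using Ma norm_ge_zero order_trans by blast
      ultimately show "norm (a \<zeta> * f (s n *\<^sub>R Y \<zeta>)) \<le> Ma * Mf"
        using Ma by (simp add: norm_mult mult_mono)
    qed
  qed simp_all
  hence "cmod (\<integral>\<zeta>. a \<zeta> * f (Y \<zeta>) \<partial>?M) \<le> hardy2_norm f * sqrt (square_mean g r)"
    by (rule tendsto_upperbound[OF tendsto_norm]) (auto intro!: always_eventually Es s)
  also have "(\<integral>\<zeta>. a \<zeta> * f (Y \<zeta>) \<partial>?M) = (\<integral>\<zeta>. g (r *\<^sub>R clip \<zeta>) * cnj (g (r *\<^sub>R clip \<zeta>)) \<partial>?M)"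
    by (intro Bochner_Integration.integral_cong refl)
       (simp only: a_def h_def mult.assoc Geq[symmetric], simp add: G_def X_def mult.commute)
  also have "\<dots> = of_real (square_mean g r)"
    unfolding square_mean_of_real using integral_clip[of "\<lambda>\<zeta>. g (r *\<^sub>R \<zeta>) * cnj (g (r *\<^sub>R \<zeta>))"] by simp
  finally have "sqrt (square_mean g r) * sqrt (square_mean g r) \<le> hardy2_norm f * sqrt (square_mean g r)"
    by (simp add: square_mean_nonneg)
  hence "sqrt (square_mean g r) \<le> hardy2_norm f"
    using square_mean_nonneg[of g r] hardy2_norm_nonneg[OF f]
      mult_le_cancel_right_pos[of "sqrt (square_mean g r)" "sqrt (square_mean g r)" "hardy2_norm f"]
    by (cases "square_mean g r = 0") simp_all
  thus ?thesis using sqrt_le_D by blast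
qed


section \<open>The linear map on pairs and its eigenvectors\<close>

section \<open>The linear algebra of a hyperbolic map with a single boundary fixed point\<close>

lemma norm_add_smult_square:
  "(norm (x + s *s y))\<^sup>2 = (norm x)\<^sup>2 + 2 * Re (cnj s * cinner x y) + (cmod s)\<^sup>2 * (norm y)\<^sup>2"
proof -
  have "complex_of_real ((norm (x + s *s y))\<^sup>2) = cinner (x + s *s y) (x + s *s y)" by (simp only: cinner_self)
  also have "\<dots> = cinner x x + (cnj s * cinner x y + cnj (cnj s * cinner x y)) + s * cnj s * cinner y y"
    unfolding cinner_simps cinner_commute[of x y] by (simp add: algebra_simps)
  also have "\<dots> = of_real ((norm x)\<^sup>2 + 2 * Re (cnj s * cinner x y) + (cmod s)\<^sup>2 * (norm y)\<^sup>2)"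
    unfolding complex_add_cnj cinner_self complex_norm_square[symmetric] by simp
  finally show ?thesis by (simp only: of_real_eq_iff)
qed

lemma cmod_add_mult_square:
  "(cmod (x + s * y))\<^sup>2 = (cmod x)\<^sup>2 + 2 * Re (cnj s * (x * cnj y)) + (cmod s)\<^sup>2 * (cmod y)\<^sup>2"
proof -
  have "complex_of_real ((cmod (x + s * y))\<^sup>2) = (x + s * y) * cnj (x + s * y)" by (simp only: complex_norm_square)
  also have "\<dots> = x * cnj x + (cnj s * (x * cnj y) + cnj (cnj s * (x * cnj y))) + (s * cnj s) * (y * cnj y)"
    by (simp add: algebra_simps)
  also have "\<dots> = of_real ((cmod x)\<^sup>2 + 2 * Re (cnj s * (x * cnj y)) + (cmod s)\<^sup>2 * (cmod y)\<^sup>2)"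
    unfolding complex_add_cnj complex_norm_square[symmetric] by simp
  finally show ?thesis by (simp only: of_real_eq_iff)
qed

text \<open>Divide by \<open>e\<close> and let it tend to 0. This extracts first order information
  from an inequality that holds on one side of a point.\<close>

lemma linear_term_nonneg:
  fixes a b c :: real
  assumes "c > 0" "\<And>e. 0 < e \<Longrightarrow> e < c \<Longrightarrow> 0 \<le> e * a + e\<^sup>2 * b"
  shows "0 \<le> a"
proof (rule tendsto_lowerbound[where F = "at_right (0 :: real)"])
  show "((\<lambda>e. a + e * b) \<longlongrightarrow> a) (at_right 0)" by (auto intro!: tendsto_eq_intros)
  show "\<forall>\<^sub>F e in at_right 0. 0 \<le> a + e * b"
    using eventually_at_right_real[OF assms(1)]
  proof (rule eventually_mono)
    fix e assume e: "e \<in> {0<..<c}"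
    hence "0 \<le> e * (a + e * b)" using assms(2)[of e] by (simp add: power2_eq_square algebra_simps)
    thus "0 \<le> a + e * b" using e by (simp add: zero_le_mult_iff)
  qed
qed simp

lemma matrix_vector_mult_smult: "A *v (c *s x) = c *s (A *v x)" for A :: "complex ^ 'n ^ 'm"
  by (simp add: vec_eq_iff matrix_vector_mult_def sum_distrib_left mult_ac)

lemma continuous_on_matrix_vector_mult [continuous_intros]:
  fixes A :: "complex ^ 'n ^ 'm"
  shows "continuous_on S f \<Longrightarrow> continuous_on S (\<lambda>x. A *v f x)"
  unfolding matrix_vector_mult_def by (intro continuous_intros)

text \<open>A linear map with a kernel has a proper range, and a vector orthogonal to the range
  spans a kernel direction of the transpose.\<close>

lemma exists_orthogonal_of_singular:
  fixes T :: "'a::euclidean_space \<Rightarrow> 'a"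
  assumes T: "linear T" and "T e = 0" "e \<noteq> 0"
  obtains w where "w \<noteq> 0" "\<And>x. T x \<bullet> w = 0"
proof -
  have "\<not> inj T" using assms linear_injective_0[OF T] by blast
  hence "\<not> surj T" using linear_surjective_imp_injective[OF T] by blast
  moreover have sp: "span (range T) = range T" using T by (simp add: linear_subspace_image span_eq_iff)
  ultimately have "span (range T) \<noteq> UNIV" by (simp only: sp not_False_eq_True)
  hence "dim (range T) < DIM('a)" by (metis dim_eq_full dim_subset_UNIV le_neq_implies_less)
  then obtain w where w: "w \<noteq> 0" "\<And>y. y \<in> span (range T) \<Longrightarrow> orthogonal w y"
    using orthogonal_to_subspace_exists by blast
  show ?thesis
  proof (rule that[OF w(1)])
    show "T x \<bullet> w = 0" for x
      using w(2)[of "T x"] by (simp add: orthogonal_def inner_commute span_base)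
  qed
qed

text \<open>The hypotheses of the theorem in terms of the coefficients. \<open>unique_fix\<close>
  merges the absence of fixed points inside the ball with uniqueness on the sphere, because
  Brouwer's theorem yields a fixed point in the closed ball.\<close>

locale hyperbolic_lf =
  fixes A :: "complex ^ 'n ^ 'n" and B C :: "complex ^ 'n" and d :: complex
    and \<tau> :: "complex ^ 'n" and \<alpha> :: real
  assumes den: "\<And>z. z \<in> ball 0 1 \<Longrightarrow> cinner z C + d \<noteq> 0"
    and maps: "\<And>z. z \<in> ball 0 1 \<Longrightarrow> lin_frac A B C d z \<in> ball 0 1"
    and \<tau>1: "norm \<tau> = 1" and fix_\<tau>: "lin_frac A B C d \<tau> = \<tau>"
    and \<alpha>: "0 < \<alpha>" "\<alpha> < 1"
    and deriv: "\<exists>D. (lin_frac A B C d has_derivative D) (at \<tau>) \<and> cinner (D \<tau>) \<tau> = of_real \<alpha>"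
    and unique_fix: "\<And>z. z \<in> cball 0 1 \<Longrightarrow> lin_frac A B C d z = z \<Longrightarrow> z = \<tau>"
begin

text \<open>\<open>M\<close> and \<open>Q\<close> are the components of the linear map on pairs that
  induces the fractional map. \<open>\<kappa>\<close> is its eigenvalue at
  \<open>(\<tau>, 1)\<close>, \<open>\<psi>\<close> pairs the image with this null vector in the
  indefinite form, and \<open>\<mu>\<close> is the factor by which the map at least expands the
  form.\<close>

definition Q where "Q x t = cinner x C + t * d"
definition M where "M x t = A *v x + t *s B"
definition \<kappa> where "\<kappa> = Q \<tau> 1"
definition \<psi> where "\<psi> x t = Q x t - cinner (M x t) \<tau>"
definition \<mu> where "\<mu> = (cmod \<kappa>)\<^sup>2 * \<alpha>"

lemma Q_add: "Q (x + y) (s + t) = Q x s + Q y t"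
  by (simp add: Q_def cinner_simps algebra_simps)

lemma Q_smult: "Q (c *s x) (c * t) = c * Q x t"
  by (simp add: Q_def cinner_simps algebra_simps)

lemma M_add: "M (x + y) (s + t) = M x s + M y t"
  by (simp add: M_def matrix_vector_right_distrib vec_eq_iff algebra_simps)

lemma M_smult: "M (c *s x) (c * t) = c *s M x t"
  by (simp add: M_def matrix_vector_mult_smult vec_eq_iff algebra_simps)

lemma \<psi>_add: "\<psi> (x + y) (s + t) = \<psi> x s + \<psi> y t"
  by (simp add: \<psi>_def Q_add M_add cinner_simps)

lemma \<psi>_smult: "\<psi> (c *s x) (c * t) = c * \<psi> x t"
  by (simp add: \<psi>_def Q_smult M_smult cinner_simps algebra_simps)

lemma lin_frac_eq: "lin_frac A B C d z = inverse (Q z 1) *s M z 1"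
  by (simp add: lin_frac_def Q_def M_def)

lemma \<tau>\<tau>: "cinner \<tau> \<tau> = 1"
  by (simp add: cinner_self \<tau>1)

lemma \<kappa>0: "\<kappa> \<noteq> 0"
proof
  assume "\<kappa> = 0"
  hence "\<tau> = 0" using fix_\<tau> by (simp add: lin_frac_eq \<kappa>_def)
  thus False using \<tau>1 by simp
qed

lemma M_\<tau>: "M \<tau> 1 = \<kappa> *s \<tau>"
proof -
  have "\<kappa> *s \<tau> = \<kappa> *s (inverse \<kappa> *s M \<tau> 1)" using fix_\<tau> by (simp add: lin_frac_eq \<kappa>_def)
  thus ?thesis using \<kappa>0 by (simp add: vector_smult_assoc)
qed

lemma \<mu>_pos: "0 < \<mu>"
  using \<kappa>0 \<alpha> by (simp add: \<mu>_def)

lemma M_le_Q_strict: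
  assumes "norm x < cmod t" shows "norm (M x t) \<le> cmod (Q x t)"
proof -
  have t: "t \<noteq> 0" using assms norm_ge_zero[of x] by auto
  define z where "z = inverse t *s x"
  have "norm z = norm x / cmod t" by (simp add: z_def norm_smult norm_inverse divide_inverse mult.commute)
  hence z: "z \<in> ball 0 1" using assms t by (simp add: divide_less_eq)
  have x: "x = t *s z" using t by (simp add: z_def vector_smult_assoc)
  have "norm (lin_frac A B C d z) < 1" using maps[OF z] by simp
  moreover have "Q z 1 \<noteq> 0" using den[OF z] by (simp add: Q_def)
  moreover have "norm (lin_frac A B C d z) = norm (M z 1) / cmod (Q z 1)"
    by (simp add: lin_frac_eq norm_smult norm_inverse divide_inverse mult.commute)
  ultimately have "norm (M z 1) \<le> cmod (Q z 1)" by (simp add: divide_less_eq)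
  hence "cmod t * norm (M z 1) \<le> cmod t * cmod (Q z 1)" by (intro mult_left_mono) auto
  thus ?thesis using M_smult[of t z 1] Q_smult[of t z 1] x by (simp add: norm_smult norm_mult)
qed

text \<open>Shrinking \<open>x\<close> moves a pair with \<open>t \<noteq> 0\<close> from the closed
  cone into the open one, and the inequality survives the limit.\<close>

lemma M_le_Q:
  assumes le: "norm x \<le> cmod t" shows "norm (M x t) \<le> cmod (Q x t)"
proof (cases "t = 0")
  case True
  thus ?thesis using le by (simp add: M_def Q_def)
next
  case False
  have "((\<lambda>s. norm (M (of_real s *s x) t)) \<longlongrightarrow> norm (M (of_real 1 *s x) t)) (at_left 1)"
    "((\<lambda>s. cmod (Q (of_real s *s x) t)) \<longlongrightarrow> cmod (Q (of_real 1 *s x) t)) (at_left 1)"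
    unfolding M_def Q_def matrix_vector_mult_smult cinner_smult_left
    by (intro tendsto_intros bounded_linear.tendsto[OF bounded_linear_smult_left])+
  moreover have "\<forall>\<^sub>F s in at_left 1. norm (M (of_real s *s x) t) \<le> cmod (Q (of_real s *s x) t)"
    using eventually_at_left_real[of 0 1, OF zero_less_one]
  proof (rule eventually_mono)
    fix s :: real assume s: "s \<in> {0<..<1}"
    have "s * norm x \<le> s * cmod t" using s le by (intro mult_left_mono) auto
    also have "\<dots> < 1 * cmod t" using s False by (intro mult_strict_right_mono) auto
    finally show "norm (M (of_real s *s x) t) \<le> cmod (Q (of_real s *s x) t)"
      using s by (intro M_le_Q_strict) (simp add: norm_smult)
  qed
  ultimately have "norm (M (of_real 1 *s x) t) \<le> cmod (Q (of_real 1 *s x) t)"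
    by (intro tendsto_le[where F = "at_left (1::real)"]) auto
  thus ?thesis by simp
qed

text \<open>\<open>(\<tau>, 1)\<close> is a null vector, so the terms quadratic in \<open>s\<close>
  cancel. The same happens after the map, which sends this vector to a multiple of itself.\<close>

lemma form_shift:
  "(cmod (t + s))\<^sup>2 - (norm (x + s *s \<tau>))\<^sup>2 = (cmod t)\<^sup>2 - (norm x)\<^sup>2 + 2 * Re (cnj s * (t - cinner x \<tau>))"
  using norm_add_smult_square[of x s \<tau>] cmod_add_mult_square[of t s 1]
  by (simp add: \<tau>1 algebra_simps)

lemma image_form_shift:
  "(cmod (Q (x + s *s \<tau>) (t + s)))\<^sup>2 - (norm (M (x + s *s \<tau>) (t + s)))\<^sup>2
    = (cmod (Q x t))\<^sup>2 - (norm (M x t))\<^sup>2 + 2 * Re (cnj (s * \<kappa>) * \<psi> x t)"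
proof -
  have "Q (x + s *s \<tau>) (t + s) = Q x t + (s * \<kappa>) * 1"
    using Q_add[of x "s *s \<tau>" t "s * 1"] Q_smult[of s \<tau> 1] by (simp add: \<kappa>_def)
  moreover have "M (x + s *s \<tau>) (t + s) = M x t + (s * \<kappa>) *s \<tau>"
    using M_add[of x "s *s \<tau>" t "s * 1"] M_smult[of s \<tau> 1] by (simp add: M_\<tau> vector_smult_assoc)
  ultimately show ?thesis
    using norm_add_smult_square[of "M x t" "s * \<kappa>" \<tau>] cmod_add_mult_square[of "Q x t" "s * \<kappa>" 1]
    by (simp add: \<tau>1 \<psi>_def algebra_simps)
qed

text \<open>Compares first order terms of the two forms at the null vector \<open>(\<tau>, 1)\<close>.\<close>

lemma Re_\<psi>_nonneg:
  assumes pos: "0 < Re (t - cinner x \<tau>)"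
  shows "0 \<le> Re (cnj \<kappa> * \<psi> x t)"
proof -
  define p where "p = Re (t - cinner x \<tau>)"
  define b where "b = (cmod t)\<^sup>2 - (norm x)\<^sup>2"
  \<comment> \<open>For \<open>e < c\<close> the first order gain \<open>2 * p\<close> outweighs
    \<open>e * b\<close>, so the pair shifted by \<open>(\<tau>, 1)\<close> lies in the
    cone.\<close>
  define c where "c = 2 * p / (\<bar>b\<bar> + 1)"
  have c: "c > 0" using pos by (simp add: c_def p_def)
  have "0 \<le> 2 * Re (cnj \<kappa> * \<psi> x t)"
  proof (rule linear_term_nonneg[OF c])
    fix e assume e: "0 < e" "e < c"
    have "e * (\<bar>b\<bar> + 1) < 2 * p" using e(2) by (simp add: c_def field_simps)
    moreover have "- (e * \<bar>b\<bar>) \<le> e * b" using e abs_le_iff[of b "\<bar>b\<bar>"] mult_left_mono[of "-\<bar>b\<bar>" b e] by auto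
    ultimately have "0 \<le> 2 * p + e * b" using e by (simp add: algebra_simps)
    hence nn: "0 \<le> e * (2 * p + e * b)" using e by simp
    let ?x = "of_real e *s x" and ?t = "of_real e * t"
    have "(cmod (?t + 1))\<^sup>2 - (norm (?x + 1 *s \<tau>))\<^sup>2 = e * (2 * p + e * b)"
      unfolding form_shift by (simp add: norm_smult norm_mult cinner_simps p_def b_def power_mult_distrib algebra_simps power2_eq_square)
    hence "(norm (?x + 1 *s \<tau>))\<^sup>2 \<le> (cmod (?t + 1))\<^sup>2" using nn by linarith
    hence "norm (?x + 1 *s \<tau>) \<le> cmod (?t + 1)" by (rule power2_le_imp_le) simp
    from power_mono[OF M_le_Q[OF this] norm_ge_zero, of 2]
    have "0 \<le> (cmod (Q ?x ?t))\<^sup>2 - (norm (M ?x ?t))\<^sup>2 + 2 * Re (cnj (1 * \<kappa>) * \<psi> ?x ?t)"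
      unfolding image_form_shift[symmetric] by simp
    also have "\<dots> = e * (2 * Re (cnj \<kappa> * \<psi> x t)) + e\<^sup>2 * ((cmod (Q x t))\<^sup>2 - (norm (M x t))\<^sup>2)"
      unfolding Q_smult M_smult \<psi>_smult using e
      by (simp add: norm_smult norm_mult power_mult_distrib algebra_simps)
    finally show "0 \<le> e * (2 * Re (cnj \<kappa> * \<psi> x t)) + e\<^sup>2 * ((cmod (Q x t))\<^sup>2 - (norm (M x t))\<^sup>2)" .
  qed
  thus ?thesis by simp
qed

text \<open>A complex linear functional whose real part has a sign on a half-space vanishes on the
  complex hyperplane in its boundary, hence is a multiple of the functional that defines the
  half-space. This says that \<open>(\<tau>, 1)\<close> is an eigenvector of the adjoint.\<close>

lemma \<psi>_eq': "\<psi> x t = \<psi> 0 1 * (t - cinner x \<tau>)"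
proof -
  have ker: "\<psi> x (cinner x \<tau>) = 0" for x
  proof -
    have nn: "0 \<le> Re (cnj \<kappa> * \<psi> x (cinner x \<tau>))" for x
    proof (rule tendsto_lowerbound[where F = "at_right (0 :: real)"])
      show "((\<lambda>e. Re (cnj \<kappa> * (\<psi> x (cinner x \<tau>) + of_real e * \<psi> 0 1))) \<longlongrightarrow> Re (cnj \<kappa> * \<psi> x (cinner x \<tau>))) (at_right 0)"
        by (auto intro!: tendsto_eq_intros)
      show "\<forall>\<^sub>F e in at_right 0. 0 \<le> Re (cnj \<kappa> * (\<psi> x (cinner x \<tau>) + of_real e * \<psi> 0 1))"
        using eventually_at_right_less[of "0 :: real"]
      proof (rule eventually_mono)
        fix e :: real assume "0 < e"
        have "\<psi> x (cinner x \<tau> + of_real e) = \<psi> x (cinner x \<tau>) + of_real e * \<psi> 0 1"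
          using \<psi>_add[of x "of_real e *s 0" "cinner x \<tau>" "of_real e * 1"] \<psi>_smult[of "of_real e" 0 1] by simp
        moreover have "0 \<le> Re (cnj \<kappa> * \<psi> x (cinner x \<tau> + of_real e))"
          using \<open>0 < e\<close> by (intro Re_\<psi>_nonneg) simp
        ultimately show "0 \<le> Re (cnj \<kappa> * (\<psi> x (cinner x \<tau>) + of_real e * \<psi> 0 1))" by simp
      qed
    qed simp
    define w where "w = cnj \<kappa> * \<psi> x (cinner x \<tau>)"
    \<comment> \<open>Scaling \<open>x\<close> by \<open>- cnj w\<close> turns the value
      \<open>w\<close> into minus its squared modulus, and only 0 is left.\<close>
    have "0 \<le> Re (cnj \<kappa> * \<psi> ((- cnj w) *s x) (cinner ((- cnj w) *s x) \<tau>))" by (rule nn)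
    also have "cnj \<kappa> * \<psi> ((- cnj w) *s x) (cinner ((- cnj w) *s x) \<tau>) = - (w * cnj w)"
      unfolding cinner_smult_left \<psi>_smult by (simp add: w_def mult_ac)
    also have "\<dots> = - of_real ((cmod w)\<^sup>2)" by (simp only: complex_norm_square)
    finally have "w = 0" by simp
    thus ?thesis using \<kappa>0 by (simp add: w_def)
  qed
  have "\<psi> x t = \<psi> (x + (t - cinner x \<tau>) *s 0) (cinner x \<tau> + (t - cinner x \<tau>) * 1)" by simp
  thus ?thesis unfolding \<psi>_add \<psi>_smult ker by simp
qed

text \<open>Along the line through \<open>\<tau>\<close> the previous lemma makes the component of
  the map in that direction explicit; comparing its derivative with the dilation coefficient gives
  the factor.\<close>

lemma \<psi>01: "\<psi> 0 1 = of_real \<alpha> * \<kappa>"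
proof -
  obtain D where D: "(lin_frac A B C d has_derivative D) (at \<tau>)" "cinner (D \<tau>) \<tau> = of_real \<alpha>"
    using deriv by blast
  define k where "k = cinner \<tau> C"
  have Qs: "Q (\<tau> + s *\<^sub>R \<tau>) 1 = \<kappa> + of_real s * k" for s
    by (simp add: Q_def \<kappa>_def cinner_simps k_def)
  have lineD: "((\<lambda>s :: real. \<tau> + s *\<^sub>R \<tau>) has_derivative (\<lambda>s. s *\<^sub>R \<tau>)) (at 0)"
    by (auto intro!: derivative_eq_intros)
  have "((\<lambda>s :: real. lin_frac A B C d (\<tau> + s *\<^sub>R \<tau>)) has_derivative (\<lambda>s. D (s *\<^sub>R \<tau>))) (at 0)"
    using has_derivative_compose[OF lineD, of "lin_frac A B C d" D] D(1) by simp
  from bounded_linear.has_derivative[OF bounded_linear_cinner_left[of \<tau>] this]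
  have "((\<lambda>s :: real. cinner (lin_frac A B C d (\<tau> + s *\<^sub>R \<tau>)) \<tau>) has_derivative (\<lambda>s. cinner (D (s *\<^sub>R \<tau>)) \<tau>)) (at 0)" .
  moreover have "D (s *\<^sub>R \<tau>) = s *\<^sub>R D \<tau>" for s
    using has_derivative_linear[OF D(1)] by (simp add: linear_cmul)
  ultimately have d1: "((\<lambda>s :: real. cinner (lin_frac A B C d (\<tau> + s *\<^sub>R \<tau>)) \<tau>) has_vector_derivative of_real \<alpha>) (at 0)"
    by (simp add: has_vector_derivative_def cinner_simps D(2) scaleR_conv_of_real[where 'a = complex])
  have eq: "cinner (lin_frac A B C d (\<tau> + s *\<^sub>R \<tau>)) \<tau> = 1 + \<psi> 0 1 * of_real s / (\<kappa> + of_real s * k)"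
    if "\<kappa> + of_real s * k \<noteq> 0" for s
  proof -
    have "\<psi> (\<tau> + s *\<^sub>R \<tau>) 1 = - (\<psi> 0 1 * of_real s)"
      by (subst \<psi>_eq') (simp add: cinner_simps \<tau>\<tau>)
    hence "cinner (M (\<tau> + s *\<^sub>R \<tau>) 1) \<tau> = \<kappa> + of_real s * k + \<psi> 0 1 * of_real s"
      unfolding \<psi>_def[of "\<tau> + s *\<^sub>R \<tau>"] Qs by (simp add: algebra_simps)
    thus ?thesis unfolding lin_frac_eq cinner_smult_left Qs using that by (simp add: field_simps)
  qed
  have d2: "((\<lambda>s :: real. 1 + \<psi> 0 1 * of_real s / (\<kappa> + of_real s * k)) has_vector_derivative \<psi> 0 1 / \<kappa>) (at 0)"
  proof -
    have "((\<lambda>s. 1 + \<psi> 0 1 * s / (\<kappa> + s * k)) has_field_derivative \<psi> 0 1 / \<kappa>) (at (of_real 0))"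
      using \<kappa>0 by (auto intro!: derivative_eq_intros)
    from has_vector_derivative_real_field[OF this] show ?thesis by simp
  qed
  have "((\<lambda>s :: real. cinner (lin_frac A B C d (\<tau> + s *\<^sub>R \<tau>)) \<tau>) has_vector_derivative \<psi> 0 1 / \<kappa>) (at 0)"
  proof (rule has_vector_derivative_transform_within_open[OF d2])
    show "open {s :: real. \<kappa> + of_real s * k \<noteq> 0}" by (intro open_Collect_neq continuous_intros)
  qed (use \<kappa>0 in \<open>auto simp: eq\<close>)
  with d1 have "of_real \<alpha> = \<psi> 0 1 / \<kappa>" using vector_derivative_unique_at by blast
  thus ?thesis using \<kappa>0 by (simp add: field_simps)
qed

lemma \<psi>_eq: "\<psi> x t = of_real \<alpha> * \<kappa> * (t - cinner x \<tau>)"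
  using \<psi>_eq'[of x t] by (simp add: \<psi>01)

text \<open>\<open>H\<close> is the defect form of the map in homogeneous coordinates; it is invariant under shifts by the
  null vector \<open>(\<tau>, 1)\<close>, along which every vector off its orthogonal complement can be moved
  into the light cone.\<close>

definition H where "H x t = (cmod (Q x t))\<^sup>2 - (norm (M x t))\<^sup>2 - \<mu> * ((cmod t)\<^sup>2 - (norm x)\<^sup>2)"

lemma H_shift: "H (x + s *s \<tau>) (t + s) = H x t"
proof -
  have "cnj (s * \<kappa>) * \<psi> x t = of_real \<mu> * (cnj s * (t - cinner x \<tau>))"
    unfolding \<psi>_eq \<mu>_def of_real_mult complex_norm_square by (simp add: mult_ac)
  moreover have Re_mult: "Re (of_real r * w) = r * Re w" for r w by simp
  ultimately have "Re (cnj (s * \<kappa>) * \<psi> x t) = \<mu> * Re (cnj s * (t - cinner x \<tau>))"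
    by (simp only: Re_mult)
  thus ?thesis unfolding H_def image_form_shift form_shift by (simp add: algebra_simps)
qed

lemma H_nonneg: "0 \<le> H x t"
proof -
  have gen: "0 \<le> H x t" if nz: "t - cinner x \<tau> \<noteq> 0" for x t
  proof -
    define l where "l = t - cinner x \<tau>"
    define b where "b = (cmod t)\<^sup>2 - (norm x)\<^sup>2"
    \<comment> \<open>Solves \<open>2 * Re (cnj s * l) = - b\<close>, which puts the shifted pair on
      the light cone.\<close>
    define s where "s = of_real (- b / (2 * (cmod l)\<^sup>2)) * l"
    have "cnj s * l = of_real (- b / (2 * (cmod l)\<^sup>2)) * of_real ((cmod l)\<^sup>2)"
      unfolding complex_norm_square by (simp add: s_def mult_ac)
    also have "\<dots> = of_real (- b / 2)" using nz by (simp add: l_def)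
    finally have "2 * Re (cnj s * l) = - b" by simp
    hence z: "(cmod (t + s))\<^sup>2 - (norm (x + s *s \<tau>))\<^sup>2 = 0" unfolding form_shift l_def[symmetric] by (simp add: b_def)
    hence "norm (x + s *s \<tau>) \<le> cmod (t + s)" by (simp add: power2_eq_iff_nonneg)
    from power_mono[OF M_le_Q[OF this] norm_ge_zero, of 2] z
    have "0 \<le> H (x + s *s \<tau>) (t + s)" by (simp add: H_def)
    thus ?thesis by (simp only: H_shift)
  qed
  show ?thesis
  proof (cases "t - cinner x \<tau> = 0")
    \<comment> \<open>The exceptional hyperplane is reached by continuity, replacing
      \<open>t\<close> by \<open>t + e\<close>.\<close>
    case True
    show ?thesis
    proof (rule tendsto_lowerbound[where F = "at_right (0 :: real)"])
      show "((\<lambda>e. H x (t + of_real e)) \<longlongrightarrow> H x t) (at_right 0)"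
      proof -
        have "continuous_on UNIV (\<lambda>e :: real. H x (t + of_real e))"
          unfolding H_def Q_def M_def by (intro continuous_intros)
        hence "isCont (\<lambda>e :: real. H x (t + of_real e)) 0" by (simp add: continuous_on_eq_continuous_at)
        thus ?thesis by (simp add: isCont_def filterlim_at_split)
      qed
      show "\<forall>\<^sub>F e in at_right 0. 0 \<le> H x (t + of_real e)"
        using eventually_at_right_less[of "0 :: real"]
        by (rule eventually_mono) (use True in \<open>auto intro!: gen simp: algebra_simps\<close>)
    qed simp
  qed (rule gen)
qed

text \<open>At a zero of the denominator on the sphere \<open>H_nonneg\<close> makes
  \<open>M\<close> vanish as well. Then at \<open>(z, 1 + e)\<close> the first two terms of
  \<open>H\<close> are of second order in \<open>e\<close>, while the last is
  \<open>- 2 * \<mu> * e\<close> to first order, so \<open>H\<close> would become negative.\<close>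

lemma Q_nonzero:
  assumes z: "norm z \<le> 1" shows "Q z 1 \<noteq> 0"
proof
  assume Q0: "Q z 1 = 0"
  hence nz: "norm z = 1" using den[of z] z by (force simp: Q_def)
  have "0 \<le> - (norm (M z 1))\<^sup>2" using H_nonneg[of z 1] nz by (simp add: H_def Q0)
  hence M0: "M z 1 = 0" by simp
  have "0 \<le> - (2 * \<mu>)"
  proof (rule linear_term_nonneg[OF zero_less_one])
    fix e :: real assume e: "0 < e"
    have "Q z (1 + of_real e) = of_real e * d"
      using Q_add[of z 0 1 "of_real e"] Q0 by (simp add: Q_def)
    moreover have "M z (1 + of_real e) = of_real e *s B"
      using M_add[of z 0 1 "of_real e"] M0 by (simp add: M_def)
    moreover have "cmod (1 + of_real e) = 1 + e"
      using e by (metis abs_of_pos add_pos_pos norm_of_real of_real_1 of_real_add zero_less_one)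
    ultimately have "0 \<le> e\<^sup>2 * (cmod d)\<^sup>2 - e\<^sup>2 * (norm B)\<^sup>2 - \<mu> * ((1 + e)\<^sup>2 - 1)"
      using H_nonneg[of z "1 + of_real e"] nz by (simp add: H_def norm_mult norm_smult power_mult_distrib)
    thus "0 \<le> e * (- (2 * \<mu>)) + e\<^sup>2 * ((cmod d)\<^sup>2 - (norm B)\<^sup>2 - \<mu>)"
      by (simp add: power2_eq_square algebra_simps)
  qed
  thus False using \<mu>_pos by simp
qed

text \<open>The functional on pairs is found as a real vector orthogonal to the range of the map
  minus \<open>k\<close>. That condition concerns real parts; applied to pairs multiplied by \<i>,
  it gives the imaginary parts too.\<close>

lemma dual_eigenvector:
  assumes "(x\<^sub>0, t\<^sub>0) \<noteq> 0" "M x\<^sub>0 t\<^sub>0 = k *s x\<^sub>0" "Q x\<^sub>0 t\<^sub>0 = k * t\<^sub>0"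
  obtains u c where "(u, c) \<noteq> 0" "\<And>x t. cinner (M x t) u + Q x t * cnj c = k * (cinner x u + t * cnj c)"
proof -
  define T where "T p = (M (fst p) (snd p) - k *s fst p, Q (fst p) (snd p) - k * snd p)" for p
  have "linear T"
  proof (rule linearI)
    show "T (p + p') = T p + T p'" for p p'
      by (simp add: T_def M_add Q_add vec_eq_iff algebra_simps)
    show "T (r *\<^sub>R p) = r *\<^sub>R T p" for r p
      using M_smult[of "of_real r" "fst p" "snd p"] Q_smult[of "of_real r" "fst p" "snd p"]
      by (simp add: T_def scaleR_eq_smult scaleR_conv_of_real[where 'a = complex] vec_eq_iff algebra_simps)
  qed
  moreover have "T (x\<^sub>0, t\<^sub>0) = 0" using assms by (simp add: T_def zero_prod_def)
  moreover note assms(1)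
  ultimately obtain w where w: "w \<noteq> 0" "\<And>p. T p \<bullet> w = 0"
    by (rule exists_orthogonal_of_singular) blast
  obtain u c where uc: "w = (u, c)" by (cases w)
  define L where "L x t = cinner x u + t * cnj c" for x t
  have inner: "(x, t) \<bullet> w = Re (L x t)" for x t
    by (simp add: uc L_def inner_eq_Re_cinner inner_complex_def)
  have L0: "L (M x t - k *s x) (Q x t - k * t) = 0" for x t
  proof (rule complex_eqI)
    show "Re (L (M x t - k *s x) (Q x t - k * t)) = Re 0"
      using w(2)[of "(x, t)"] unfolding T_def fst_conv snd_conv inner by simp
    have Ti: "T (\<i> *s x, \<i> * t) = (\<i> *s (M x t - k *s x), \<i> * (Q x t - k * t))"
      unfolding T_def fst_conv snd_conv M_smult Q_smult by (simp add: vec_eq_iff algebra_simps)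
    have Li: "L (\<i> *s y) (\<i> * s) = \<i> * L y s" for y s by (simp add: L_def cinner_simps algebra_simps)
    have "Re (\<i> * L (M x t - k *s x) (Q x t - k * t)) = 0"
      using w(2)[of "(\<i> *s x, \<i> * t)"] by (simp only: Ti inner Li)
    thus "Im (L (M x t - k *s x) (Q x t - k * t)) = Im 0" by simp
  qed
  show ?thesis
  proof (rule that[of u c])
    show "(u, c) \<noteq> 0" using w(1) uc by simp
    show "cinner (M x t) u + Q x t * cnj c = k * (cinner x u + t * cnj c)" for x t
      using L0[of x t] by (simp add: L_def cinner_simps algebra_simps)
  qed
qed

text \<open>A functional that kills \<open>(\<tau>, 1)\<close> is \<open>cinner x w\<close> minus a
  multiple of \<open>t - cinner x \<tau>\<close>, with \<open>w\<close> orthogonal to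
  \<open>\<tau>\<close>. If \<open>w = 0\<close>, its eigenvalue would be
  \<open>\<alpha> * \<kappa>\<close>. Otherwise \<open>H_nonneg\<close> at \<open>(w, 0)\<close>
  bounds the part of \<open>M w 0\<close> orthogonal to \<open>\<tau>\<close> by
  \<open>sqrt \<mu> * norm w\<close>, while the eigenvalue equation makes it at least
  \<open>cmod \<kappa> * norm w\<close>. Both contradict \<open>\<alpha> < 1\<close>.\<close>

lemma dual_eigenvector_at_\<tau>:
  assumes uc: "(u, c) \<noteq> 0"
    and L: "\<And>x t. cinner (M x t) u + Q x t * cnj c = \<kappa> * (cinner x u + t * cnj c)"
  shows "cinner \<tau> u + cnj c \<noteq> 0"
proof
  assume L\<tau>: "cinner \<tau> u + cnj c = 0"
  define b where "b = cinner u \<tau>"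
  define w where "w = u - b *s \<tau>"
  have cc: "cnj c = - cnj b" using L\<tau> by (simp add: b_def cinner_commute[of u \<tau>] eq_neg_iff_add_eq_0 add.commute)
  have cu: "cinner x u = cinner x w + cnj b * cinner x \<tau>" for x by (simp add: w_def cinner_simps)
  have w\<tau>: "cinner w \<tau> = 0" by (simp add: w_def cinner_simps \<tau>\<tau> b_def)
  have L': "cinner (M x t) w - cnj b * \<psi> x t = \<kappa> * (cinner x w - cnj b * (t - cinner x \<tau>))" for x t
    using L[of x t] unfolding cu cc \<psi>_def by (simp add: algebra_simps)
  show False
  proof (cases "w = 0")
    case True
    have "b \<noteq> 0"
    proof
      assume "b = 0"
      hence "c = 0" using cc by simp
      moreover have "u = 0" using True \<open>b = 0\<close> by (simp add: w_def)
      ultimately show False using uc by (simp add: zero_prod_def)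
    qed
    moreover have "cnj b * (of_real \<alpha> * \<kappa>) = \<kappa> * cnj b"
      using L'[of 0 1] by (simp add: True \<psi>01)
    ultimately have "complex_of_real \<alpha> = 1" using \<kappa>0 by simp
    thus False using \<alpha> by simp
  next
    case False
    define y where "y = M w 0"
    define y' where "y' = y - cinner y \<tau> *s \<tau>"
    have \<psi>w: "\<psi> w 0 = 0" by (simp add: \<psi>_eq w\<tau>)
    hence Qw: "Q w 0 = cinner y \<tau>" by (simp add: \<psi>_def y_def)
    have yw: "cinner y w = \<kappa> * of_real ((norm w)\<^sup>2)"
      using L'[of w 0] \<psi>w by (simp add: y_def w\<tau> cinner_self)
    have \<tau>w: "cinner \<tau> w = 0" using w\<tau> cinner_commute[of \<tau> w] by simp
    have "cinner y' w = cinner y w" by (simp add: y'_def cinner_simps \<tau>w)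
    hence "cmod \<kappa> * (norm w)\<^sup>2 \<le> norm y' * norm w"
      using cmod_cinner_le[of y' w] yw by (simp add: norm_mult norm_power)
    hence "cmod \<kappa> * norm w \<le> norm y'" using False by (simp add: power2_eq_square)
    hence "(cmod \<kappa> * norm w)\<^sup>2 \<le> (norm y')\<^sup>2" by (intro power_mono) auto
    also have "(norm y')\<^sup>2 = (norm y)\<^sup>2 - (cmod (cinner y \<tau>))\<^sup>2"
    proof -
      have "Re (cinner y \<tau> * cnj (cinner y \<tau>)) = (cmod (cinner y \<tau>))\<^sup>2"
        by (metis Re_complex_of_real complex_norm_square)
      thus ?thesis
        using norm_add_smult_square[of y "- cinner y \<tau>" \<tau>] by (simp add: y'_def \<tau>1 mult.commute)
    qed
    also have "\<dots> \<le> \<mu> * (norm w)\<^sup>2" using H_nonneg[of w 0] by (simp add: H_def Qw y_def)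
    finally have "(cmod \<kappa>)\<^sup>2 * (norm w)\<^sup>2 \<le> (cmod \<kappa>)\<^sup>2 * \<alpha> * (norm w)\<^sup>2"
      by (simp add: power_mult_distrib \<mu>_def)
    hence "1 \<le> \<alpha>" using False \<kappa>0 by simp
    thus False using \<alpha> by simp
  qed
qed

lemma affine_eigenfunction:
  obtains v where "norm v < 1"
    "\<And>z. norm z \<le> 1 \<Longrightarrow> (1 - cinner (lin_frac A B C d z) v) * Q z 1 = \<kappa> * (1 - cinner z v)"
proof -
  have pr: "(\<tau>, 1 :: complex) \<noteq> 0" by (simp add: zero_prod_def)
  have Q\<tau>: "Q \<tau> 1 = \<kappa> * 1" by (simp add: \<kappa>_def)
  obtain u c where uc: "(u, c) \<noteq> 0"
    and L: "\<And>x t. cinner (M x t) u + Q x t * cnj c = \<kappa> * (cinner x u + t * cnj c)"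
    using dual_eigenvector[OF pr M_\<tau> Q\<tau>] by blast
  have L\<tau>: "cinner \<tau> u + cnj c \<noteq> 0" by (rule dual_eigenvector_at_\<tau>[OF uc L])
  define l where "l z = cinner z u + cnj c" for z
  have l\<phi>: "l (lin_frac A B C d z) * Q z 1 = \<kappa> * l z" if "norm z \<le> 1" for z
    using L[of z 1] Q_nonzero[OF that] by (simp add: l_def lin_frac_eq cinner_simps field_simps)
  have lnz: "l z \<noteq> 0" if z: "norm z \<le> 1" for z
  proof
    assume "l z = 0"
    \<comment> \<open>Compact and convex because \<open>l\<close> is affine, and mapped into itself
      by the eigenvalue equation.\<close>
    define S where "S = {z \<in> cball 0 1. l z = 0}"
    have cont: "continuous_on (cball 0 1) l" unfolding l_def by (intro continuous_intros)
    have "S = cball 0 1 \<inter> l -` {0}" by (auto simp: S_def)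
    hence "closed S" using continuous_closed_preimage[OF cont] by simp
    moreover have "bounded S" by (rule bounded_subset[OF bounded_cball[of 0 1]]) (auto simp: S_def)
    ultimately have "compact S" by (simp add: compact_eq_bounded_closed)
    moreover have "convex S"
    proof (rule convexI)
      fix x y and s t :: real assume xy: "x \<in> S" "y \<in> S" and st: "0 \<le> s" "0 \<le> t" "s + t = 1"
      have "l (s *\<^sub>R x + t *\<^sub>R y) = of_real s * l x + of_real t * l y + (1 - of_real (s + t)) * cnj c"
        by (simp add: l_def cinner_simps algebra_simps)
      hence "l (s *\<^sub>R x + t *\<^sub>R y) = 0" using xy st by (simp add: S_def)
      moreover have "s *\<^sub>R x + t *\<^sub>R y \<in> cball 0 1"
        using convexD[OF convex_cball[of 0 1], of x y s t] xy st unfolding S_def by blast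
      ultimately show "s *\<^sub>R x + t *\<^sub>R y \<in> S" by (simp add: S_def)
    qed
    moreover have "S \<noteq> {}" using \<open>l z = 0\<close> z by (auto simp: S_def)
    moreover have "continuous_on S (lin_frac A B C d)"
      unfolding lin_frac_def using Q_nonzero by (intro continuous_intros) (auto simp: S_def Q_def)
    moreover have "lin_frac A B C d \<in> S \<rightarrow> S"
    proof
      fix y assume y: "y \<in> S"
      hence y1: "norm y \<le> 1" by (simp add: S_def)
      have "norm (M y 1) \<le> cmod (Q y 1)" using y1 by (intro M_le_Q) simp
      moreover have "norm (lin_frac A B C d y) = norm (M y 1) / cmod (Q y 1)"
        by (simp add: lin_frac_eq norm_smult norm_inverse divide_inverse mult.commute)
      ultimately have "norm (lin_frac A B C d y) \<le> 1"
        using Q_nonzero[OF y1] by (simp add: divide_le_eq)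
      moreover have "l (lin_frac A B C d y) = 0" using l\<phi>[OF y1] y Q_nonzero[OF y1] by (simp add: S_def)
      ultimately show "lin_frac A B C d y \<in> S" by (simp add: S_def)
    qed
    ultimately obtain y where y: "y \<in> S" "lin_frac A B C d y = y" by (rule brouwer)
    hence "y = \<tau>" using unique_fix by (simp add: S_def)
    thus False using y(1) L\<tau> by (simp add: S_def l_def)
  qed
  have c0: "cnj c \<noteq> 0" using lnz[of 0] by (simp add: l_def)
  \<comment> \<open>Normalises the eigenfunction to the value 1 at the origin, where
    \<open>l\<close> does not vanish.\<close>
  define v where "v = (- inverse c) *s u"
  have lv: "l z = cnj c * (1 - cinner z v)" for z
    using c0 unfolding l_def v_def cinner_smult_right by (simp add: algebra_simps)
  show ?thesis
  proof (rule that[of v])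
    show "norm v < 1"
    proof (rule ccontr)
      assume "\<not> norm v < 1"
      hence v: "1 \<le> norm v" by simp
      \<comment> \<open>The point of the hyperplane \<open>cinner z v = 1\<close> nearest to the
        origin. For \<open>norm v \<ge> 1\<close> it would be a zero of \<open>l\<close> in the
        closed ball.\<close>
      define z where "z = (1 / (norm v)\<^sup>2) *\<^sub>R v"
      have "norm z = 1 / norm v" using v by (simp add: z_def power2_eq_square)
      hence "norm z \<le> 1" using v by (simp add: divide_le_eq)
      moreover have "norm v \<noteq> 0" using v by linarith
      hence "cinner z v = 1"
        by (simp add: z_def cinner_simps cinner_self del: of_real_power)
      ultimately show False using lnz[of z] by (simp add: lv)
    qed
    show "(1 - cinner (lin_frac A B C d z) v) * Q z 1 = \<kappa> * (1 - cinner z v)" if "norm z \<le> 1" for z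
      using l\<phi>[OF that] c0 unfolding lv by (simp add: mult_ac)
  qed
qed

text \<open>This is \<open>\<psi>_eq\<close> at \<open>t = 1\<close>: the second affine
  eigenfunction, for the eigenvalue \<open>\<alpha> * \<kappa>\<close>.\<close>

lemma \<tau>_eigenfunction:
  assumes "norm z \<le> 1"
  shows "(1 - cinner (lin_frac A B C d z) \<tau>) * Q z 1 = of_real \<alpha> * \<kappa> * (1 - cinner z \<tau>)"
proof -
  have "(1 - inverse (Q z 1) * w) * Q z 1 = Q z 1 - w" for w
    using Q_nonzero[OF assms] by (simp add: left_diff_distrib)
  thus ?thesis using \<psi>_eq[of z 1] by (simp add: \<psi>_def lin_frac_eq cinner_smult_left)
qed

end


section \<open>Completeness, the Neumann series and the growth of the iterates\<close>

section \<open>Series in the Hardy space\<close>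

text \<open>Cauchy's inequality on the complex line through \<open>x\<close> in the direction of
  \<open>h\<close>. It turns bounds for the terms of a series into bounds for their
  derivatives.\<close>

lemma ball_hol_derivative_bound:
  assumes f: "ball_hol f" and x: "norm x + \<delta> \<le> \<rho>" "0 < \<delta>" "\<rho> < 1"
    and M: "\<And>z. norm z \<le> \<rho> \<Longrightarrow> cmod (f z) \<le> M"
    and D: "(f has_derivative D) (at x)"
  shows "cmod (D h) \<le> M / \<delta> * norm h"
proof (cases "h = 0")
  case True
  thus ?thesis using has_derivative_linear[OF D] by (simp add: linear_0)
next
  case False
  define e where "e = (1 / norm h) *\<^sub>R h"
  have e: "norm e = 1" "h = norm h *\<^sub>R e" using False by (simp_all add: e_def)
  have le: "norm (x + u *s e) \<le> norm x + cmod u" for u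
    using norm_triangle_ineq[of x "u *s e"] e by (simp add: norm_smult)
  have hol: "(\<lambda>u. f (x + u *s e)) holomorphic_on {u. x + u *s e \<in> ball 0 1}"
    using f by (intro holomorphic_on_line) (auto simp: ball_hol_def)
  have sub: "cball 0 \<delta> \<subseteq> {u. x + u *s e \<in> ball 0 1}"
  proof
    fix u :: complex assume "u \<in> cball 0 \<delta>"
    thus "u \<in> {u. x + u *s e \<in> ball 0 1}" using le[of u] x by simp
  qed
  have "cmod ((deriv ^^ 1) (\<lambda>u. f (x + u *s e)) 0) \<le> fact 1 * M / \<delta> ^ 1"
  proof (rule Cauchy_inequality)
    show "(\<lambda>u. f (x + u *s e)) holomorphic_on ball 0 \<delta>"
      by (rule holomorphic_on_subset[OF hol order_trans[OF ball_subset_cball sub]])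
    show "continuous_on (cball 0 \<delta>) (\<lambda>u. f (x + u *s e))"
      by (intro holomorphic_on_imp_continuous_on holomorphic_on_subset[OF hol sub])
    fix u :: complex assume "cmod (0 - u) = \<delta>"
    thus "cmod (f (x + u *s e)) \<le> M" using le[of u] x by (intro M) simp
  qed (rule x)
  moreover have "deriv (\<lambda>u. f (x + u *s e)) 0 = D e"
  proof -
    have op: "open {u. x + u *s e \<in> ball 0 1}"
      using open_vimage[of "ball 0 1" "\<lambda>u. x + u *s e"]
      by (simp add: vimage_def continuous_intros)
    have "((\<lambda>u. f (x + u *s e)) has_field_derivative deriv (\<lambda>u. f (x + u *s e)) 0) (at 0)"
      by (rule holomorphic_derivI[OF hol op]) (use sub x in auto)
    hence "((\<lambda>u. f (x + u *s e)) has_derivative (*) (deriv (\<lambda>u. f (x + u *s e)) 0)) (at (of_real 0))"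
      by (simp add: has_field_derivative_def)
    from has_derivative_compose[OF bounded_linear_imp_has_derivative[OF bounded_linear_of_real] this]
    have "((\<lambda>t :: real. f (x + of_real t *s e)) has_derivative (\<lambda>t. deriv (\<lambda>u. f (x + u *s e)) 0 * of_real t)) (at 0)"
      .
    moreover have "((\<lambda>t :: real. x + t *\<^sub>R e) has_derivative (\<lambda>t. t *\<^sub>R e)) (at 0)"
      by (auto intro!: derivative_eq_intros)
    from has_derivative_compose[OF this, of f D]
    have "((\<lambda>t :: real. f (x + of_real t *s e)) has_derivative (\<lambda>t. D (t *\<^sub>R e))) (at 0)"
      using D by (simp add: scaleR_eq_smult)
    ultimately have "(\<lambda>t :: real. deriv (\<lambda>u. f (x + u *s e)) 0 * of_real t) = (\<lambda>t. D (t *\<^sub>R e))"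
      by (rule has_derivative_unique)
    from fun_cong[OF this, of 1] show ?thesis by simp
  qed
  ultimately have "cmod (D e) \<le> M / \<delta>" by simp
  hence "norm h * cmod (D e) \<le> norm h * (M / \<delta>)" by (intro mult_left_mono) auto
  moreover have "D h = norm h *\<^sub>R D e"
    using has_derivative_linear[OF D] e(2) by (metis linear_cmul)
  ultimately show ?thesis by (simp add: mult.commute)
qed

lemma summable_cmod_sub_partial_le:
  fixes a :: "nat \<Rightarrow> complex"
  assumes "summable (\<lambda>n. cmod (a n))"
  shows "cmod (sum a {..<n} - suminf a) \<le> (\<Sum>k. cmod (a (k + n)))"
proof -
  have s: "summable a" using assms by (rule summable_norm_cancel)
  have "suminf a = (\<Sum>k. a (k + n)) + sum a {..<n}" by (rule suminf_split_initial_segment[OF s])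
  hence "suminf a - sum a {..<n} = (\<Sum>k. a (k + n))" by (simp only: add_diff_cancel_right')
  hence "cmod (sum a {..<n} - suminf a) = cmod (\<Sum>k. a (k + n))"
    by (metis norm_minus_commute)
  also have "\<dots> \<le> (\<Sum>k. cmod (a (k + n)))"
    by (intro summable_norm summable_ignore_initial_segment[OF assms])
  finally show ?thesis .
qed

lemma hardy2_series_holomorphic:
  fixes g :: "nat \<Rightarrow> complex ^ 'n \<Rightarrow> complex"
  assumes g: "\<And>n. ball_hol (g n)"
    and C: "\<And>\<rho>. \<rho> < 1 \<Longrightarrow> \<exists>C. \<forall>n z. norm z \<le> \<rho> \<longrightarrow> cmod (g n z) \<le> C * M n"
    and M: "summable M" "\<And>n. 0 \<le> M n"
  shows "holomorphic_fun_on (\<lambda>z. \<Sum>n. g n z) (ball 0 1)"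
proof (rule holomorphic_fun_onI)
  fix z0 :: "complex ^ 'n" assume z0: "z0 \<in> ball 0 1"
  \<comment> \<open>The distance to the sphere is cut into three: one part for the neighbourhood of
    \<open>z0\<close>, one as room for Cauchy's inequality, and one to keep \<open>\<rho>\<close>
    below 1.\<close>
  define \<delta> where "\<delta> = (1 - norm z0) / 3"
  define \<rho> where "\<rho> = norm z0 + 2 * \<delta>"
  have \<delta>: "0 < \<delta>" "\<rho> < 1" using z0 by (auto simp: \<delta>_def \<rho>_def field_simps)
  obtain C where C: "\<And>n z. norm z \<le> \<rho> \<Longrightarrow> cmod (g n z) \<le> C * M n" using C[OF \<delta>(2)] by blast
  define C' where "C' = max C 0"
  have C': "cmod (g n z) \<le> C' * M n" if "norm z \<le> \<rho>" for n z
    using C[OF that, of n] mult_right_mono[of C C' "M n"] M(2)[of n] by (simp add: C'_def)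
  have C'0: "0 \<le> C'" by (simp add: C'_def)
  have S: "norm x + \<delta> \<le> \<rho>" if "x \<in> ball z0 \<delta>" for x
    using that norm_triangle_ineq2[of x z0] by (simp add: \<rho>_def dist_norm norm_minus_commute)
  have Sb: "x \<in> ball 0 1" if "x \<in> ball z0 \<delta>" for x using S[OF that] \<delta> by simp
  have "\<forall>n x. \<exists>D. x \<in> ball z0 \<delta> \<longrightarrow> (g n has_derivative D) (at x) \<and> (\<forall>c v. D (c *s v) = c * D v)"
    using g Sb by (metis ball_hol_def holomorphic_fun_onD open_ball)
  then obtain D where D: "\<And>n x. x \<in> ball z0 \<delta> \<Longrightarrow> (g n has_derivative D n x) (at x)"
    "\<And>n x c v. x \<in> ball z0 \<delta> \<Longrightarrow> D n x (c *s v) = c * D n x v" by metis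
  have Dle: "cmod (D n x h) \<le> C' * M n / \<delta> * norm h" if "x \<in> ball z0 \<delta>" for n x h
    by (rule ball_hol_derivative_bound[OF g S[OF that] \<delta>(1,2) C' D(1)[OF that]])
  have sM: "summable (\<lambda>n. C' * M n / \<delta>)" using M(1) by (intro summable_divide summable_mult)
  have sD: "summable (\<lambda>n. cmod (D n x h))" if "x \<in> ball z0 \<delta>" for x h
    by (rule summable_comparison_test'[OF summable_mult2[OF sM, of "norm h"]]) (use Dle[OF that] in auto)
  have "\<exists>G. \<forall>x\<in>ball z0 \<delta>. (\<lambda>n. g n x) sums (G x) \<and> (G has_derivative (\<lambda>h. \<Sum>n. D n x h)) (at x within ball z0 \<delta>)"
  proof (rule has_derivative_series)
    show "(g n has_derivative D n x) (at x within ball z0 \<delta>)" if "x \<in> ball z0 \<delta>" for n x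
      using D(1)[OF that] by (rule has_derivative_at_withinI)
    show "z0 \<in> ball z0 \<delta>" using \<delta> by simp
    have "summable (\<lambda>n. g n z0)"
    proof (rule summable_norm_cancel, rule summable_comparison_test'[OF summable_mult[OF M(1), of C']])
      show "norm (cmod (g n z0)) \<le> C' * M n" for n using C'[of z0 n] \<delta> by (simp add: \<rho>_def)
    qed
    thus "(\<lambda>n. g n z0) sums (\<Sum>n. g n z0)" by (rule summable_sums)
    fix e :: real assume e: "0 < e"
    have "(\<lambda>n. \<Sum>k. C' * M (k + n) / \<delta>) \<longlonglongrightarrow> 0" by (rule suminf_exist_split2[OF sM])
    hence "\<forall>\<^sub>F n in sequentially. (\<Sum>k. C' * M (k + n) / \<delta>) < e" using e by (rule order_tendstoD)
    thus "\<forall>\<^sub>F n in sequentially. \<forall>x\<in>ball z0 \<delta>. \<forall>h. cmod ((\<Sum>i<n. D i x h) - (\<Sum>n. D n x h)) \<le> e * norm h"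
    proof (rule eventually_mono, intro ballI allI)
      fix n x h assume n: "(\<Sum>k. C' * M (k + n) / \<delta>) < e" and x: "x \<in> ball z0 \<delta>"
      have sMn: "summable (\<lambda>k. C' * M (k + n) / \<delta>)" by (rule summable_ignore_initial_segment[OF sM])
      have "cmod ((\<Sum>i<n. D i x h) - (\<Sum>n. D n x h)) \<le> (\<Sum>k. cmod (D (k + n) x h))"
        by (rule summable_cmod_sub_partial_le[OF sD[OF x]])
      also have "\<dots> \<le> (\<Sum>k. C' * M (k + n) / \<delta> * norm h)"
        by (intro suminf_le Dle x summable_ignore_initial_segment[OF sD[OF x]] summable_mult2 sMn)
      also have "\<dots> = (\<Sum>k. C' * M (k + n) / \<delta>) * norm h" by (rule suminf_mult2[OF sMn, symmetric])
      also have "\<dots> \<le> e * norm h" using n by (intro mult_right_mono) auto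
      finally show "cmod ((\<Sum>i<n. D i x h) - (\<Sum>n. D n x h)) \<le> e * norm h" .
    qed
  qed simp
  then obtain G where G: "\<And>x. x \<in> ball z0 \<delta> \<Longrightarrow> (\<lambda>n. g n x) sums (G x)"
    "\<And>x. x \<in> ball z0 \<delta> \<Longrightarrow> (G has_derivative (\<lambda>h. \<Sum>n. D n x h)) (at x within ball z0 \<delta>)" by blast
  have z0': "z0 \<in> ball z0 \<delta>" using \<delta> by simp
  have "(G has_derivative (\<lambda>h. \<Sum>n. D n z0 h)) (at z0)"
    using G(2)[OF z0'] unfolding at_within_open[OF z0' open_ball] .
  hence "((\<lambda>z. \<Sum>n. g n z) has_derivative (\<lambda>h. \<Sum>n. D n z0 h)) (at z0)"
    by (rule has_derivative_transform_within_open[OF _ open_ball z0'])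
       (use G(1) in \<open>simp add: sums_iff\<close>)
  moreover have "(\<Sum>n. D n z0 (c *s v)) = c * (\<Sum>n. D n z0 v)" for c v
    unfolding D(2)[OF z0'] by (rule suminf_mult) (rule summable_norm_cancel[OF sD[OF z0']])
  ultimately show "\<exists>D. ((\<lambda>z. \<Sum>n. g n z) has_derivative D) (at z0) \<and> (\<forall>c v. D (c *s v) = c * D v)"
    by blast
qed

lemma hardy2_sum:
  assumes "\<And>i. i \<in> I \<Longrightarrow> f i \<in> hardy2" "finite I"
  shows "(\<lambda>z. \<Sum>i\<in>I. f i z) \<in> hardy2 \<and> hardy2_norm (\<lambda>z. \<Sum>i\<in>I. f i z) \<le> (\<Sum>i\<in>I. hardy2_norm (f i))"
  using assms(2,1)
proof (induction I rule: finite_induct)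
  case empty
  show ?case by (simp add: hardy2_zero)
next
  case (insert i I)
  thus ?case using hardy2_add[of "f i" "\<lambda>z. \<Sum>i\<in>I. f i z"] by fastforce
qed

text \<open>Completeness of the Hardy space in the form that the Neumann series uses. Point
  evaluations turn the norm bounds into locally uniform convergence, and the bound on the means
  passes to the limit at each radius.\<close>

lemma hardy2_series:
  fixes g :: "nat \<Rightarrow> complex ^ 'n \<Rightarrow> complex"
  assumes g: "\<And>n. g n \<in> hardy2" and le: "\<And>n. hardy2_norm (g n) \<le> M n" and M: "summable M"
  shows "summable (\<lambda>n. g n z)" "(\<lambda>z. \<Sum>n. g n z) \<in> hardy2"
    "hardy2_norm (\<lambda>z. \<Sum>n. g n z) \<le> suminf M"
proof -
  have M0: "0 \<le> M n" for n using hardy2_norm_nonneg[OF g[of n]] le[of n] by linarith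
  have bg: "ball_hol (g n)" for n using g by (rule hardy2_ball_hol)
  have C: "\<exists>C. \<forall>n z. norm z \<le> \<rho> \<longrightarrow> cmod (g n z) \<le> C * M n" if \<rho>1: "\<rho> < 1" for \<rho>
  proof -
    obtain C where C: "0 < C" "\<And>f z. (f :: complex ^ 'n \<Rightarrow> complex) \<in> hardy2 \<Longrightarrow> norm z \<le> \<rho> \<Longrightarrow> cmod (f z) \<le> C * hardy2_norm f"
      using hardy2_point_evaluation[OF \<rho>1] by blast
    have "cmod (g n z) \<le> C * M n" if "norm z \<le> \<rho>" for n z
      using C(2)[OF g that, of n] mult_left_mono[OF le[of n], of C] C(1) by linarith
    thus ?thesis by blast
  qed
  have summ: "summable (\<lambda>n. g n z)" for z
  proof (cases "norm z < 1")
    case True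
    then obtain C where C: "\<And>n y. norm y \<le> norm z \<Longrightarrow> cmod (g n y) \<le> C * M n" using C by blast
    show ?thesis
      by (rule summable_norm_cancel, rule summable_comparison_test'[OF summable_mult[OF M, of C]])
         (use C in auto)
  next
    case False
    thus ?thesis using bg by (simp add: ball_hol_def)
  qed
  thus "summable (\<lambda>n. g n z)" .
  have bh: "ball_hol (\<lambda>z. \<Sum>n. g n z)"
    unfolding ball_hol_def using hardy2_series_holomorphic[OF bg C M M0] bg by (simp add: ball_hol_def)
  have sM: "0 \<le> suminf M" by (intro suminf_nonneg M M0)
  have "square_mean (\<lambda>z. \<Sum>n. g n z) r \<le> (suminf M)\<^sup>2" if r: "0 < r" "r < 1" for r
  proof -
    define S where "S N z = (\<Sum>n<N. g n z)" for N z
    have S: "S N \<in> hardy2" "hardy2_norm (S N) \<le> suminf M" for N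
    proof -
      have "S N \<in> hardy2" "hardy2_norm (S N) \<le> (\<Sum>n<N. hardy2_norm (g n))"
        unfolding S_def using hardy2_sum[of "{..<N}" g] g by auto
      moreover have "(\<Sum>n<N. hardy2_norm (g n)) \<le> (\<Sum>n<N. M n)" by (intro sum_mono le)
      moreover have "(\<Sum>n<N. M n) \<le> suminf M" by (intro sum_le_suminf M) (auto simp: M0)
      ultimately show "S N \<in> hardy2" "hardy2_norm (S N) \<le> suminf M" by auto
    qed
    obtain C where C: "\<And>n y. norm y \<le> r \<Longrightarrow> cmod (g n y) \<le> C * M n" using C[OF r(2)] by blast
    define K where "K = (\<Sum>n. C * M n)"
    have sCM: "summable (\<lambda>n. C * M n)" by (intro summable_mult M)
    have CM0: "0 \<le> C * M n" for n
      by (rule order_trans[OF norm_ge_zero[of "g n 0"] C]) (use r in simp)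
    have SK: "cmod (S N y) \<le> K" if "norm y \<le> r" for N y
    proof -
      have "cmod (S N y) \<le> (\<Sum>n<N. C * M n)" unfolding S_def by (rule sum_norm_le) (rule C[OF that])
      also have "\<dots> \<le> K" unfolding K_def by (intro sum_le_suminf sCM) (auto simp: CM0)
      finally show ?thesis .
    qed
    note [measurable] = ball_hol_measurable[OF bh] ball_hol_measurable[OF hardy2_ball_hol[OF S(1)]]
    have "(\<lambda>N. square_mean (S N) r) \<longlonglongrightarrow> square_mean (\<lambda>z. \<Sum>n. g n z) r"
      unfolding square_mean_def
    proof (rule integral_dominated_convergence[where w = "\<lambda>_. K\<^sup>2"])
      show "AE \<zeta> in sphere_measure. (\<lambda>N. (cmod (S N (r *\<^sub>R \<zeta>)))\<^sup>2) \<longlonglongrightarrow> (cmod (\<Sum>n. g n (r *\<^sub>R \<zeta>)))\<^sup>2"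
        unfolding S_def by (intro AE_I2 tendsto_intros summable_LIMSEQ summ)
      show "AE \<zeta> in sphere_measure. norm ((cmod (S N (r *\<^sub>R \<zeta>)))\<^sup>2) \<le> K\<^sup>2" for N
        using AE_sphere_norm by eventually_elim (use r in \<open>auto intro!: power_mono SK\<close>)
    qed simp_all
    moreover have "square_mean (S N) r \<le> (suminf M)\<^sup>2" for N
      using square_mean_le_norm[OF S(1) r, of N] power_mono[OF S(2)[of N] hardy2_norm_nonneg[OF S(1)[of N]], of 2]
      by linarith
    ultimately show ?thesis by (intro tendsto_upperbound[of _ _ sequentially]) auto
  qed
  from hardy2I[OF bh this sM] show "(\<lambda>z. \<Sum>n. g n z) \<in> hardy2" "hardy2_norm (\<lambda>z. \<Sum>n. g n z) \<le> suminf M"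
    by auto
qed


section \<open>Bounded composition operators and the resolvent\<close>

lemma comp_op_add: "comp_op \<phi> (f + g) = comp_op \<phi> f + comp_op \<phi> g"
  by (auto simp: comp_op_def)

lemma comp_op_cscale: "comp_op \<phi> (cscale c f) = cscale c (comp_op \<phi> f)"
  by (auto simp: comp_op_def cscale_def)

lemma hardy2_plus: "f \<in> hardy2 \<Longrightarrow> g \<in> hardy2 \<Longrightarrow> f + g \<in> hardy2"
  using hardy2_add(1)[of f g] by (simp add: plus_fun_def)

lemma hardy2_minus: "f \<in> hardy2 \<Longrightarrow> g \<in> hardy2 \<Longrightarrow> f - g \<in> hardy2"
  using hardy2_diff(1)[of f g] by (simp add: fun_diff_def)

lemma hardy2_norm_minus: "f \<in> hardy2 \<Longrightarrow> g \<in> hardy2 \<Longrightarrow> hardy2_norm (f - g) \<le> hardy2_norm f + hardy2_norm g"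
  using hardy2_diff(2)[of f g] by (simp add: fun_diff_def)

lemma hardy2_cscale: "f \<in> hardy2 \<Longrightarrow> cscale c f \<in> hardy2"
  unfolding cscale_def by (rule hardy2_cmult_le)

lemma hardy2_norm_cscale: "f \<in> hardy2 \<Longrightarrow> hardy2_norm (cscale c f) = cmod c * hardy2_norm f"
  unfolding cscale_def by (rule hardy2_norm_cmult)

lemma bounded_op_comp_op_minus:
  fixes \<phi> :: "complex ^ 'n \<Rightarrow> complex ^ 'n"
  assumes T: "\<And>F. F \<in> hardy2 \<Longrightarrow> comp_op \<phi> F \<in> hardy2"
    and K: "\<And>F. F \<in> hardy2 \<Longrightarrow> hardy2_norm (comp_op \<phi> F) \<le> K * hardy2_norm F"
  shows "bounded_op hardy2 hardy2_norm (\<lambda>f. comp_op \<phi> f - cscale \<mu> f)"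
  unfolding bounded_op_def
proof (intro conjI ballI allI)
  show "comp_op \<phi> f - cscale \<mu> f \<in> hardy2" if "f \<in> hardy2" for f
    by (intro hardy2_minus T that hardy2_cscale)
  show "comp_op \<phi> (f + g) - cscale \<mu> (f + g) = (comp_op \<phi> f - cscale \<mu> f) + (comp_op \<phi> g - cscale \<mu> g)" for f g
    unfolding comp_op_add by (auto simp: cscale_def algebra_simps)
  show "comp_op \<phi> (cscale c f) - cscale \<mu> (cscale c f) = cscale c (comp_op \<phi> f - cscale \<mu> f)" for c f
    unfolding comp_op_cscale by (auto simp: cscale_def algebra_simps)
  show "\<exists>K. \<forall>f\<in>hardy2. hardy2_norm (comp_op \<phi> f - cscale \<mu> f) \<le> K * hardy2_norm f"
  proof (intro exI ballI)
    fix f :: "complex ^ 'n \<Rightarrow> complex" assume f: "f \<in> hardy2"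
    have "hardy2_norm (comp_op \<phi> f - cscale \<mu> f) \<le> hardy2_norm (comp_op \<phi> f) + hardy2_norm (cscale \<mu> f)"
      by (intro hardy2_norm_minus T f hardy2_cscale)
    thus "hardy2_norm (comp_op \<phi> f - cscale \<mu> f) \<le> (K + cmod \<mu>) * hardy2_norm f"
      using K[OF f] by (simp add: hardy2_norm_cscale f algebra_simps)
  qed
qed

text \<open>The Neumann series. The hypothesis bounds all powers up to a factor \<open>K\<close>,
  because the operator is bounded by \<open>R\<close> in an equivalent norm and not in
  \<open>hardy2_norm\<close> itself.\<close>

lemma invertible_comp_op_minus:
  fixes \<phi> :: "complex ^ 'n \<Rightarrow> complex ^ 'n"
  assumes maps: "\<phi> ` ball 0 1 \<subseteq> ball 0 1"
    and T: "\<And>F. F \<in> hardy2 \<Longrightarrow> comp_op \<phi> F \<in> hardy2"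
    and K: "\<And>F n. F \<in> hardy2 \<Longrightarrow> hardy2_norm ((comp_op \<phi> ^^ n) F) \<le> K * R ^ n * hardy2_norm F"
    and R: "0 \<le> R" "R < cmod \<mu>"
  shows "invertible_op hardy2 hardy2_norm (\<lambda>f. comp_op \<phi> f - cscale \<mu> f)"
proof -
  let ?T = "comp_op \<phi>"
  have \<mu>: "\<mu> \<noteq> 0" "0 < cmod \<mu>" using R by auto
  have Tn: "(?T ^^ n) F \<in> hardy2" if "F \<in> hardy2" for n F
    by (induction n) (auto intro: T that)
  have Tn_add: "(?T ^^ n) (f + g) = (?T ^^ n) f + (?T ^^ n) g" for n f g
    by (induction n) (simp_all only: funpow.simps comp_apply id_apply comp_op_add)
  have Tn_cscale: "(?T ^^ n) (cscale c f) = cscale c ((?T ^^ n) f)" for n c f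
    by (induction n) (simp_all only: funpow.simps comp_apply id_apply comp_op_cscale)
  \<comment> \<open>The terms of the Neumann series for the inverse of the operator minus
    \<open>\<mu>\<close>.\<close>
  define t where "t F n z = (- (inverse \<mu> ^ Suc n)) * (?T ^^ n) F z" for F n z
  define M where "M F n = K * hardy2_norm F / cmod \<mu> * (R / cmod \<mu>) ^ n" for F :: "complex ^ 'n \<Rightarrow> complex" and n
  have tM: "t F n \<in> hardy2" "hardy2_norm (t F n) \<le> M F n" if F: "F \<in> hardy2" for F n
  proof -
    show "t F n \<in> hardy2" unfolding t_def by (rule hardy2_cmult_le(1)[OF Tn[OF F]])
    have "hardy2_norm (t F n) = cmod (- (inverse \<mu> ^ Suc n)) * hardy2_norm ((?T ^^ n) F)"
      unfolding t_def by (rule hardy2_norm_cmult[OF Tn[OF F]])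
    also have "\<dots> \<le> cmod (- (inverse \<mu> ^ Suc n)) * (K * R ^ n * hardy2_norm F)"
      by (intro mult_left_mono K F) auto
    also have "cmod (- (inverse \<mu> ^ Suc n)) = inverse (cmod \<mu>) ^ Suc n"
      by (simp only: norm_minus_cancel norm_power norm_inverse)
    also have "\<dots> * (K * R ^ n * hardy2_norm F) = M F n"
      by (simp add: M_def divide_inverse power_mult_distrib mult_ac)
    finally show "hardy2_norm (t F n) \<le> M F n" .
  qed
  have sM: "summable (M F)" for F
    unfolding M_def using R \<mu> by (intro summable_mult summable_geometric) (simp add: norm_divide)
  define S where "S F z = (\<Sum>n. t F n z)" for F z
  have S: "S F \<in> hardy2" "hardy2_norm (S F) \<le> suminf (M F)" "summable (\<lambda>n. t F n z)" if "F \<in> hardy2" for F z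
    unfolding S_def using hardy2_series[of "t F" "M F", OF tM(1)[OF that] tM(2)[OF that] sM] by auto
  have bS: "bounded_op hardy2 hardy2_norm S"
    unfolding bounded_op_def
  proof (intro conjI ballI allI)
    show "S f \<in> hardy2" if "f \<in> hardy2" for f by (rule S[OF that])
    show "S (f + g) = S f + S g" if "f \<in> hardy2" "g \<in> hardy2" for f g
    proof
      fix z
      have "t (f + g) n z = t f n z + t g n z" for n by (simp add: t_def Tn_add algebra_simps)
      thus "S (f + g) z = (S f + S g) z"
        unfolding S_def by (simp add: suminf_add S(3) that)
    qed
    show "S (cscale c f) = cscale c (S f)" if "f \<in> hardy2" for c f
    proof
      fix z
      have "t (cscale c f) n z = c * t f n z" for n
        unfolding t_def Tn_cscale by (simp add: cscale_def)
      hence "S (cscale c f) z = c * S f z"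
        unfolding S_def by (simp add: suminf_mult S(3) that)
      thus "S (cscale c f) z = cscale c (S f) z" by (simp add: cscale_def)
    qed
    show "\<exists>K. \<forall>f\<in>hardy2. hardy2_norm (S f) \<le> K * hardy2_norm f"
    proof (intro exI ballI)
      fix f :: "complex ^ 'n \<Rightarrow> complex" assume f: "f \<in> hardy2"
      have "M f = (\<lambda>n. (K / cmod \<mu> * (R / cmod \<mu>) ^ n) * hardy2_norm f)" by (auto simp: M_def)
      moreover have "summable (\<lambda>n. K / cmod \<mu> * (R / cmod \<mu>) ^ n)"
        using R \<mu> by (intro summable_mult summable_geometric) (simp add: norm_divide)
      ultimately have "suminf (M f) = (\<Sum>n. K / cmod \<mu> * (R / cmod \<mu>) ^ n) * hardy2_norm f"
        by (simp only: suminf_mult2)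
      thus "hardy2_norm (S f) \<le> (\<Sum>n. K / cmod \<mu> * (R / cmod \<mu>) ^ n) * hardy2_norm f"
        using S(2)[OF f] by simp
    qed
  qed
  \<comment> \<open>Telescoping: composing with the map shifts the series by one term, up to the
    factor \<open>\<mu>\<close>, and the missing first term is \<open>F\<close>.\<close>
  have key: "(\<Sum>n. - (inverse \<mu> ^ Suc n) * (?T ^^ Suc n) F z) - \<mu> * S F z = F z" if F: "F \<in> hardy2" for F z
  proof -
    have eq: "- (inverse \<mu> ^ Suc n) * (?T ^^ Suc n) F z = \<mu> * t F (Suc n) z" for n
      using \<mu> by (simp add: t_def)
    have "(\<Sum>n. t F (Suc n) z) = S F z - t F 0 z"
      unfolding S_def by (rule suminf_split_head[OF S(3)[OF F]])
    moreover have "summable (\<lambda>n. t F (Suc n) z)"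
      using summable_ignore_initial_segment[OF S(3)[OF F], of 1] by simp
    ultimately have "(\<Sum>n. - (inverse \<mu> ^ Suc n) * (?T ^^ Suc n) F z) = \<mu> * (S F z - t F 0 z)"
      unfolding eq by (simp add: suminf_mult)
    thus ?thesis using \<mu> by (simp add: t_def algebra_simps)
  qed
  have ST: "S (?T F - cscale \<mu> F) = F" if F: "F \<in> hardy2" for F
  proof
    fix z
    \<comment> \<open>Written as a sum so that additivity and homogeneity of \<open>S\<close>
      apply.\<close>
    have a1: "?T F - cscale \<mu> F = ?T F + cscale (- \<mu>) F" by (auto simp: cscale_def)
    have a2: "S (?T F + cscale (- \<mu>) F) = S (?T F) + cscale (- \<mu>) (S F)"
      using bS F T[OF F] hardy2_cscale[OF F] unfolding bounded_op_def by metis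
    have "S (?T F) z = (\<Sum>n. - (inverse \<mu> ^ Suc n) * (?T ^^ Suc n) F z)"
      unfolding S_def t_def by (simp add: funpow_swap1)
    moreover have "S (?T F - cscale \<mu> F) z = S (?T F) z - \<mu> * S F z"
      unfolding a1 a2 by (simp add: cscale_def)
    ultimately show "S (?T F - cscale \<mu> F) z = F z" using key[OF F, of z] by simp
  qed
  have TS: "?T (S F) - cscale \<mu> (S F) = F" if F: "F \<in> hardy2" for F
  proof
    fix z
    have "?T (S F) z = (\<Sum>n. - (inverse \<mu> ^ Suc n) * (?T ^^ Suc n) F z)"
    proof (cases "z \<in> ball 0 1")
      case True
      thus ?thesis by (simp add: comp_op_def S_def t_def)
    next
      case False
      thus ?thesis by (simp add: comp_op_def)
    qed
    thus "(?T (S F) - cscale \<mu> (S F)) z = F z" using key[OF F, of z] by (simp add: cscale_def)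
  qed
  have "bounded_op hardy2 hardy2_norm (\<lambda>f. ?T f - cscale \<mu> f)"
    by (rule bounded_op_comp_op_minus[where K = "K * R", OF T]) (use K[of _ 1] in auto)
  thus ?thesis unfolding invertible_op_def using bS ST TS by blast
qed

context hyperbolic_lf begin

definition v\<^sub>0 where
  "v\<^sub>0 = (SOME v. norm v < 1 \<and>
    (\<forall>z. norm z \<le> 1 \<longrightarrow> (1 - cinner (lin_frac A B C d z) v) * Q z 1 = \<kappa> * (1 - cinner z v)))"

lemma v\<^sub>0: "norm v\<^sub>0 < 1"
  "norm z \<le> 1 \<Longrightarrow> (1 - cinner (lin_frac A B C d z) v\<^sub>0) * Q z 1 = \<kappa> * (1 - cinner z v\<^sub>0)"
proof -
  have "\<exists>v. norm v < 1 \<and>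
    (\<forall>z. norm z \<le> 1 \<longrightarrow> (1 - cinner (lin_frac A B C d z) v) * Q z 1 = \<kappa> * (1 - cinner z v))"
    using affine_eigenfunction by metis
  from someI_ex[OF this] show "norm v\<^sub>0 < 1"
    "norm z \<le> 1 \<Longrightarrow> (1 - cinner (lin_frac A B C d z) v\<^sub>0) * Q z 1 = \<kappa> * (1 - cinner z v\<^sub>0)"
    unfolding v\<^sub>0_def by blast+
qed

definition aff where "aff z = 1 - cinner z v\<^sub>0"

lemma aff_bounds:
  assumes "norm z \<le> 1"
  shows "1 - norm v\<^sub>0 \<le> Re (aff z)" "1 - norm v\<^sub>0 \<le> cmod (aff z)" "cmod (aff z) \<le> 2" "aff z \<noteq> 0"
proof -
  have "cmod (cinner z v\<^sub>0) \<le> 1 * norm v\<^sub>0"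
    using order_trans[OF cmod_cinner_le mult_right_mono[OF assms norm_ge_zero]] .
  hence c: "cmod (cinner z v\<^sub>0) \<le> norm v\<^sub>0" by simp
  show r: "1 - norm v\<^sub>0 \<le> Re (aff z)" using complex_Re_le_cmod[of "cinner z v\<^sub>0"] c by (simp add: aff_def)
  thus m: "1 - norm v\<^sub>0 \<le> cmod (aff z)" using complex_Re_le_cmod[of "aff z"] by linarith
  show "cmod (aff z) \<le> 2" using norm_triangle_ineq4[of 1 "cinner z v\<^sub>0"] c v\<^sub>0(1) by (simp add: aff_def)
  show "aff z \<noteq> 0" using m v\<^sub>0(1) by auto
qed

abbreviation \<phi> where "\<phi> \<equiv> lin_frac A B C d"

lemma \<phi>_maps: "\<phi> ` ball 0 1 \<subseteq> ball 0 1"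
  using maps by blast

lemma \<phi>_holomorphic: "holomorphic_map_on \<phi> (ball 0 1)"
  by (rule holomorphic_lin_frac) (rule den)

lemma ball_hol_comp_op: "ball_hol F \<Longrightarrow> ball_hol (comp_op \<phi> F)"
  unfolding comp_op_def
  by (rule ball_hol_cut, rule holomorphic_fun_on_compose_map[OF _ \<phi>_holomorphic open_ball open_ball \<phi>_maps])
     (simp add: ball_hol_def)

text \<open>\<open>hardy2_norm (wt F)\<close> is an equivalent norm, since \<open>aff\<close> is
  bounded and bounded away from 0 on the ball. In it the composition operator has norm at most
  \<open>R\<close>.\<close>

definition wt where "wt F = (\<lambda>z. if z \<in> ball 0 1 then inverse (aff z) ^ CARD('n) * F z else 0)"

lemma ball_hol_wt: "ball_hol F \<Longrightarrow> ball_hol (wt F)"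
  unfolding wt_def aff_def
  by (rule ball_hol_cut, intro holomorphic_fun_intros)
     (use aff_bounds(4) in \<open>auto simp: ball_hol_def aff_def\<close>)

lemma wt_hardy2:
  assumes "F \<in> hardy2"
  shows "wt F \<in> hardy2" "hardy2_norm (wt F) \<le> (1 / (1 - norm v\<^sub>0)) ^ CARD('n) * hardy2_norm F"
proof -
  have le: "cmod (wt F z) \<le> (1 / (1 - norm v\<^sub>0)) ^ CARD('n) * cmod (F z)" if "norm z < 1" for z
  proof -
    have "inverse (cmod (aff z)) \<le> 1 / (1 - norm v\<^sub>0)"
      using aff_bounds(2)[of z] that v\<^sub>0(1) by (simp add: inverse_eq_divide frac_le)
    thus ?thesis using that by (simp add: wt_def norm_mult norm_power norm_inverse power_mono mult_right_mono)
  qed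
  show "wt F \<in> hardy2" "hardy2_norm (wt F) \<le> (1 / (1 - norm v\<^sub>0)) ^ CARD('n) * hardy2_norm F"
    using hardy2_comparison[OF assms ball_hol_wt[OF hardy2_ball_hol[OF assms]] le] v\<^sub>0(1) by auto
qed

lemma wt_hardy2_converse:
  assumes "ball_hol F" "wt F \<in> hardy2"
  shows "F \<in> hardy2" "hardy2_norm F \<le> 2 ^ CARD('n) * hardy2_norm (wt F)"
proof -
  have le: "cmod (F z) \<le> 2 ^ CARD('n) * cmod (wt F z)" if "norm z < 1" for z
  proof -
    have "F z = aff z ^ CARD('n) * wt F z"
      using that aff_bounds(4)[of z] by (simp add: wt_def power_inverse)
    thus ?thesis
      using aff_bounds(3)[of z] that by (simp add: norm_mult norm_power power_mono mult_right_mono)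
  qed
  show "F \<in> hardy2" "hardy2_norm F \<le> 2 ^ CARD('n) * hardy2_norm (wt F)"
    using hardy2_comparison[OF assms(2,1) le] by auto
qed

definition R where "R = (1 / sqrt \<alpha>) ^ CARD('n)"

lemma R_eq: "R = \<alpha> powr (- real CARD('n) / 2)"
proof -
  have "R = (\<alpha> powr (-1/2)) ^ CARD('n)"
    using \<alpha> by (simp add: R_def powr_minus_divide powr_half_sqrt)
  also have "\<dots> = \<alpha> powr (- real CARD('n) / 2)"
    using \<alpha> by (simp add: powr_realpow[symmetric] powr_powr)
  finally show ?thesis .
qed

lemma R_pos: "0 < R"
  using \<alpha> by (simp add: R_def)

text \<open>The contraction estimate is applied to \<open>wt F\<close>. Because \<open>aff\<close>
  is an eigenfunction, the inverse of the normalised denominator turns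
  \<open>inverse (aff (\<phi> z))\<close> into \<open>u * inverse (aff z)\<close>. The estimate thus
  concerns \<open>u ^ N\<close> times \<open>wt (comp_op \<phi> F)\<close>, where
  \<open>cmod u = sqrt \<alpha>\<close>.\<close>

lemma wt_comp_op:
  assumes F: "F \<in> hardy2"
  shows "wt (comp_op \<phi> F) \<in> hardy2" "hardy2_norm (wt (comp_op \<phi> F)) \<le> R * hardy2_norm (wt F)"
proof -
  \<comment> \<open>Scaling all four coefficients does not change the map; this factor turns
    \<open>H_nonneg\<close> into the hypothesis \<open>psd\<close>.\<close>
  define k where "k = 1 / sqrt \<mu>"
  have k: "0 < k" using \<mu>_pos by (simp add: k_def)
  have k2: "k\<^sup>2 * \<mu> = 1" using \<mu>_pos by (simp add: k_def power_divide)
  define A' where "A' = (\<chi> i j. of_real k * A $ i $ j)"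
  define B' where "B' = of_real k *s B"
  define C' where "C' = of_real k *s C"
  define d' where "d' = of_real k * d"
  have Q': "cinner x C' + t * d' = of_real k * Q x t" for x t
    by (simp add: C'_def d'_def Q_def cinner_simps algebra_simps)
  have M': "A' *v x + t *s B' = of_real k *s M x t" for x t
    by (simp add: A'_def B'_def M_def vec_eq_iff matrix_vector_mult_def sum_distrib_left algebra_simps)
  have \<phi>': "lin_frac A' B' C' d' = \<phi>"
  proof
    fix z
    show "lin_frac A' B' C' d' z = \<phi> z"
      using Q'[of z 1] M'[of z 1] k by (simp add: lin_frac_eq) (simp add: lin_frac_def vector_smult_assoc)
  qed
  define u where "u = inverse (of_real k * \<kappa>)"
  have cu: "cmod u = sqrt \<alpha>"
  proof -
    have "cmod \<kappa> * k = 1 / sqrt \<alpha>" using \<kappa>0 by (simp add: k_def \<mu>_def real_sqrt_mult)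
    moreover have "cmod u = inverse (cmod \<kappa> * k)" using k by (simp add: u_def norm_inverse norm_mult mult.commute)
    ultimately show ?thesis by simp
  qed
  have le: "square_mean (\<lambda>z. u ^ CARD('n) * wt (comp_op \<phi> F) z) r \<le> (hardy2_norm (wt F))\<^sup>2"
    if r: "0 < r" "r < 1" for r
  proof (rule weighted_composition_square_mean_le[where A = A' and B = B' and C = C' and d = d'])
    show "cinner z C' + d' \<noteq> 0" if "z \<in> ball 0 1" for z
      using Q'[of z 1] Q_nonzero[of z] that k by simp
    show "lin_frac A' B' C' d' ` ball 0 1 \<subseteq> ball 0 1" unfolding \<phi>' by (rule \<phi>_maps)
    show "0 \<le> (cmod (cinner x C' + t * d'))\<^sup>2 - (norm (A' *v x + t *s B'))\<^sup>2 - (cmod t)\<^sup>2 + (norm x)\<^sup>2" for x t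
    proof -
      have "0 \<le> k\<^sup>2 * H x t" using H_nonneg by simp
      also have "\<dots> = k\<^sup>2 * (cmod (Q x t))\<^sup>2 - k\<^sup>2 * (norm (M x t))\<^sup>2 - (k\<^sup>2 * \<mu>) * ((cmod t)\<^sup>2 - (norm x)\<^sup>2)"
        by (simp add: H_def algebra_simps)
      finally show ?thesis unfolding Q' M' k2 by (simp add: norm_mult norm_smult power_mult_distrib)
    qed
    show "wt F \<in> hardy2" by (rule wt_hardy2[OF F])
    show "ball_hol (\<lambda>z. u ^ CARD('n) * wt (comp_op \<phi> F) z)"
      by (intro ball_hol_cmult ball_hol_wt ball_hol_comp_op hardy2_ball_hol F)
    fix z :: "complex ^ 'n" assume z: "z \<in> ball 0 1"
    hence z1: "norm z \<le> 1" by simp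
    have \<phi>z: "\<phi> z \<in> ball 0 1" using z by (rule maps)
    hence \<phi>z1: "norm (\<phi> z) \<le> 1" by simp
    have "aff (\<phi> z) * Q z 1 = \<kappa> * aff z" using v\<^sub>0(2)[OF z1] by (simp add: aff_def)
    hence "u * inverse (aff z) = inverse (of_real k * Q z 1) * inverse (aff (\<phi> z))"
      using k \<kappa>0 Q_nonzero[OF z1] aff_bounds(4)[OF z1] aff_bounds(4)[OF \<phi>z1] by (simp add: u_def field_simps)
    hence "u ^ CARD('n) * inverse (aff z) ^ CARD('n) = inverse (of_real k * Q z 1) ^ CARD('n) * inverse (aff (\<phi> z)) ^ CARD('n)"
      by (metis power_mult_distrib)
    thus "u ^ CARD('n) * wt (comp_op \<phi> F) z = inverse (cinner z C' + d') ^ CARD('n) * wt F (lin_frac A' B' C' d' z)"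
      using z \<phi>z Q'[of z 1] unfolding \<phi>' by (simp add: wt_def comp_op_def mult.assoc[symmetric])
  qed (use r in auto)
  have bw: "ball_hol (wt (comp_op \<phi> F))" by (intro ball_hol_wt ball_hol_comp_op hardy2_ball_hol F)
  have "square_mean (wt (comp_op \<phi> F)) r \<le> (R * hardy2_norm (wt F))\<^sup>2" if r: "0 < r" "r < 1" for r
  proof -
    have "(sqrt \<alpha> ^ CARD('n))\<^sup>2 * square_mean (wt (comp_op \<phi> F)) r \<le> (hardy2_norm (wt F))\<^sup>2"
      using le[OF r] unfolding square_mean_cmult norm_power cu .
    moreover have "R * sqrt \<alpha> ^ CARD('n) = 1" using \<alpha> by (simp add: R_def power_mult_distrib[symmetric])
    hence "R\<^sup>2 * (sqrt \<alpha> ^ CARD('n))\<^sup>2 = 1" by (simp add: power_mult_distrib[symmetric])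
    ultimately show ?thesis
      using mult_left_mono[of _ _ "R\<^sup>2"] by (fastforce simp: power_mult_distrib mult.assoc[symmetric])
  qed
  from hardy2I[OF bw this] R_pos hardy2_norm_nonneg[OF wt_hardy2(1)[OF F]]
  show "wt (comp_op \<phi> F) \<in> hardy2" "hardy2_norm (wt (comp_op \<phi> F)) \<le> R * hardy2_norm (wt F)" by auto
qed

lemma comp_op_hardy2: "F \<in> hardy2 \<Longrightarrow> comp_op \<phi> F \<in> hardy2"
  using wt_hardy2_converse(1)[OF ball_hol_comp_op[OF hardy2_ball_hol] wt_comp_op(1)] .

definition power_const where "power_const = 2 ^ CARD('n) * (1 / (1 - norm v\<^sub>0)) ^ CARD('n)"

text \<open>The iteration takes place in the weighted norm, so the cost of changing norms arises
  once and not at every step.\<close>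

lemma comp_op_power_le:
  assumes F: "F \<in> hardy2"
  shows "hardy2_norm ((comp_op \<phi> ^^ n) F) \<le> power_const * R ^ n * hardy2_norm F"
proof -
  have Fn: "(comp_op \<phi> ^^ n) F \<in> hardy2" for n by (induction n) (auto intro: comp_op_hardy2 F)
  have wn: "hardy2_norm (wt ((comp_op \<phi> ^^ n) F)) \<le> R ^ n * hardy2_norm (wt F)" for n
  proof (induction n)
    case (Suc n)
    have "hardy2_norm (wt ((comp_op \<phi> ^^ Suc n) F)) \<le> R * hardy2_norm (wt ((comp_op \<phi> ^^ n) F))"
      using wt_comp_op(2)[OF Fn[of n]] by simp
    also have "\<dots> \<le> R * (R ^ n * hardy2_norm (wt F))" using Suc R_pos by (intro mult_left_mono) auto
    finally show ?case by simp
  qed simp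
  have "hardy2_norm ((comp_op \<phi> ^^ n) F) \<le> 2 ^ CARD('n) * hardy2_norm (wt ((comp_op \<phi> ^^ n) F))"
    by (intro wt_hardy2_converse(2) hardy2_ball_hol wt_hardy2 Fn)
  also have "\<dots> \<le> 2 ^ CARD('n) * (R ^ n * hardy2_norm (wt F))" by (intro mult_left_mono wn) auto
  also have "\<dots> \<le> 2 ^ CARD('n) * (R ^ n * ((1 / (1 - norm v\<^sub>0)) ^ CARD('n) * hardy2_norm F))"
    using R_pos by (intro mult_left_mono wt_hardy2 F) auto
  finally show ?thesis by (simp add: power_const_def mult_ac)
qed

lemma invertible_outside:
  "R < cmod \<mu>' \<Longrightarrow> invertible_op hardy2 hardy2_norm (\<lambda>f. comp_op \<phi> f - cscale \<mu>' f)"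
  by (rule invertible_comp_op_minus[OF \<phi>_maps comp_op_hardy2 comp_op_power_le]) (use R_pos in auto)

end


section \<open>Eigenfunctions, their multiplicity and the spectra\<close>

section \<open>Negative powers in the Hardy space\<close>

lemma power_series_coeff_unique:
  fixes a b :: "nat \<Rightarrow> complex"
  assumes s: "0 < s"
    and a: "\<And>u. cmod u < s \<Longrightarrow> (\<lambda>k. a k * u ^ k) sums f u"
    and b: "\<And>u. cmod u < s \<Longrightarrow> (\<lambda>k. b k * u ^ k) sums f u"
  shows "a k = b k"
proof (induction k rule: less_induct)
  case (less k)
  define F where "F u = (f u - (\<Sum>j<k. a j * u ^ j)) / u ^ k" for u
  have eq: "(\<Sum>j<k. b j * u ^ j) = (\<Sum>j<k. a j * u ^ j)" for u using less by simp
  have shift: "(\<lambda>n. c (n + k) * u ^ n) sums F u"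
    if "u \<noteq> 0" and c: "(\<lambda>k. c k * u ^ k) sums f u" and "(\<Sum>j<k. c j * u ^ j) = (\<Sum>j<k. a j * u ^ j)" for c u
  proof -
    have "(\<lambda>n. c (n + k) * u ^ (n + k)) sums (f u - (\<Sum>j<k. a j * u ^ j))"
      using sums_split_initial_segment[OF c, of k] that(3) by simp
    from sums_divide[OF this, of "u ^ k"] show ?thesis using that(1) by (simp add: F_def power_add)
  qed
  have "(F \<longlongrightarrow> a (0 + k)) (at 0)"
    by (rule powser_limit_0_strong[OF s]) (auto intro: shift a)
  moreover have "(F \<longlongrightarrow> b (0 + k)) (at 0)"
    by (rule powser_limit_0_strong[OF s]) (auto intro: shift b simp: eq)
  ultimately have "a (0 + k) = b (0 + k)" by (rule tendsto_unique[OF at_neq_bot])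
  thus ?case by simp
qed

text \<open>Raabe's test: its quantity tends to \<open>N + 1 - 2 * a\<close>, which exceeds 1
  exactly when \<open>a < N / 2\<close>. This is where the critical exponent comes from.\<close>

lemma summable_binomial_ratio:
  fixes a :: real
  assumes a: "0 < a" "a < real N / 2"
  shows "summable (\<lambda>k. \<bar>(- a) gchoose k\<bar>\<^sup>2 / real (N + k - 1 choose k))"
proof (rule raabes_test_convergence)
  define t where "t k = \<bar>(- a) gchoose k\<bar>\<^sup>2 / real (N + k - 1 choose k)" for k
  have N: "N > 0" using a by (cases N) auto
  have g0: "(- a) gchoose k \<noteq> 0" for k
  proof -
    have "((- a) gchoose k) = (\<Prod>i<k. - a - real i) / fact k" by (simp add: gbinomial_prod_rev atLeast0LessThan)
    moreover have "(\<Prod>i<k. - a - real i) \<noteq> 0"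
    proof -
      have "- a - real i \<noteq> 0" for i using a by auto
      thus ?thesis by simp
    qed
    ultimately show ?thesis by simp
  qed
  have c0: "0 < (N + k - 1 choose k)" for k using N by (simp add: zero_less_binomial)
  have pos: "0 < t k" for k using g0[of k] c0[of k] by (simp add: t_def)
  thus "\<forall>\<^sub>F k in sequentially. 0 < t k" by simp
  have ratio: "t k / t (Suc k) = (real k + 1) * (real N + real k) / (a + real k)\<^sup>2" for k
  proof -
    have "((- a) gchoose Suc k) * (real k + 1) = ((- a) gchoose k) * (- (a + real k))"
      using gbinomial_mult_1[of "- a" k] by (simp add: algebra_simps)
    hence "\<bar>(- a) gchoose Suc k\<bar> * \<bar>real k + 1\<bar> = \<bar>(- a) gchoose k\<bar> * \<bar>- (a + real k)\<bar>"
      by (simp only: flip: abs_mult)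
    hence "\<bar>(- a) gchoose Suc k\<bar> * (real k + 1) = \<bar>(- a) gchoose k\<bar> * (a + real k)"
      using a by simp
    hence g: "\<bar>(- a) gchoose Suc k\<bar> = \<bar>(- a) gchoose k\<bar> * (a + real k) / (real k + 1)"
      by (simp add: field_simps add_pos_nonneg)
    have "Suc k * (Suc (N + k - 1) choose Suc k) = Suc (N + k - 1) * (N + k - 1 choose k)"
      by (rule Suc_times_binomial)
    moreover have "Suc (N + k - 1) = N + k" "N + Suc k - 1 = N + k" using N by auto
    ultimately have "real (Suc k) * real (N + Suc k - 1 choose Suc k) = real (N + k) * real (N + k - 1 choose k)"
      by (metis of_nat_mult)
    hence c: "real (N + Suc k - 1 choose Suc k) = (real N + real k) * real (N + k - 1 choose k) / (real k + 1)"
      by (simp add: field_simps)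
    have nz: "real k + 1 \<noteq> 0" "a + real k \<noteq> 0" "real N + real k \<noteq> 0" using a N by (auto simp: add_pos_nonneg)
    have alg: "(G\<^sup>2 / e) / ((G * x / y)\<^sup>2 / (n * e / y)) = y * n / x\<^sup>2"
      if "G \<noteq> 0" "e \<noteq> 0" "x \<noteq> 0" "y \<noteq> 0" "n \<noteq> 0" for G e x y n :: real
      using that by (simp add: field_simps power2_eq_square)
    have "\<bar>(- a) gchoose k\<bar> \<noteq> 0" "real (N + k - 1 choose k) \<noteq> 0" using g0[of k] c0[of k] by auto
    from alg[OF this nz(2,1,3)] show ?thesis unfolding t_def g c .
  qed
  have "(\<lambda>k. real k * (t k / t (Suc k) - 1)) \<longlonglongrightarrow> real N + 1 - 2 * a"
    unfolding ratio by real_asymp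
  hence "liminf (\<lambda>k. ereal (real k * (t k / t (Suc k) - 1))) = ereal (real N + 1 - 2 * a)"
    by (intro lim_imp_Liminf) auto
  moreover have "1 < real N + 1 - 2 * a" using a by simp
  ultimately show "1 < liminf (\<lambda>k. ereal (real k * (t k / t (Suc k) - 1)))" by simp
qed

text \<open>The slice coefficients are binomial coefficients times powers of
  \<open>cinner \<zeta> \<tau>\<close>, so the sphere moments turn the squared norm into the series
  of the previous lemma.\<close>

lemma negative_power_hardy2:
  fixes \<tau> :: "complex ^ 'n"
  assumes \<tau>: "norm \<tau> = 1" and a: "0 < a" "a < real CARD('n) / 2"
  shows "(\<lambda>z. if z \<in> ball 0 1 then exp (- of_real a * Ln (1 - cinner z \<tau>)) else 0) \<in> hardy2"
proof -
  let ?P = "\<lambda>z :: complex ^ 'n. if z \<in> ball 0 1 then exp (- of_real a * Ln (1 - cinner z \<tau>)) else 0"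
  let ?N = "CARD('n)"
  have cle: "cmod (cinner z \<tau>) \<le> norm z" for z using cmod_cinner_le[of z \<tau>] \<tau> by simp
  have re: "0 < Re (1 - cinner z \<tau>)" if "z \<in> ball 0 1" for z
    using complex_Re_le_cmod[of "cinner z \<tau>"] cle[of z] that by simp
  have "holomorphic_fun_on (\<lambda>z. exp (- of_real a * Ln (1 - cinner z \<tau>))) (ball 0 1)"
  proof (rule holomorphic_fun_on_compose_complex[where g = "\<lambda>w. exp (- of_real a * Ln w)" and T = "- \<real>\<^sub>\<le>\<^sub>0"])
    show "holomorphic_fun_on (\<lambda>z. 1 - cinner z \<tau>) (ball 0 1)" by (intro holomorphic_fun_intros)
    show "(\<lambda>w. exp (- of_real a * Ln w)) holomorphic_on - \<real>\<^sub>\<le>\<^sub>0" by (auto intro!: holomorphic_intros)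
    show "(\<lambda>z. 1 - cinner z \<tau>) ` ball 0 1 \<subseteq> - \<real>\<^sub>\<le>\<^sub>0"
      using re by (fastforce simp: complex_nonpos_Reals_iff)
  qed auto
  hence bP: "ball_hol ?P" by (rule ball_hol_cut)
  define b where "b k = (complex_of_real (- a) gchoose k) * (- 1) ^ k" for k
  have sl: "slice_coeff ?P k \<zeta> = b k * cinner \<zeta> \<tau> ^ k" if \<zeta>: "norm \<zeta> \<le> 1" for k \<zeta>
  proof (rule power_series_coeff_unique[OF zero_less_one, where f = "\<lambda>u. ?P (u *s \<zeta>)"])
    fix u :: complex assume u: "cmod u < 1"
    have u\<zeta>: "cmod u * norm \<zeta> < 1" using u \<zeta> mult_left_le[of "norm \<zeta>" "cmod u"] by simp
    show "(\<lambda>k. slice_coeff ?P k \<zeta> * u ^ k) sums ?P (u *s \<zeta>)" by (rule slice_sums[OF bP u\<zeta>])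
    define w where "w = u * cinner \<zeta> \<tau>"
    have "cmod w \<le> cmod u * norm \<zeta>" unfolding w_def norm_mult by (intro mult_left_mono cle) simp
    hence w1: "cmod (- w) < 1" using u\<zeta> by simp
    have "(\<lambda>k. (complex_of_real (- a) gchoose k) * (- w) ^ k) sums (1 + (- w)) powr of_real (- a)"
      by (rule gen_binomial_complex[OF w1])
    moreover have "(complex_of_real (- a) gchoose k) * (- w) ^ k = b k * cinner \<zeta> \<tau> ^ k * u ^ k" for k
      unfolding b_def w_def power_minus[of "u * cinner \<zeta> \<tau>"] by (simp add: power_mult_distrib mult_ac)
    moreover have "(1 + (- w)) powr of_real (- a) = ?P (u *s \<zeta>)"
    proof -
      have "1 - w \<noteq> 0" using w1 by auto
      thus ?thesis using u\<zeta> by (simp add: powr_def w_def cinner_simps norm_smult)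
    qed
    ultimately show "(\<lambda>k. b k * cinner \<zeta> \<tau> ^ k * u ^ k) sums ?P (u *s \<zeta>)" by simp
  qed
  have csq: "coeff_sq ?P k = (cmod (b k))\<^sup>2 * sphere_moment \<tau> k" for k
  proof -
    have "coeff_sq ?P k = (\<integral>\<zeta>. (cmod (b k))\<^sup>2 * cmod (cinner \<zeta> \<tau>) ^ (2 * k) \<partial>sphere_measure)"
      unfolding coeff_sq_def
    proof (rule integral_cong_AE)
      note [measurable] = slice_coeff_measurable[OF bP]
      show "(\<lambda>\<zeta>. (cmod (slice_coeff ?P k \<zeta>))\<^sup>2) \<in> borel_measurable sphere_measure" by measurable
      show "AE \<zeta> in sphere_measure. (cmod (slice_coeff ?P k \<zeta>))\<^sup>2 = (cmod (b k))\<^sup>2 * cmod (cinner \<zeta> \<tau>) ^ (2 * k)"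
        using AE_sphere_norm
      proof eventually_elim
        case (elim \<zeta>)
        hence "norm \<zeta> \<le> 1" by simp
        thus ?case unfolding sl[OF \<open>norm \<zeta> \<le> 1\<close>]
          by (simp add: norm_mult norm_power power_mult_distrib power_even_eq)
      qed
    qed measurable
    thus ?thesis by (simp add: sphere_moment_def)
  qed
  have "sphere_moment \<tau> k = 1 / real (?N + k - 1 choose k)" for k
    using sphere_moment_eq[OF \<tau>, of k] by (metis mult_eq_0_iff nonzero_eq_divide_eq zero_neq_one)
  moreover have "cmod (b k) = \<bar>(- a) gchoose k\<bar>" for k
  proof -
    have "complex_of_real (- a) gchoose k = of_real ((- a) gchoose k)"
      by (simp add: gbinomial_prod_rev)
    thus ?thesis by (simp add: b_def norm_mult norm_power)
  qed
  ultimately have summ: "summable (coeff_sq ?P)"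
    unfolding csq[abs_def] using summable_binomial_ratio[OF a] by simp
  have s0: "0 \<le> suminf (coeff_sq ?P)" by (intro suminf_nonneg summ coeff_sq_nonneg)
  have "square_mean ?P r \<le> (sqrt (suminf (coeff_sq ?P)))\<^sup>2" if r: "0 < r" "r < 1" for r
  proof -
    have "square_mean ?P r \<le> suminf (coeff_sq ?P)"
      using r by (intro sums_le[OF _ square_mean_sums[OF bP] summable_sums[OF summ]])
        (auto intro!: mult_left_le_one_le coeff_sq_nonneg power_le_one)
    thus ?thesis unfolding real_sqrt_pow2[OF s0] .
  qed
  thus ?thesis by (rule hardy2I(1)[OF bP _ real_sqrt_ge_zero[OF s0]])
qed


section \<open>Infinite-dimensional eigenspaces\<close>

text \<open>A linear relation among the functions \<open>f * E ^ j\<close> is a polynomial that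
  vanishes at the infinitely many values of \<open>E\<close> where \<open>f\<close> is not
  0.\<close>

lemma infinite_dimensional_powers:
  fixes f E :: "'a \<Rightarrow> complex"
  assumes W: "\<And>j :: nat. (\<lambda>x. f x * E x ^ j) \<in> W" and inf: "infinite (E ` {x. f x \<noteq> 0})"
  shows "infinite_dimensional W"
  unfolding infinite_dimensional_def
proof
  assume "\<exists>B. finite B \<and> B \<subseteq> W \<and> W \<subseteq> cfun.span B"
  then obtain B where B: "finite B" "W \<subseteq> cfun.span B" by blast
  define g where "g j = (\<lambda>x. f x * E x ^ j)" for j :: nat
  have vanish: "\<forall>j\<le>n. c j = 0" if c: "\<And>x. (\<Sum>j\<le>n. c j * g j x) = 0" for n and c :: "nat \<Rightarrow> complex"
  proof (rule ccontr)
    assume "\<not> (\<forall>j\<le>n. c j = 0)"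
    hence fin: "finite {w. (\<Sum>j\<le>n. c j * w ^ j) = 0}" using polyfun_finite_roots[of c n] by auto
    have "E ` {x. f x \<noteq> 0} \<subseteq> {w. (\<Sum>j\<le>n. c j * w ^ j) = 0}"
    proof safe
      fix x assume fx: "f x \<noteq> 0"
      have "f x * (\<Sum>j\<le>n. c j * E x ^ j) = 0" using c[of x] by (simp add: g_def sum_distrib_left mult_ac)
      thus "(\<Sum>j\<le>n. c j * E x ^ j) = 0" using fx by simp
    qed
    thus False using inf fin finite_subset by blast
  qed
  have inj: "inj g"
  proof (rule injI, rule ccontr)
    fix i j assume ij: "g i = g j" "i \<noteq> j"
    define c where "c k = (if k = i then 1 else if k = j then -1 else 0 :: complex)" for k
    have "(\<Sum>k\<le>i + j. c k * g k x) = 0" for x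
    proof -
      have "(\<Sum>k\<le>i + j. c k * g k x) = (\<Sum>k\<in>{i, j}. c k * g k x)"
        by (rule sum.mono_neutral_right) (auto simp: c_def)
      also have "\<dots> = 0" using ij by (simp add: c_def)
      finally show ?thesis .
    qed
    hence "c i = 0" using vanish[of c "i + j"] by simp
    thus False by (simp add: c_def)
  qed
  have "cfun.independent (range g)"
  proof
    assume "cfun.dependent (range g)"
    then obtain S u v where S: "finite S" "S \<subseteq> range g" "v \<in> S" "u v \<noteq> 0" "(\<Sum>v\<in>S. cscale (u v) v) = 0"
      unfolding cfun.dependent_explicit by blast
    define J where "J = g -` S"
    have J: "finite J" "S = g ` J" using S inj by (auto simp: J_def finite_vimageI)
    obtain n where n: "J \<subseteq> {..n}" using J(1) finite_nat_iff_bounded_le by auto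
    define c where "c j = (if j \<in> J then u (g j) else 0)" for j
    have "(\<Sum>j\<le>n. c j * g j x) = 0" for x
    proof -
      have ev: "(\<Sum>v\<in>S'. h v) x = (\<Sum>v\<in>S'. h v x)" for S' and h :: "('a \<Rightarrow> complex) \<Rightarrow> 'a \<Rightarrow> complex"
        by (induction S' rule: infinite_finite_induct) auto
      have "(\<Sum>j\<le>n. c j * g j x) = (\<Sum>j\<in>J. c j * g j x)"
        by (rule sum.mono_neutral_right) (use n in \<open>auto simp: c_def\<close>)
      also have "\<dots> = (\<Sum>j\<in>J. cscale (u (g j)) (g j) x)" by (simp add: c_def cscale_def)
      also have "\<dots> = (\<Sum>v\<in>S. cscale (u v) v x)"
        unfolding J(2) using inj by (subst sum.reindex) (auto intro: inj_on_subset)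
      also have "\<dots> = (\<Sum>v\<in>S. cscale (u v) v) x" by (rule ev[symmetric])
      finally show ?thesis using S(5) by simp
    qed
    hence "\<forall>j\<le>n. c j = 0" by (rule vanish)
    moreover obtain j where "v = g j" "j \<in> J" using S(3) J(2) by blast
    ultimately show False using S(4) n by (auto simp: c_def)
  qed
  moreover have "range g \<subseteq> cfun.span B" using W B(2) by (auto simp: g_def)
  ultimately have "finite (range g)" using cfun.independent_span_bound[OF B(1)] by blast
  thus False using inj finite_imageD by blast
qed

lemma infinite_dimensional_nonzero:
  assumes "infinite_dimensional W" obtains g where "g \<in> W" "g \<noteq> 0"
proof -
  have "\<not> W \<subseteq> cfun.span {}" using assms unfolding infinite_dimensional_def by blast
  thus ?thesis using that by auto
qed

text \<open>The kernel of a functional has codimension at most 1: a finite spanning set of it,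
  together with one vector outside, would span everything.\<close>

lemma infinite_dimensional_kernel:
  assumes inf: "infinite_dimensional W"
    and add: "\<And>f g. f \<in> W \<Longrightarrow> g \<in> W \<Longrightarrow> f + g \<in> W" and scale: "\<And>c f. f \<in> W \<Longrightarrow> cscale c f \<in> W"
    and l: "\<And>f g. f \<in> W \<Longrightarrow> g \<in> W \<Longrightarrow> l (f + g) = l f + l g" "\<And>c f. f \<in> W \<Longrightarrow> l (cscale c f) = c * l f"
  shows "infinite_dimensional {f \<in> W. l f = (0 :: complex)}"
proof (cases "\<forall>f\<in>W. l f = 0")
  case True
  hence "{f \<in> W. l f = 0} = W" by auto
  thus ?thesis using inf by simp
next
  case False
  then obtain w where w: "w \<in> W" "l w \<noteq> 0" by blast
  show ?thesis unfolding infinite_dimensional_def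
  proof
    assume "\<exists>B. finite B \<and> B \<subseteq> {f \<in> W. l f = 0} \<and> {f \<in> W. l f = 0} \<subseteq> cfun.span B"
    then obtain B where B: "finite B" "B \<subseteq> {f \<in> W. l f = 0}" "{f \<in> W. l f = 0} \<subseteq> cfun.span B" by blast
    have "W \<subseteq> cfun.span (insert w B)"
    proof
      fix f assume f: "f \<in> W"
      define c where "c = l f / l w"
      define h where "h = f + cscale (- c) w"
      have "h \<in> W" unfolding h_def by (intro add f scale w)
      moreover have "l h = 0" using l(1)[OF f scale[OF w(1)], of "- c"] l(2)[OF w(1), of "- c"] w(2) by (simp add: h_def c_def)
      ultimately have "h \<in> cfun.span (insert w B)"
        using B(3) cfun.span_mono[of B "insert w B"] by blast
      moreover have "cscale c w \<in> cfun.span (insert w B)"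
        by (intro cfun.span_scale cfun.span_base) simp
      ultimately have "h + cscale c w \<in> cfun.span (insert w B)" by (rule cfun.span_add)
      moreover have "h + cscale c w = f" by (auto simp: h_def cscale_def)
      ultimately show "f \<in> cfun.span (insert w B)" by simp
    qed
    moreover have "insert w B \<subseteq> W" "finite (insert w B)" using B w by auto
    ultimately show False using inf unfolding infinite_dimensional_def by blast
  qed
qed

text \<open>Finitely many orthogonality conditions leave an infinite-dimensional space, which
  replaces a Gram-Schmidt process.\<close>

lemma hardy2_orthogonal_unit:
  assumes inf: "infinite_dimensional W" and sub: "W \<subseteq> hardy2"
    and add: "\<And>f g. f \<in> W \<Longrightarrow> g \<in> W \<Longrightarrow> f + g \<in> W" and scale: "\<And>c f. f \<in> W \<Longrightarrow> cscale c f \<in> W"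
    and H: "finite H" "H \<subseteq> hardy2"
  obtains g where "g \<in> W" "hardy2_norm g = 1" "\<And>h. h \<in> H \<Longrightarrow> hardy2_inner g h = 0"
proof -
  have ip_add: "hardy2_inner (f + g) h = hardy2_inner f h + hardy2_inner g h"
    if "f \<in> hardy2" "g \<in> hardy2" "h \<in> hardy2" for f g h
    using hardy2_inner_add_left[OF that] by (simp add: plus_fun_def)
  have ip_scale: "hardy2_inner (cscale c f) h = c * hardy2_inner f h" if "f \<in> hardy2" "h \<in> hardy2" for c f h
    using hardy2_inner_cmult_left[OF that] by (simp add: cscale_def)
  have "infinite_dimensional {g \<in> W. \<forall>h\<in>H. hardy2_inner g h = 0}"
    using H
  proof (induction H rule: finite_induct)
    case empty
    thus ?case using inf by simp
  next
    case (insert h H)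
    let ?W = "{g \<in> W. \<forall>h\<in>H. hardy2_inner g h = 0}"
    have h: "h \<in> hardy2" and Hs: "H \<subseteq> hardy2" using insert by auto
    have "infinite_dimensional {g \<in> ?W. hardy2_inner g h = 0}"
    proof (rule infinite_dimensional_kernel)
      show "infinite_dimensional ?W" using insert by simp
    qed (use h Hs sub in \<open>auto simp: ip_add ip_scale subset_iff add scale\<close>)
    moreover have "{g \<in> ?W. hardy2_inner g h = 0} = {g \<in> W. \<forall>h\<in>insert h H. hardy2_inner g h = 0}" by auto
    ultimately show ?case by simp
  qed
  then obtain g where "g \<in> {g \<in> W. \<forall>h\<in>H. hardy2_inner g h = 0}" and g0: "g \<noteq> 0"
    by (rule infinite_dimensional_nonzero)
  hence g: "g \<in> W" "\<And>h. h \<in> H \<Longrightarrow> hardy2_inner g h = 0" by auto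
  have gh: "g \<in> hardy2" using g sub by blast
  have n0: "hardy2_norm g \<noteq> 0" using hardy2_norm_eq_0[OF gh] g0 by auto
  have n: "0 < hardy2_norm g" using n0 hardy2_norm_nonneg[OF gh] by simp
  let ?g = "cscale (of_real (1 / hardy2_norm g)) g"
  show ?thesis
  proof (rule that[of ?g])
    show "?g \<in> W" by (rule scale[OF g(1)])
    show "hardy2_norm ?g = 1" using n by (simp add: hardy2_norm_cscale[OF gh] norm_divide)
    show "hardy2_inner ?g h = 0" if "h \<in> H" for h
      using ip_scale[OF gh] H that g(2)[OF that] by auto
  qed
qed

text \<open>Dependent choice, each vector orthogonal to its predecessors. The mutual distance sqrt 2
  is what rules out convergent subsequences.\<close>

lemma hardy2_orthonormal_sequence:
  fixes W :: "(complex ^ 'n \<Rightarrow> complex) set"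
  assumes inf: "infinite_dimensional W" and sub: "W \<subseteq> hardy2"
    and add: "\<And>f g. f \<in> W \<Longrightarrow> g \<in> W \<Longrightarrow> f + g \<in> W" and scale: "\<And>c f. f \<in> W \<Longrightarrow> cscale c f \<in> W"
  shows "\<exists>f :: nat \<Rightarrow> complex ^ 'n \<Rightarrow> complex. (\<forall>n. f n \<in> W \<and> hardy2_norm (f n) = 1) \<and>
    (\<forall>m n. m < n \<longrightarrow> hardy2_norm (f n - f m) = sqrt 2)"
proof -
  define P where "P f n r \<longleftrightarrow> r \<in> W \<and> hardy2_norm r = 1 \<and> (\<forall>m<n. hardy2_inner r (f m) = 0)"
    for f :: "nat \<Rightarrow> complex ^ 'n \<Rightarrow> complex" and n r
  have "\<exists>f. \<forall>n. P f n (f n)"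
  proof (rule dependent_wellorder_choice)
    show "P f n r = P g n r" if "\<And>y. y < n \<Longrightarrow> f y = g y" for f g n r
      using that by (auto simp: P_def)
    fix n and f :: "nat \<Rightarrow> complex ^ 'n \<Rightarrow> complex" assume f: "\<And>y. y < n \<Longrightarrow> P f y (f y)"
    have "f ` {..<n} \<subseteq> hardy2" using f sub by (auto simp: P_def)
    then obtain g where "g \<in> W" "hardy2_norm g = 1" "\<And>h. h \<in> f ` {..<n} \<Longrightarrow> hardy2_inner g h = 0"
      using hardy2_orthogonal_unit[OF inf sub add scale, of "f ` {..<n}"] by blast
    thus "\<exists>r. P f n r" by (auto simp: P_def)
  qed
  then obtain f where f: "\<And>n. P f n (f n)" by blast
  have W: "f n \<in> W" "hardy2_norm (f n) = 1" for n using f by (auto simp: P_def)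
  have fh: "f n \<in> hardy2" for n using W sub by blast
  have "hardy2_norm (f n - f m) = sqrt 2" if "m < n" for m n
  proof -
    have "(hardy2_norm (f n - f m))\<^sup>2 = 2"
      using hardy2_norm_diff[OF fh fh, of n m] f[of n] that W(2) by (simp add: P_def fun_diff_def)
    thus ?thesis using hardy2_norm_nonneg[OF hardy2_minus[OF fh fh]] real_sqrt_unique by metis
  qed
  thus ?thesis using W by blast
qed

lemma invertible_imp_essentially_invertible:
  assumes "invertible_op hardy2 hardy2_norm T"
  shows "essentially_invertible_op hardy2 hardy2_norm T"
proof -
  obtain S where S: "bounded_op hardy2 hardy2_norm S" "\<And>f. f \<in> hardy2 \<Longrightarrow> S (T f) = f \<and> T (S f) = f"
    and T: "bounded_op hardy2 hardy2_norm T"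
    using assms unfolding invertible_op_def by blast
  have z: "(0 :: complex ^ 'a \<Rightarrow> complex) \<in> hardy2" "hardy2_norm (0 :: complex ^ 'a \<Rightarrow> complex) = 0"
    using hardy2_zero by (simp_all add: zero_fun_def)
  have c: "compact_op hardy2 hardy2_norm Z" if Z: "\<And>f. f \<in> hardy2 \<Longrightarrow> Z f = 0"
    for Z :: "(complex ^ 'a \<Rightarrow> complex) \<Rightarrow> complex ^ 'a \<Rightarrow> complex"
    unfolding compact_op_def
  proof (intro conjI allI impI)
    show "bounded_op hardy2 hardy2_norm Z"
      unfolding bounded_op_def using Z z
      by (auto simp: hardy2_plus hardy2_cscale intro!: exI[of _ 0])
    fix f :: "nat \<Rightarrow> complex ^ 'a \<Rightarrow> complex" assume f: "\<forall>k. f k \<in> hardy2 \<and> hardy2_norm (f k) \<le> 1"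
    show "\<exists>s :: nat \<Rightarrow> nat. \<exists>g\<in>hardy2. strict_mono s \<and> (\<lambda>k. hardy2_norm (Z (f (s k)) - g)) \<longlonglongrightarrow> 0"
      using f z by (intro exI[of _ id] bexI[of _ 0]) (auto simp: Z strict_mono_def)
  qed
  show ?thesis unfolding essentially_invertible_op_def
  proof (intro conjI exI)
    show "compact_op hardy2 hardy2_norm (\<lambda>f. S (T f) - f)" by (rule c) (simp add: S)
    show "compact_op hardy2 hardy2_norm (\<lambda>f. T (S f) - f)" by (rule c) (simp add: S)
  qed (rule T S)+
qed

lemma eigenspace_closed:
  fixes \<phi> :: "complex ^ 'n \<Rightarrow> complex ^ 'n"
  shows "f \<in> eigenspace hardy2 (comp_op \<phi>) \<mu> \<Longrightarrow> g \<in> eigenspace hardy2 (comp_op \<phi>) \<mu> \<Longrightarrow> f + g \<in> eigenspace hardy2 (comp_op \<phi>) \<mu>"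
    "f \<in> eigenspace hardy2 (comp_op \<phi>) \<mu> \<Longrightarrow> cscale c f \<in> eigenspace hardy2 (comp_op \<phi>) \<mu>"
  by (auto simp: eigenspace_def hardy2_plus hardy2_cscale comp_op_add comp_op_cscale)
     (auto simp: cscale_def algebra_simps)

text \<open>An approximate left inverse would map an orthonormal sequence of eigenvectors for a nearby
  eigenvalue close to a precompact sequence.\<close>

lemma not_essentially_invertible:
  fixes \<phi> :: "complex ^ 'n \<Rightarrow> complex ^ 'n"
  assumes near: "\<And>e. 0 < e \<Longrightarrow> \<exists>\<nu>. cmod (\<nu> - \<mu>) < e \<and> infinite_dimensional (eigenspace hardy2 (comp_op \<phi>) \<nu>)"
  shows "\<not> essentially_invertible_op hardy2 hardy2_norm (\<lambda>f. comp_op \<phi> f - cscale \<mu> f)"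
proof
  let ?T = "\<lambda>f. comp_op \<phi> f - cscale \<mu> f"
  assume "essentially_invertible_op hardy2 hardy2_norm ?T"
  then obtain S where S: "bounded_op hardy2 hardy2_norm S"
    and cp: "compact_op hardy2 hardy2_norm (\<lambda>f. S (?T f) - f)"
    unfolding essentially_invertible_op_def by blast
  obtain K where K: "\<And>f. f \<in> hardy2 \<Longrightarrow> hardy2_norm (S f) \<le> K * hardy2_norm f"
    using S unfolding bounded_op_def by blast
  have Sh: "S f \<in> hardy2" if "f \<in> hardy2" for f using S that unfolding bounded_op_def by blast
  \<comment> \<open>Makes the vectors \<open>u n\<close> have norm at most 1/4; adding 1 covers
    \<open>K = 0\<close>.\<close>
  define e where "e = 1 / (4 * (\<bar>K\<bar> + 1))"
  have e: "0 < e" by (simp add: e_def add_nonneg_pos)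
  obtain \<nu> where \<nu>: "cmod (\<nu> - \<mu>) < e" "infinite_dimensional (eigenspace hardy2 (comp_op \<phi>) \<nu>)"
    using near[OF e] by blast
  have sub: "eigenspace hardy2 (comp_op \<phi>) \<nu> \<subseteq> hardy2" by (auto simp: eigenspace_def)
  have "\<exists>f. (\<forall>n. f n \<in> eigenspace hardy2 (comp_op \<phi>) \<nu> \<and> hardy2_norm (f n) = 1) \<and>
    (\<forall>m n :: nat. m < n \<longrightarrow> hardy2_norm (f n - f m) = sqrt 2)"
    by (rule hardy2_orthonormal_sequence[OF \<nu>(2) sub eigenspace_closed])
  then obtain f where f: "\<And>n. f n \<in> eigenspace hardy2 (comp_op \<phi>) \<nu>" "\<And>n. hardy2_norm (f n) = 1"
    "\<And>m n :: nat. m < n \<Longrightarrow> hardy2_norm (f n - f m) = sqrt 2" by blast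
  have fh: "f n \<in> hardy2" for n using f(1) sub by blast
  have Tf: "?T (f n) = cscale (\<nu> - \<mu>) (f n)" for n
    using f(1)[of n] by (auto simp: eigenspace_def cscale_def algebra_simps)
  define u where "u n = S (?T (f n))" for n
  have uh: "u n \<in> hardy2" for n unfolding u_def Tf by (intro Sh hardy2_cscale fh)
  have un: "hardy2_norm (u n) \<le> 1 / 4" for n
  proof -
    have "hardy2_norm (u n) \<le> K * cmod (\<nu> - \<mu>)"
      unfolding u_def Tf using K[OF hardy2_cscale[OF fh]] by (simp add: hardy2_norm_cscale fh f(2))
    also have "\<dots> \<le> \<bar>K\<bar> * e" using \<nu>(1) by (intro mult_mono) auto
    also have "\<dots> \<le> 1 / 4" by (simp add: e_def field_simps)
    finally show ?thesis .
  qed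
  have fk: "\<forall>k. f k \<in> hardy2 \<and> hardy2_norm (f k) \<le> 1" using fh f(2) by simp
  have "\<exists>s :: nat \<Rightarrow> nat. \<exists>g\<in>hardy2. strict_mono s \<and>
      (\<lambda>k. hardy2_norm ((S (?T (f (s k))) - f (s k)) - g)) \<longlonglongrightarrow> 0"
    using cp[unfolded compact_op_def, THEN conjunct2, THEN spec, of f] fk by (rule mp)
  then obtain s :: "nat \<Rightarrow> nat" and g where g: "g \<in> hardy2" "strict_mono s"
    "(\<lambda>k. hardy2_norm ((u (s k) - f (s k)) - g)) \<longlonglongrightarrow> 0"
    unfolding u_def by blast
  have "\<forall>\<^sub>F k in sequentially. hardy2_norm ((u (s k) - f (s k)) - g) < 1 / 4"
    using g(3) by (rule order_tendstoD) simp
  then obtain k where k: "\<And>n. n \<ge> k \<Longrightarrow> hardy2_norm ((u (s n) - f (s n)) - g) < 1 / 4"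
    by (auto simp: eventually_sequentially)
  define i j where "i = s k" and "j = s (Suc k)"
  define p where "p n = (u n - f n) - g" for n
  have ph: "p n \<in> hardy2" for n unfolding p_def by (intro hardy2_minus uh fh g)
  \<comment> \<open>Four terms of norm at most 1/4, two of them strictly smaller, so the distance
    falls below 1 and hence below sqrt 2.\<close>
  have "f j - f i = (p i - p j) - (u i - u j)" by (simp add: p_def)
  hence "hardy2_norm (f j - f i) \<le> hardy2_norm (p i - p j) + hardy2_norm (u i - u j)"
    by (simp only: hardy2_norm_minus hardy2_minus ph uh)
  also have "\<dots> \<le> (hardy2_norm (p i) + hardy2_norm (p j)) + (hardy2_norm (u i) + hardy2_norm (u j))"
    by (intro add_mono hardy2_norm_minus ph uh)
  also have "\<dots> < 1"
    using un[of i] un[of j] k[of k] k[of "Suc k"] by (simp add: p_def i_def j_def)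
  finally have "hardy2_norm (f j - f i) < 1" .
  moreover have "i < j" using g(2) by (simp add: i_def j_def strict_mono_def)
  hence "hardy2_norm (f j - f i) = sqrt 2" by (rule f(3))
  ultimately show False using real_sqrt_ge_1_iff[of 2] by linarith
qed

context hyperbolic_lf begin

text \<open>A logarithm of the quotient that the overview calls W. Both arguments lie in the right
  half-plane, so the principal branches are holomorphic and each has an imaginary part below pi / 2
  in modulus.\<close>

definition W where "W z = Ln (aff z) - Ln (1 - cinner z \<tau>)"

lemma Re_denominator: "norm z < 1 \<Longrightarrow> 0 < Re (1 - cinner z \<tau>)"
  using complex_Re_le_cmod[of "cinner z \<tau>"] cmod_cinner_le[of z \<tau>] \<tau>1 by simp

lemma Re_aff: "norm z < 1 \<Longrightarrow> 0 < Re (aff z)"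
  using aff_bounds(1)[of z] v\<^sub>0(1) by simp

lemma holomorphic_W: "holomorphic_fun_on W (ball 0 1)"
  unfolding W_def aff_def
proof (rule holomorphic_fun_on_diff)
  show "holomorphic_fun_on (\<lambda>z. Ln (1 - cinner z v\<^sub>0)) (ball 0 1)"
    by (rule holomorphic_fun_on_compose_complex[where g = Ln and T = "- \<real>\<^sub>\<le>\<^sub>0"])
       (use Re_aff in \<open>fastforce simp: complex_nonpos_Reals_iff aff_def intro!: holomorphic_fun_intros holomorphic_intros\<close>)+
  show "holomorphic_fun_on (\<lambda>z. Ln (1 - cinner z \<tau>)) (ball 0 1)"
    by (rule holomorphic_fun_on_compose_complex[where g = Ln and T = "- \<real>\<^sub>\<le>\<^sub>0"])
       (use Re_denominator in \<open>fastforce simp: complex_nonpos_Reals_iff intro!: holomorphic_fun_intros holomorphic_intros\<close>)+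
qed

lemma exp_W: "norm z < 1 \<Longrightarrow> exp (W z) = aff z / (1 - cinner z \<tau>)"
  unfolding W_def exp_diff using Re_aff[of z] Re_denominator[of z]
  by (subst (1 2) exp_Ln) auto

lemma Im_W: "norm z < 1 \<Longrightarrow> \<bar>Im (W z)\<bar> < pi"
  using Re_Ln_pos_lt_imp[OF Re_aff, of z] Re_Ln_pos_lt_imp[OF Re_denominator, of z] by (simp add: W_def)

text \<open>The map acts on \<open>W\<close> as the translation by this number.\<close>

definition \<gamma> where "\<gamma> = ln (1 / \<alpha>)"

lemma \<gamma>: "0 < \<gamma>"
  using \<alpha> by (simp add: \<gamma>_def)

text \<open>The exponentials agree by the two affine eigenfunction equations, and the bound on the
  imaginary parts excludes a nonzero multiple of 2 pi \<i>.\<close>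

lemma W_comp:
  assumes z: "norm z < 1" shows "W (\<phi> z) = W z + of_real \<gamma>"
proof -
  have z1: "norm z \<le> 1" and zb: "z \<in> ball 0 1" using z by auto
  have \<phi>z: "norm (\<phi> z) < 1" using maps[OF zb] by simp
  have nz: "1 - cinner z \<tau> \<noteq> 0" "1 - cinner (\<phi> z) \<tau> \<noteq> 0"
    using Re_denominator[OF z] Re_denominator[OF \<phi>z] by auto
  have "aff (\<phi> z) * Q z 1 = \<kappa> * aff z" using v\<^sub>0(2)[OF z1] by (simp add: aff_def)
  moreover have "(1 - cinner (\<phi> z) \<tau>) * Q z 1 = of_real \<alpha> * \<kappa> * (1 - cinner z \<tau>)"
    by (rule \<tau>_eigenfunction[OF z1])
  moreover have "(aff (\<phi> z) / (1 - cinner (\<phi> z) \<tau>)) = (aff (\<phi> z) * Q z 1) / ((1 - cinner (\<phi> z) \<tau>) * Q z 1)"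
    using Q_nonzero[OF z1] by simp
  ultimately have "exp (W (\<phi> z)) = exp (W z) / of_real \<alpha>"
    using \<kappa>0 by (simp add: exp_W z \<phi>z)
  also have "\<dots> = exp (W z) * exp (of_real \<gamma>)"
    using \<alpha> by (simp add: \<gamma>_def exp_of_real field_simps)
  also have "\<dots> = exp (W z + of_real \<gamma>)" by (simp add: exp_add)
  finally obtain n :: int where n: "W (\<phi> z) = W z + of_real \<gamma> + (of_int (2 * n) * pi) * \<i>"
    unfolding exp_eq by auto
  hence "Im (W (\<phi> z)) = Im (W z) + of_int (2 * n) * pi" by simp
  hence "\<bar>of_int (2 * n) * pi\<bar> < 2 * pi" using Im_W[OF z] Im_W[OF \<phi>z] by linarith
  hence "\<bar>real_of_int (2 * n)\<bar> < 2" by (simp add: abs_mult)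
  hence "n = 0" by linarith
  thus ?thesis using n by simp
qed

text \<open>A function of \<open>W\<close> with period \<open>\<gamma>\<close>, hence invariant
  under the map, and bounded because the imaginary part of \<open>W\<close> is bounded. Its powers
  turn one eigenfunction into infinitely many.\<close>

definition E where "E z = exp (\<i> * of_real (2 * pi / \<gamma>) * W z)"

lemma holomorphic_E: "holomorphic_fun_on E (ball 0 1)"
  unfolding E_def
  by (rule holomorphic_fun_on_compose_complex[OF holomorphic_W, where g = "\<lambda>w. exp (\<i> * of_real (2 * pi / \<gamma>) * w)" and T = UNIV])
     (auto intro!: holomorphic_intros)

lemma E_comp: "norm z < 1 \<Longrightarrow> E (\<phi> z) = E z"
proof -
  assume z: "norm z < 1"
  have "\<i> * of_real (2 * pi / \<gamma>) * W (\<phi> z) = \<i> * of_real (2 * pi / \<gamma>) * W z + 2 * of_real pi * \<i>"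
    using \<gamma> by (simp add: W_comp[OF z] field_simps)
  thus ?thesis by (simp add: E_def exp_add)
qed

lemma E_bound: "norm z < 1 \<Longrightarrow> cmod (E z) \<le> exp (2 * pi / \<gamma> * pi)"
  using Im_W[of z] \<gamma> mult_left_mono[of "- Im (W z)" pi "2 * pi / \<gamma>"]
  by (simp add: E_def norm_exp_eq_Re)

text \<open>On the disc through \<open>\<tau>\<close> a finite range would make \<open>W\<close>
  constant, so \<open>aff\<close> and \<open>1 - cinner z \<tau>\<close> would be proportional
  there. Comparing them at two points gives \<open>cinner \<tau> v\<^sub>0 = 1\<close>, which
  \<open>norm v\<^sub>0 < 1\<close> excludes.\<close>

lemma infinite_E: "infinite (E ` ball 0 1)"
proof
  assume fin: "finite (E ` ball 0 1)"
  define h where "h u = W (0 + u *s \<tau>)" for u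
  have set: "{u. 0 + u *s \<tau> \<in> ball 0 1} = ball 0 1" by (auto simp: norm_smult \<tau>1)
  have hh: "h holomorphic_on ball 0 1"
    using holomorphic_on_line[OF holomorphic_W open_ball, of 0 \<tau>] unfolding set h_def .
  define c where "c = \<i> * of_real (2 * pi / \<gamma>)"
  have c: "c \<noteq> 0" using \<gamma> by (simp add: c_def)
  have eh: "(\<lambda>u. exp (c * h u)) holomorphic_on ball 0 1" by (intro holomorphic_intros hh)
  have "(\<lambda>u. exp (c * h u)) ` ball 0 1 \<subseteq> E ` ball 0 1"
    by (auto simp: E_def h_def c_def norm_smult \<tau>1 intro!: imageI)
  hence "finite ((\<lambda>u. exp (c * h u)) ` ball 0 1)" using fin finite_subset by blast
  hence "(\<lambda>u. exp (c * h u)) constant_on ball 0 1"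
    by (intro continuous_finite_range_constant holomorphic_on_imp_continuous_on eh) auto
  then obtain k where k: "\<And>u. u \<in> ball 0 1 \<Longrightarrow> exp (c * h u) = k" by (auto simp: constant_on_def)
  have "(h has_field_derivative 0) (at u within ball 0 1)" if u: "u \<in> ball 0 1" for u
  proof -
    have dh: "(h has_field_derivative deriv h u) (at u)" by (rule holomorphic_derivI[OF hh open_ball u])
    have "((\<lambda>u. exp (c * h u)) has_field_derivative exp (c * h u) * (c * deriv h u)) (at u)"
      using dh by (auto intro!: derivative_eq_intros)
    moreover have "((\<lambda>u. exp (c * h u)) has_field_derivative 0) (at u)"
      by (rule has_field_derivative_transform_within_open[OF DERIV_const[of k] open_ball u]) (simp add: k)
    ultimately have "exp (c * h u) * (c * deriv h u) = 0" by (rule DERIV_unique)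
    hence "deriv h u = 0" using c by simp
    thus ?thesis using dh by (metis has_field_derivative_at_within)
  qed
  from has_field_derivative_zero_constant[OF convex_ball this]
  obtain k' where k': "\<And>u. u \<in> ball 0 1 \<Longrightarrow> h u = k'" by blast
  have q: "1 - u * cinner \<tau> v\<^sub>0 = exp k' * (1 - u)" if "u \<in> ball 0 1" for u
  proof -
    have "u *s \<tau> \<in> ball 0 1" using that by (simp add: norm_smult \<tau>1)
    hence "exp (h u) = aff (u *s \<tau>) / (1 - cinner (u *s \<tau>) \<tau>)" by (simp add: h_def exp_W)
    moreover have "1 - u \<noteq> 0" using that by auto
    ultimately show ?thesis using k'[OF that] by (simp add: aff_def cinner_simps \<tau>\<tau> field_simps)
  qed
  have "cinner \<tau> v\<^sub>0 = 1" using q[of 0] q[of "1/2"] by simp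
  hence "1 \<le> norm v\<^sub>0" using cmod_cinner_le[of \<tau> v\<^sub>0] \<tau>1 by simp
  thus False using v\<^sub>0(1) by simp
qed


text \<open>Composition with the map multiplies \<open>exp (s * W z)\<close> by
  \<open>exp (s * \<gamma>)\<close>. Since \<open>ln R = N / 2 * \<gamma>\<close>, the bound on
  \<open>\<mu>'\<close> says that \<open>Re s < N / 2\<close>. The imaginary part of
  \<open>W\<close> is bounded, so the function grows no faster than a negative power of
  \<open>1 - cinner z \<tau>\<close> that lies in the Hardy space.\<close>

lemma eigenspace_infinite:
  assumes \<mu>': "\<mu>' \<noteq> 0" "cmod \<mu>' < R"
  shows "infinite_dimensional (eigenspace hardy2 (comp_op \<phi>) \<mu>')"
proof -
  define s where "s = Ln \<mu>' / of_real \<gamma>"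
  have s: "exp (s * of_real \<gamma>) = \<mu>'" using \<gamma> \<mu>' by (simp add: s_def)
  have "Re s = ln (cmod \<mu>') / \<gamma>" using \<mu>' by (simp add: s_def Re_divide_of_real)
  moreover have "ln (cmod \<mu>') < real CARD('n) / 2 * \<gamma>"
  proof -
    have "ln (cmod \<mu>') < ln R" using \<mu>' R_pos by simp
    also have "ln R = real CARD('n) / 2 * \<gamma>" using \<alpha> by (simp add: R_eq ln_powr \<gamma>_def ln_div)
    finally show ?thesis .
  qed
  ultimately have Res: "Re s < real CARD('n) / 2" using \<gamma> by (simp add: divide_less_eq)
  \<comment> \<open>At least \<open>Re s\<close>, below N / 2, and positive even when
    \<open>Re s\<close> is negative, as \<open>negative_power_hardy2\<close> demands.\<close>
  define a where "a = (max 0 (Re s) + real CARD('n) / 2) / 2"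
  have a: "0 < a" "a < real CARD('n) / 2" "Re s \<le> a"
    using Res by (auto simp: a_def max_def)
  define f where "f z = (if z \<in> ball 0 1 then exp (s * W z) else 0)" for z
  define P where "P z = (if z \<in> ball 0 1 then exp (- of_real a * Ln (1 - cinner z \<tau>)) else 0)" for z
  have P: "P \<in> hardy2" unfolding P_def[abs_def] by (rule negative_power_hardy2[OF \<tau>1 a(1,2)])
  have bf: "ball_hol f"
    unfolding f_def
    by (rule ball_hol_cut, rule holomorphic_fun_on_compose_complex[OF holomorphic_W, where g = "\<lambda>w. exp (s * w)" and T = UNIV])
       (auto intro!: holomorphic_intros)
  \<comment> \<open>Bounds the logarithm of \<open>cmod (aff z)\<close> in both directions, because
    \<open>Re s\<close> may have either sign.\<close>
  define L where "L = \<bar>ln (1 - norm v\<^sub>0)\<bar> + ln 2"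
  define Mf where "Mf = exp (\<bar>Re s\<bar> * L + (a - Re s) * ln 2 + \<bar>Im s\<bar> * pi)"
  have le: "cmod (f z) \<le> Mf * cmod (P z)" if z: "norm z < 1" for z
  proof -
    have z1: "norm z \<le> 1" using z by simp
    define A1 where "A1 = ln (cmod (aff z))"
    define D1 where "D1 = ln (cmod (1 - cinner z \<tau>))"
    have nz: "aff z \<noteq> 0" "1 - cinner z \<tau> \<noteq> 0" using Re_aff[OF z] Re_denominator[OF z] by auto
    have ReW: "Re (W z) = A1 - D1" using nz by (simp add: W_def A1_def D1_def)
    have "A1 \<le> ln 2" unfolding A1_def using aff_bounds(3)[OF z1] nz by simp
    moreover have "ln (1 - norm v\<^sub>0) \<le> A1" unfolding A1_def using aff_bounds(2)[OF z1] v\<^sub>0(1) nz by simp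
    ultimately have A1: "\<bar>A1\<bar> \<le> L" 
      unfolding L_def abs_le_iff using ln_ge_zero[of "2 :: real"] by (intro conjI) linarith+
    have "cmod (1 - cinner z \<tau>) \<le> 2"
      using norm_triangle_ineq4[of 1 "cinner z \<tau>"] cmod_cinner_le[of z \<tau>] \<tau>1 z by simp
    hence D1: "D1 \<le> ln 2" unfolding D1_def using nz by simp
    have "Re s * A1 \<le> \<bar>Re s\<bar> * L"
      using mult_left_mono[OF A1, of "\<bar>Re s\<bar>"] abs_le_D1[of "Re s * A1" "\<bar>Re s\<bar> * L"] by (simp add: abs_mult)
    moreover have "(a - Re s) * D1 \<le> (a - Re s) * ln 2" using a D1 by (intro mult_left_mono) auto
    moreover have "- (Im s * Im (W z)) \<le> \<bar>Im s\<bar> * pi"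
      using mult_left_mono[OF less_imp_le[OF Im_W[OF z]], of "\<bar>Im s\<bar>"]
        abs_le_D2[of "Im s * Im (W z)" "\<bar>Im s\<bar> * pi"] by (simp add: abs_mult)
    ultimately have "Re (s * W z) \<le> (\<bar>Re s\<bar> * L + (a - Re s) * ln 2 + \<bar>Im s\<bar> * pi) + - a * D1"
      by (simp add: ReW algebra_simps)
    hence "exp (Re (s * W z)) \<le> Mf * exp (- a * D1)" unfolding Mf_def exp_add[symmetric] by simp
    moreover have "cmod (P z) = exp (- a * D1)" using z nz by (simp add: P_def norm_exp_eq_Re D1_def)
    ultimately show ?thesis using z by (simp add: f_def norm_exp_eq_Re)
  qed
  have f: "f \<in> hardy2" by (rule hardy2_comparison(1)[OF P bf le]) (simp_all add: Mf_def)
  have fE: "(\<lambda>z. f z * E z ^ j) \<in> eigenspace hardy2 (comp_op \<phi>) \<mu>'" for j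
  proof -
    have "holomorphic_fun_on (\<lambda>z. f z * E z ^ j) (ball 0 1)"
      using bf by (intro holomorphic_fun_intros holomorphic_E) (simp add: ball_hol_def)
    hence b: "ball_hol (\<lambda>z. f z * E z ^ j)" using bf by (simp add: ball_hol_def)
    have "(\<lambda>z. f z * E z ^ j) \<in> hardy2"
    proof (rule hardy2_comparison(1)[OF f b])
      fix z :: "complex ^ 'n" assume z: "norm z < 1"
      have "cmod (E z) ^ j \<le> exp (2 * pi / \<gamma> * pi) ^ j" by (intro power_mono E_bound z) simp
      thus "cmod (f z * E z ^ j) \<le> exp (2 * pi / \<gamma> * pi) ^ j * cmod (f z)"
        unfolding norm_mult norm_power by (metis mult.commute mult_right_mono norm_ge_zero)
    qed simp
    moreover have "comp_op \<phi> (\<lambda>z. f z * E z ^ j) = cscale \<mu>' (\<lambda>z. f z * E z ^ j)"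
    proof
      fix z
      show "comp_op \<phi> (\<lambda>z. f z * E z ^ j) z = cscale \<mu>' (\<lambda>z. f z * E z ^ j) z"
      proof (cases "z \<in> ball 0 1")
        case True
        hence z: "norm z < 1" by simp
        have "f (\<phi> z) = \<mu>' * f z"
          using maps[OF True] True W_comp[OF z] s by (simp add: f_def distrib_left exp_add)
        thus ?thesis using True E_comp[OF z] by (simp add: comp_op_def cscale_def)
      next
        case False
        thus ?thesis by (simp add: comp_op_def cscale_def f_def)
      qed
    qed
    ultimately show ?thesis by (simp add: eigenspace_def)
  qed
  have "{z. f z \<noteq> 0} = ball 0 1" by (auto simp: f_def)
  hence "infinite (E ` {z. f z \<noteq> 0})" using infinite_E by simp
  with fE show ?thesis by (rule infinite_dimensional_powers)
qed

text \<open>Two points with the same image give a kernel vector of the linear map on pairs. The dual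
  eigenvector for 0 is an affine function \<open>l\<close> that vanishes on the image of the ball,
  so the composition operator annihilates all multiples of \<open>l\<close>.\<close>

lemma kernel_infinite:
  assumes ninj: "\<not> inj_on \<phi> (ball 0 1)"
  shows "infinite_dimensional (eigenspace hardy2 (comp_op \<phi>) 0)"
proof -
  obtain x y where xy: "x \<in> ball 0 1" "y \<in> ball 0 1" "x \<noteq> y" "\<phi> x = \<phi> y"
    using ninj by (auto simp: inj_on_def)
  have nQ: "Q x 1 \<noteq> 0" "Q y 1 \<noteq> 0" using xy by (auto intro!: Q_nonzero)
  have M\<phi>: "M z 1 = Q z 1 *s \<phi> z" if "Q z 1 \<noteq> 0" for z
    using that by (simp add: lin_frac_eq vector_smult_assoc)
  \<comment> \<open>The combination of \<open>(x, 1)\<close> and \<open>(y, 1)\<close> whose images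
    under the linear map cancel.\<close>
  define x0 where "x0 = Q y 1 *s x + (- Q x 1) *s y"
  define t0 where "t0 = Q y 1 * 1 + (- Q x 1) * 1"
  have "M x0 t0 = Q y 1 *s M x 1 + (- Q x 1) *s M y 1"
    unfolding x0_def t0_def by (simp only: M_add M_smult)
  hence "M x0 t0 = 0 *s x0"
    unfolding M\<phi>[OF nQ(1)] M\<phi>[OF nQ(2)] xy(4) by (simp add: vector_smult_assoc vec_eq_iff)
  moreover have "Q x0 t0 = 0 * t0"
    unfolding x0_def t0_def by (simp only: Q_add Q_smult) simp
  moreover have "(x0, t0) \<noteq> 0"
  proof
    assume "(x0, t0) = 0"
    hence 0: "x0 = 0" "Q y 1 = Q x 1" by (auto simp: zero_prod_def t0_def)
    hence "Q x 1 *s (x - y) = 0" by (simp add: x0_def vec_eq_iff algebra_simps)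
    thus False using nQ xy(3) by simp
  qed
  ultimately obtain u c where uc: "(u, c) \<noteq> 0"
    and L0: "\<And>x t. cinner (M x t) u + Q x t * cnj c = 0 * (cinner x u + t * cnj c)"
    using dual_eigenvector[of x0 t0 0] by blast
  define l where "l z = cinner z u + cnj c" for z
  have l\<phi>: "l (\<phi> z) = 0" if "norm z \<le> 1" for z
    using L0[of z 1] Q_nonzero[OF that] by (simp add: l_def lin_frac_eq cinner_simps field_simps)
  have u0: "u \<noteq> 0"
  proof
    assume "u = 0"
    moreover have "l (\<phi> 0) = 0" by (rule l\<phi>) simp
    ultimately show False using uc by (simp add: l_def zero_prod_def)
  qed
  define f where "f z = (if z \<in> ball 0 1 then l z else 0)" for z
  define G where "G z = cinner z u" for z
  have fG: "(\<lambda>z. f z * G z ^ j) \<in> eigenspace hardy2 (comp_op \<phi>) 0" for j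
  proof -
    have eq: "(\<lambda>z. f z * G z ^ j) = (\<lambda>z. if z \<in> ball 0 1 then l z * G z ^ j else 0)"
      by (auto simp: f_def)
    have b: "ball_hol (\<lambda>z. f z * G z ^ j)"
      unfolding eq unfolding l_def G_def by (intro ball_hol_cut holomorphic_fun_intros)
    define O1 where "O1 = (\<lambda>z :: complex ^ 'n. if z \<in> ball 0 1 then (1 :: complex) else 0)"
    have "O1 \<in> hardy2"
    proof (rule hardy2I(1)[where M = 1])
      show "ball_hol O1" unfolding O1_def by (intro ball_hol_cut holomorphic_fun_intros)
      fix r :: real assume r: "0 < r" "r < 1"
      have "square_mean O1 r \<le> (\<integral>\<zeta>. 1 \<partial>(sphere_measure :: (complex ^ 'n) measure))"
        unfolding square_mean_def by (rule integral_mono') (auto simp: O1_def)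
      thus "square_mean O1 r \<le> 1\<^sup>2" by simp
    qed simp
    hence "(\<lambda>z. f z * G z ^ j) \<in> hardy2"
    proof (rule hardy2_comparison(1)[OF _ b])
      fix z :: "complex ^ 'n" assume z: "norm z < 1"
      have Gz: "cmod (G z) \<le> norm u"
        using cmod_cinner_le[of z u] mult_right_mono[of "norm z" 1 "norm u"] z by (simp add: G_def)
      have "cmod (l z) \<le> norm u + cmod c"
        using norm_triangle_ineq[of "G z" "cnj c"] Gz by (simp add: l_def G_def)
      hence "cmod (l z) * cmod (G z) ^ j \<le> (norm u + cmod c) * norm u ^ j"
        using Gz by (intro mult_mono power_mono) auto
      thus "cmod (f z * G z ^ j) \<le> ((norm u + cmod c) * norm u ^ j) * cmod (O1 z)"
        using z by (simp add: f_def O1_def norm_mult norm_power)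
    qed simp
    moreover have "comp_op \<phi> (\<lambda>z. f z * G z ^ j) = cscale 0 (\<lambda>z. f z * G z ^ j)"
      using l\<phi> by (auto simp: comp_op_def cscale_def f_def fun_eq_iff)
    ultimately show ?thesis by (simp add: eigenspace_def)
  qed
  have "infinite (G ` {z. f z \<noteq> 0})"
  proof
    assume fin: "finite (G ` {z. f z \<noteq> 0})"
    \<comment> \<open>Points \<open>z\<close> on the ray of \<open>u\<close> with
      \<open>G z = p\<close> below \<open>\<delta> * (norm u)\<^sup>2\<close> have norm less than
      1/2, and \<open>l z = 0\<close> is possible only for \<open>p = - Re c\<close>.\<close>
    define \<delta> where "\<delta> = 1 / (2 * norm u)"
    have \<delta>: "0 < \<delta>" using u0 by (simp add: \<delta>_def)
    have "complex_of_real ` ({0<..<\<delta> * (norm u)\<^sup>2} - {- Re c}) \<subseteq> G ` {z. f z \<noteq> 0}"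
    proof
      fix w assume "w \<in> complex_of_real ` ({0<..<\<delta> * (norm u)\<^sup>2} - {- Re c})"
      then obtain p where "w = of_real p" "p \<in> {0<..<\<delta> * (norm u)\<^sup>2} - {- Re c}" by blast
      hence p: "w = of_real p" "0 < p" "p < \<delta> * (norm u)\<^sup>2" "p \<noteq> - Re c" by auto
      define z where "z = (p / (norm u)\<^sup>2) *\<^sub>R u"
      have Gz: "G z = of_real p"
        using u0 by (simp add: G_def z_def cinner_simps cinner_self del: of_real_power)
      have "norm z = p / norm u" using p u0 by (simp add: z_def power2_eq_square)
      also have "\<dots> < 1" using p(2,3) u0 by (simp add: \<delta>_def power2_eq_square divide_less_eq)
      finally have "z \<in> ball 0 1" by simp
      moreover have "l z \<noteq> 0"
      proof
        assume "l z = 0"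
        hence "of_real p = - cnj c" using Gz by (simp add: l_def G_def eq_neg_iff_add_eq_0)
        hence "Re (of_real p) = Re (- cnj c)" by (simp only:)
        thus False using p(4) by simp
      qed
      ultimately have "z \<in> {z. f z \<noteq> 0}" by (simp add: f_def)
      thus "w \<in> G ` {z. f z \<noteq> 0}" using Gz p(1) by (metis imageI)
    qed
    hence "finite (complex_of_real ` ({0<..<\<delta> * (norm u)\<^sup>2} - {- Re c}))" using fin finite_subset by blast
    hence "finite ({0<..<\<delta> * (norm u)\<^sup>2} - {- Re c})"
      by (rule finite_imageD) (auto simp: inj_on_def)
    hence "finite {0<..<\<delta> * (norm u)\<^sup>2}" by simp
    thus False using \<delta> u0 infinite_Ioo[of 0 "\<delta> * (norm u)\<^sup>2"] by simp
  qed
  with fG show ?thesis by (rule infinite_dimensional_powers)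
qed

text \<open>Also 0 and the points of the circle are limits of nonzero points inside the disc, which
  have infinite-dimensional eigenspaces.\<close>

lemma not_essentially_invertible_inside:
  assumes "cmod \<mu>' \<le> R"
  shows "\<not> essentially_invertible_op hardy2 hardy2_norm (\<lambda>f. comp_op \<phi> f - cscale \<mu>' f)"
proof (rule not_essentially_invertible)
  fix e :: real assume e: "0 < e"
  show "\<exists>\<nu>. cmod (\<nu> - \<mu>') < e \<and> infinite_dimensional (eigenspace hardy2 (comp_op \<phi>) \<nu>)"
  proof (cases "\<mu>' = 0")
    case True
    define \<nu> where "\<nu> = complex_of_real (min e R / 2)"
    have "0 < min e R / 2" "min e R / 2 < e" "min e R / 2 < R" using e R_pos by (auto simp: min_def)
    hence "\<nu> \<noteq> 0" "cmod \<nu> < R" "cmod (\<nu> - \<mu>') < e" using True by (auto simp: \<nu>_def simp del: of_real_divide)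
    thus ?thesis using eigenspace_infinite by blast
  next
    case False
    \<comment> \<open>Shrinks \<open>\<mu>'\<close> by less than \<open>e\<close>, with a factor of
      at least 1/2 that keeps it nonzero.\<close>
    define p where "p = min (1/2) (e / (2 * cmod \<mu>'))"
    have p: "0 < p" "p < 1" "p * cmod \<mu>' < e"
    proof -
      have "p * cmod \<mu>' \<le> e / (2 * cmod \<mu>') * cmod \<mu>'" unfolding p_def by (intro mult_right_mono) auto
      thus "p * cmod \<mu>' < e" using e False by simp
    qed (use e False in \<open>auto simp: p_def\<close>)
    define \<nu> where "\<nu> = of_real (1 - p) * \<mu>'"
    have "\<nu> \<noteq> 0" using p False by (simp add: \<nu>_def)
    moreover have "cmod \<nu> < R"
    proof -
      have "cmod \<nu> = (1 - p) * cmod \<mu>'" using p unfolding \<nu>_def norm_mult norm_of_real by simp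
      also have "\<dots> < 1 * cmod \<mu>'" using p False by (intro mult_strict_right_mono) auto
      finally show ?thesis using assms by simp
    qed
    moreover have "cmod (\<nu> - \<mu>') < e"
    proof -
      have "\<nu> - \<mu>' = - (of_real p * \<mu>')" by (simp add: \<nu>_def algebra_simps)
      thus ?thesis using p by (simp add: norm_mult)
    qed
    ultimately show ?thesis using eigenspace_infinite by blast
  qed
qed

text \<open>Invertibility outside the disc and essential non-invertibility on it settle both spectra
  at once, since invertible operators are essentially invertible.\<close>

lemma spectra:
  "op_spectrum hardy2 hardy2_norm (comp_op \<phi>) = {\<mu>'. cmod \<mu>' \<le> R}"
  "op_essential_spectrum hardy2 hardy2_norm (comp_op \<phi>) = {\<mu>'. cmod \<mu>' \<le> R}"
proof -
  have "invertible_op hardy2 hardy2_norm (\<lambda>f. comp_op \<phi> f - cscale \<mu>' f)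
      \<longleftrightarrow> \<not> cmod \<mu>' \<le> R" and "essentially_invertible_op hardy2 hardy2_norm (\<lambda>f. comp_op \<phi> f - cscale \<mu>' f)
      \<longleftrightarrow> \<not> cmod \<mu>' \<le> R" for \<mu>'
    using invertible_outside[of \<mu>'] not_essentially_invertible_inside[of \<mu>']
      invertible_imp_essentially_invertible[of "\<lambda>f. comp_op \<phi> f - cscale \<mu>' f"] by force+
  thus "op_spectrum hardy2 hardy2_norm (comp_op \<phi>) = {\<mu>'. cmod \<mu>' \<le> R}"
    "op_essential_spectrum hardy2 hardy2_norm (comp_op \<phi>) = {\<mu>'. cmod \<mu>' \<le> R}"
    unfolding op_spectrum_def op_essential_spectrum_def by auto
qed

end

text \<open>A function annihilated by the operator vanishes on the image of the ball. If
  \<open>\<phi>\<close> is injective there, the image is open by invariance of domain, the function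
  is 0 by the identity theorem, and 0 is not an eigenvalue. The map (z + 1) / 2 of the unit disc,
  with \<alpha> = 1/2 and the only boundary fixed point 1, is of this kind. So for the value 0
  eigenfunctions are claimed for non-injective maps only.\<close>

theorem theorem3p2:
  fixes \<phi> :: "complex ^ 'n \<Rightarrow> complex ^ 'n" and \<tau> :: "complex ^ 'n" and \<alpha> :: real
  assumes "\<phi> \<in> LFM"
    and "hyperbolic \<phi>"
    and "\<not> ball_automorphism \<phi>"
    and "\<exists>!\<zeta>. \<zeta> \<in> sphere 0 1 \<and> \<phi> \<zeta> = \<zeta>"
    and "denjoy_wolff \<phi> \<tau> \<alpha>"
  shows "op_spectrum hardy2 hardy2_norm (comp_op \<phi>)
           = {\<mu>. cmod \<mu> \<le> \<alpha> powr (- real CARD('n) / 2)} \<and>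
         op_essential_spectrum hardy2 hardy2_norm (comp_op \<phi>)
           = {\<mu>. cmod \<mu> \<le> \<alpha> powr (- real CARD('n) / 2)} \<and>
         (\<forall>\<mu>. cmod \<mu> < \<alpha> powr (- real CARD('n) / 2) \<and>
              (\<mu> = 0 \<longrightarrow> \<not> inj_on \<phi> (ball 0 1)) \<longrightarrow>
           op_eigenvalue hardy2 (comp_op \<phi>) \<mu> \<and>
           infinite_dimensional (eigenspace hardy2 (comp_op \<phi>) \<mu>))"
proof -
  obtain A B C d where \<phi>: "\<phi> = lin_frac A B C d" and den: "\<And>z. z \<in> ball 0 1 \<Longrightarrow> cinner z C + d \<noteq> 0"
    and maps: "\<phi> ` ball 0 1 \<subseteq> ball 0 1"
    using assms(1) unfolding LFM_def by blast
  have nofix: "\<And>z. z \<in> ball 0 1 \<Longrightarrow> \<phi> z \<noteq> z"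
    using assms(2) unfolding hyperbolic_def no_interior_fixpoint_def by blast
  obtain D where \<tau>: "\<tau> \<in> sphere 0 1" "\<phi> \<tau> = \<tau>" "0 < \<alpha>"
    and D: "(\<phi> has_derivative D) (at \<tau>)" "cinner (D \<tau>) \<tau> = of_real \<alpha>"
    using assms(5) unfolding denjoy_wolff_def by blast
  \<comment> \<open>Hyperbolicity comes with a point and a coefficient of its own; uniqueness of the
    fixed point and of the derivative identifies them with \<open>\<tau>\<close> and
    \<open>\<alpha>\<close>, so that \<open>\<alpha> < 1\<close>.\<close>
  obtain \<tau>' \<alpha>' D' where \<tau>': "\<tau>' \<in> sphere 0 1" "\<phi> \<tau>' = \<tau>'" "\<alpha>' < 1"
    and D': "(\<phi> has_derivative D') (at \<tau>')" "cinner (D' \<tau>') \<tau>' = of_real \<alpha>'"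
    using assms(2) unfolding hyperbolic_def denjoy_wolff_def by blast
  have uniq: "\<zeta> = \<tau>" if "\<zeta> \<in> sphere 0 1" "\<phi> \<zeta> = \<zeta>" for \<zeta>
    using assms(4) \<tau> that by blast
  have "\<tau>' = \<tau>" using \<tau>' by (intro uniq)
  hence "D' = D" using has_derivative_unique[OF D'(1)] D(1) by simp
  hence "\<alpha>' = \<alpha>" using D(2) D'(2) \<open>\<tau>' = \<tau>\<close> by simp
  hence \<alpha>1: "\<alpha> < 1" using \<tau>'(3) by simp
  interpret hyperbolic_lf A B C d \<tau> \<alpha>
  proof
    show "cinner z C + d \<noteq> 0" if "z \<in> ball 0 1" for z by (rule den[OF that])
    show "lin_frac A B C d z \<in> ball 0 1" if "z \<in> ball 0 1" for z using maps that unfolding \<phi> by blast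
    show "norm \<tau> = 1" using \<tau>(1) by simp
    show "lin_frac A B C d \<tau> = \<tau>" using \<tau>(2) unfolding \<phi> .
    show "0 < \<alpha>" "\<alpha> < 1" by (rule \<tau>(3), rule \<alpha>1)
    show "\<exists>D. (lin_frac A B C d has_derivative D) (at \<tau>) \<and> cinner (D \<tau>) \<tau> = of_real \<alpha>"
      using D unfolding \<phi> by blast
    show "z = \<tau>" if "z \<in> cball 0 1" "lin_frac A B C d z = z" for z
    proof (cases "z \<in> ball 0 1")
      case True
      thus ?thesis using nofix[OF True] that(2) unfolding \<phi> by simp
    next
      case False
      hence "z \<in> sphere 0 1" using that(1) by simp
      thus ?thesis using that(2) unfolding \<phi>[symmetric] by (rule uniq)
    qed
  qed
  have inf: "infinite_dimensional (eigenspace hardy2 (comp_op \<phi>) \<mu>)"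
    if "cmod \<mu> < R" "\<mu> = 0 \<longrightarrow> \<not> inj_on \<phi> (ball 0 1)" for \<mu>
    using that eigenspace_infinite[of \<mu>] kernel_infinite unfolding \<phi> by (cases "\<mu> = 0") auto
  moreover have "op_eigenvalue hardy2 (comp_op \<phi>) \<mu>"
    if "infinite_dimensional (eigenspace hardy2 (comp_op \<phi>) \<mu>)" for \<mu>
    using infinite_dimensional_nonzero[OF that] unfolding op_eigenvalue_def by blast
  ultimately show ?thesis
    using spectra unfolding R_eq \<phi>[symmetric] by blast
qed

end
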